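(* Let $k\ge1$, let $\lambda$ be a partition with $\lambda_1\le k$, so that its conjugate is $\lambda'=(\lambda_1',\ldots,\lambda_k')$, and put $L_i=\lambda_i'-\lambda_{i+1}'$ for $1\le i\le k$, with $\lambda_{k+1}'=0$, and $\mathbf{L}=(L_1,\ldots,L_k)$. Let $a$ be such that $\mu=\left(\tfrac12|\lambda|-a,\ \tfrac12|\lambda|+a\right)$ is a pair of nonnegative integers. Then $$\left[\begin{matrix}\mathbf{L}\\ a\end{matrix}\right]_t=\sum_{\eta}K_{\eta\mu}\,\widetilde K_{\eta\lambda}(t)=t^{n(\lambda)}\mathcal{P}_{\lambda\mu}(t^{-1}),$$ where the sum is over all partitions $\eta$ of $|\lambda|$.
   Context: The Schilling–Warnaar $t$-supernomial coefficient is $$\left[\begin{matrix}\mathbf{L}\\ a\end{matrix}\right]_t=\sum_{j_1+\cdots+j_k=a+\frac{|\lambda|}{2}}t^{\sum_{l=2}^k j_{l-1}(L_l+\cdots+L_k-j_l)}\left[\begin{matrix}L_k\\ j_k\end{matrix}\right]_t\left[\begin{matrix}L_{k-1}+j_k\\ j_{k-1}\end{matrix}\right]_t\cdots\left[\begin{matrix}L_1+j_2\\ j_1\end{matrix}\right]_t,$$ summed over nonnegative integers $j_1,\ldots,j_k$ (note $|\lambda|=\sum_{i=1}^k iL_i$), where $\left[\begin{matrix}N\\ m\end{matrix}\right]_t=\frac{(t;t)_N}{(t;t)_m(t;t)_{N-m}}$ for $0\le m\le N$ and $0$ otherwise, $(t;t)_m=\prod_{j=1}^m(1-t^j)$. $K_{\eta\lambda}(t)$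 is the Kostka–Foulkes polynomial, defined by $s_\eta(x)=\sum_\lambda K_{\eta\lambda}(t)P_\lambda(x;t)$ with $s_\eta$ Schur functions and $P_\lambda(x;t)$ Hall–Littlewood functions; $\widetilde K_{\eta\lambda}(t)=t^{n(\lambda)}K_{\eta\lambda}(t^{-1})$ with $n(\lambda)=\sum_{i\ge1}(i-1)\lambda_i$; for a composition $\mu$, $K_{\eta\mu}$ is the Kostka number, the number of semistandard Young tableaux of shape $\eta$ and weight $\mu$; $\mathcal{P}_{\lambda\mu}(t)=\sum_\eta K_{\eta\mu}K_{\eta\lambda}(t)$. *)

theory Defs
  imports
    "HOL-Library.Poly_Mapping"
    "HOL-Library.FuncSet"
    "HOL-Combinatorics.Permutations"
    "HOL-Computational_Algebra.Polynomial_Factorial"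
begin

section \<open>Partitions\<close>

text \<open>A partition is the weakly decreasing list of its positive parts.\<close>

definition is_partition :: "nat list \<Rightarrow> bool" where
  "is_partition lam \<longleftrightarrow> sorted_wrt (\<ge>) lam \<and> 0 \<notin> set lam"

definition partitions_of :: "nat \<Rightarrow> nat list set" where
  "partitions_of n = {lam. is_partition lam \<and> sum_list lam = n}"

text \<open>Parts are indexed from \<open>0\<close> here, so \<open>part lam i\<close> is \<open>\<lambda>\<^sub>i\<^sub>+\<^sub>1\<close>.\<close>

definition part :: "nat list \<Rightarrow> nat \<Rightarrow> nat" where
  "part lam i = (if i < length lam then lam ! i else 0)"

text \<open>The argument \<open>i\<close> of \<open>conj_part\<close> starts at \<open>1\<close>: \<open>conj_part lam i\<close> is \<open>\<lambda>'\<^sub>i\<close>.\<close>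

definition conj_part :: "nat list \<Rightarrow> nat \<Rightarrow> nat" where
  "conj_part lam i = card {r. r < length lam \<and> i \<le> lam ! r}"

definition n_stat :: "nat list \<Rightarrow> nat" where
  "n_stat lam = (\<Sum>i<length lam. i * lam ! i)"


section \<open>Kostka numbers\<close>

definition diagram :: "nat list \<Rightarrow> (nat \<times> nat) set" where
  "diagram eta = {(r, c). r < length eta \<and> c < eta ! r}"

text \<open>Fillings are normalised to be \<open>0\<close> outside the diagram, so that distinct functions
  are distinct tableaux.\<close>

definition ssyt :: "nat list \<Rightarrow> (nat \<times> nat \<Rightarrow> nat) set" where
  "ssyt eta = {T.
     (\<forall>x. x \<notin> diagram eta \<longrightarrow> T x = 0) \<and>
     (\<forall>x \<in> diagram eta. 1 \<le> T x) \<and>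
     (\<forall>r c c'. (r, c) \<in> diagram eta \<and> (r, c') \<in> diagram eta \<and> c \<le> c' \<longrightarrow> T (r, c) \<le> T (r, c')) \<and>
     (\<forall>r r' c. (r, c) \<in> diagram eta \<and> (r', c) \<in> diagram eta \<and> r < r' \<longrightarrow> T (r, c) < T (r', c))}"

text \<open>The weight is a composition: the entry \<open>i + 1\<close> occurs \<open>mu ! i\<close> times, and no entry
  exceeds \<open>length mu\<close>.\<close>

definition kostka_number :: "nat list \<Rightarrow> nat list \<Rightarrow> nat" where
  "kostka_number eta mu =
     card {T \<in> ssyt eta. \<forall>i. card {x \<in> diagram eta. T x = i + 1} = part mu i}"


section \<open>Schur functions and Hall--Littlewood functions\<close>

text \<open>Symmetric functions are handled as in Macdonald's book, through their images in finitely
  many variables: a symmetric function \<open>f\<close> is the family of the \<open>f(x\<^sub>0, \<dots>, x\<^sub>n\<^sub>-\<^sub>1)\<close>, and an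
  identity of symmetric functions is an identity of these for all \<open>n\<close>. They are computed in the
  fraction field of \<open>\<int>[t][x\<^sub>0, x\<^sub>1, \<dots>]\<close>, where a monomial in the \<open>x\<^sub>i\<close> is a finitely supported
  exponent vector and the coefficient type \<open>int poly\<close> is \<open>\<int>[t]\<close>.\<close>

type_synonym xpoly = "(nat \<Rightarrow>\<^sub>0 nat) \<Rightarrow>\<^sub>0 int poly"

definition coef :: "int poly \<Rightarrow> xpoly fract" where
  "coef p = to_fract (Poly_Mapping.single 0 p)"

definition xvar :: "nat \<Rightarrow> xpoly fract" where
  "xvar i = to_fract (Poly_Mapping.single (Poly_Mapping.single i 1) 1)"

definition tvar :: "xpoly fract" where
  "tvar = coef [:0, 1:]"

definition alternant :: "nat \<Rightarrow> (nat \<Rightarrow> nat) \<Rightarrow> xpoly fract" where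
  "alternant n al =
     (\<Sum>w | w permutes {..<n}. of_int (sign w) * (\<Prod>i<n. xvar (w i) ^ al i))"

definition schur :: "nat \<Rightarrow> nat list \<Rightarrow> xpoly fract" where
  "schur n eta =
     (if length eta \<le> n
      then alternant n (\<lambda>i. part eta i + (n - 1 - i)) / alternant n (\<lambda>i. n - 1 - i)
      else 0)"

text \<open>\<open>v\<^sub>m(t)\<close> and \<open>v\<^sub>\<lambda>(t) = \<Prod>\<^bsub>i\<ge>0\<^esub> v\<^bsub>m\<^sub>i\<^esub>(t)\<close> in Macdonald's notation, where \<open>m\<^sub>0 = n - \<ell>(\<lambda>)\<close>
  is the number of zero parts of \<open>\<lambda>\<close> padded to length \<open>n\<close>.\<close>

definition v_fac :: "nat \<Rightarrow> xpoly fract" where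
  "v_fac m = (\<Prod>j=1..m. (1 - tvar ^ j) / (1 - tvar))"

definition v_part :: "nat \<Rightarrow> nat list \<Rightarrow> xpoly fract" where
  "v_part n lam = v_fac (n - length lam) * (\<Prod>i \<in> set lam. v_fac (count_list lam i))"

definition hall_littlewood_P :: "nat \<Rightarrow> nat list \<Rightarrow> xpoly fract" where
  "hall_littlewood_P n lam =
     (if length lam \<le> n
      then (\<Sum>w | w permutes {..<n}.
              (\<Prod>i<n. xvar (w i) ^ part lam i) *
              (\<Prod>j<n. \<Prod>i<j. (xvar (w i) - tvar * xvar (w j)) / (xvar (w i) - xvar (w j))))
           / v_part n lam
      else 0)"


section \<open>Kostka--Foulkes polynomials\<close>

text \<open>\<open>kostka_foulkes eta lam\<close> is \<open>K\<^sub>\<eta>\<^sub>\<lambda>(t)\<close>, the coefficient of \<open>P\<^sub>\<lambda>(x;t)\<close> in the (finite)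
  expansion of \<open>s\<^sub>\<eta>(x)\<close>; the same coefficients serve for every number \<open>n\<close> of variables.\<close>

definition kostka_foulkes :: "nat list \<Rightarrow> nat list \<Rightarrow> int poly" where
  "kostka_foulkes eta = (THE K.
     finite {lam. K lam \<noteq> 0} \<and>
     (\<forall>lam. K lam \<noteq> 0 \<longrightarrow> is_partition lam) \<and>
     (\<forall>n. schur n eta = (\<Sum>lam | K lam \<noteq> 0. coef (K lam) * hall_littlewood_P n lam)))"

definition cal_P :: "nat list \<Rightarrow> nat list \<Rightarrow> int poly" where
  "cal_P lam mu =
     (\<Sum>eta \<in> partitions_of (sum_list lam). of_nat (kostka_number eta mu) * kostka_foulkes eta lam)"

definition eval_int_poly :: "int poly \<Rightarrow> 'a :: field \<Rightarrow> 'a" where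
  "eval_int_poly p x = poly (map_poly of_int p) x"

definition kostka_foulkes_tilde :: "nat list \<Rightarrow> nat list \<Rightarrow> 'a :: field \<Rightarrow> 'a" where
  "kostka_foulkes_tilde eta lam t = t ^ n_stat lam * eval_int_poly (kostka_foulkes eta lam) (inverse t)"


section \<open>Supernomial coefficients\<close>

definition t_pochhammer :: "'a :: field \<Rightarrow> nat \<Rightarrow> 'a" where
  "t_pochhammer t m = (\<Prod>j=1..m. 1 - t ^ j)"

definition t_binomial :: "'a :: field \<Rightarrow> nat \<Rightarrow> nat \<Rightarrow> 'a" where
  "t_binomial t N m =
     (if m \<le> N then t_pochhammer t N / (t_pochhammer t m * t_pochhammer t (N - m)) else 0)"

text \<open>\<open>L\<close> and \<open>j\<close> are indexed by \<open>1, \<dots>, k\<close>. The exponent of \<open>t\<close> is an integer that can be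
  negative (only in terms that vanish), hence \<open>powi\<close>. The parameter \<open>a\<close> may be a half-integer.\<close>

definition supernomial :: "'a :: field \<Rightarrow> nat \<Rightarrow> (nat \<Rightarrow> nat) \<Rightarrow> rat \<Rightarrow> 'a" where
  "supernomial t k L a =
     (\<Sum>j | j \<in> {1..k} \<rightarrow>\<^sub>E (UNIV :: nat set) \<and>
            of_nat (\<Sum>l=1..k. j l) = a + of_nat (\<Sum>i=1..k. i * L i) / 2.
        t powi (\<Sum>l=2..k. int (j (l - 1)) * (int (\<Sum>i=l..k. L i) - int (j l))) *
        t_binomial t (L k) (j k) *
        (\<Prod>l=1..<k. t_binomial t (L l + j (l + 1)) (j l)))"

text \<open>The indeterminate of \<open>\<rat>(t)\<close>, the fraction field of \<open>\<int>[t]\<close>.\<close>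

definition t_indet :: "int poly fract" where
  "t_indet = to_fract [:0, 1:]"

end

(* The Kostka number K_{eta,mu} is the coefficient of s_eta in h_{mu_1} h_{mu_2}, so P_{lambda,mu}(t)
   is the coefficient of P_lambda(x;t) in h_{mu_1} h_{mu_2}. The latter is computed with the Pieri rule
   for h_r P_nu, applied twice starting from P_0 = 1; the intermediate partition nu gives the
   summation variables j_l = lambda'_l - nu'_l.

   The Pieri rule is proved column by column. Removing the first column of lambda gives
     P_lambda(X) = sum over S of size lambda'_1 of x^S Delta(S, X - S) P_{lambda^-}(S),
     Delta(S, R) = prod_{a in S, b in R} (x_a - t x_b)/(x_a - x_b),
   and Delta satisfies the cocycle identity
     Delta(A, B u C) Delta(B, C) = Delta(A u B, C) Delta(A, B),
   so that everything reduces to sum_{|T|=p} Delta(T, S - T) = [|S| choose p]_t and to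
     prod_{b in Y} 1/(1 - x_b v) = sum_S t^{|S|(|S|-1)/2} v^|S| x^S Delta(S, Y - S) prod_{b in S} 1/(1 - x_b v),
   which follow from Lagrange interpolation and the q-binomial theorem.

   At t = 0 the Hall-Littlewood functions are the Schur functions and the Pieri rule is the one for
   Schur functions. Comparing the two expansions of h_p h_{N-p} gives the Kostka-Foulkes polynomials
   of all two-row shapes; no other shape has a tableau of weight mu. *)

theory Submission
  imports
    Defs
    "HOL-Computational_Algebra.Computational_Algebra"
    "HOL-Combinatorics.Combinatorics"
begin


section \<open>Gaussian binomial coefficients\<close>

text \<open>A permutation moves all variables at once, which hides the column structure. But the
  orderings of the variables with exponent zero only contribute a constant \<open>v_m(t)\<close>, so
  a Hall-Littlewood function is a sum over chains of subsets.

  Kostka-Foulkes polynomials are given by a definite description: nothing is known of them until an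
  expansion is exhibited and shown unique. Existence comes from
  \<open>s_(q,N-q) = h_q h_(N-q) - h_(q+1) h_(N-q-1)\<close>; uniqueness is linear independence,
  read off modulo \<open>t\<close>, where the numerators become alternants.

  The same coefficients are needed at \<open>t = 0\<close>, in \<open>\<int>[t]\<close>, in the
  field containing the \<open>x_i\<close>, and at \<open>1/t\<close>. Hence they are defined without
  division over commutative rings and carried along ring homomorphisms.

  The passage to \<open>1/t\<close> produces the supernomial: for \<open>c = m + d\<close> the
  identity \<open>(c choose 2) = (m choose 2) + (d choose 2) + m d\<close>, together with the
  reversal of a Gaussian binomial, leaves exactly its quadratic exponent.\<close>

fun gauss :: "'a::comm_ring_1 \<Rightarrow> nat \<Rightarrow> nat \<Rightarrow> 'a" where
  "gauss t n 0 = 1"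
| "gauss t 0 (Suc p) = 0"
| "gauss t (Suc n) (Suc p) = gauss t n p + t ^ Suc p * gauss t n (Suc p)"

lemma gauss_eq_0: "n < p \<Longrightarrow> gauss t n p = 0"
  by (induction t n p rule: gauss.induct) auto

lemma gauss_self [simp]: "gauss t n n = 1"
  by (induction n) (auto simp: gauss_eq_0)

lemma gauss_at_0: "p \<le> n \<Longrightarrow> gauss 0 n p = (1 :: 'a::comm_ring_1)"
proof (induction n arbitrary: p)
  case (Suc n p)
  then show ?case by (cases p) auto
qed auto

text \<open>This is the q-binomial expansion of the product of \<open>1 - t^i\<close> over
  \<open>i < n\<close>, which contains the factor \<open>1 - t^0 = 0\<close>. Since
  \<open>t^(Suc p choose 2) = t^(p choose 2) t^p\<close>, the Pascal recursion makes the sum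
  telescope.\<close>

lemma sum_alternating_gauss:
  fixes t :: "'a::comm_ring_1"
  shows "(\<Sum>p\<le>n. (-1) ^ p * t ^ (p choose 2) * gauss t n p) = (if n = 0 then 1 else 0)"
proof (cases n)
  case (Suc m)
  let ?f = "\<lambda>p. (-1) ^ p * t ^ (p choose 2) * t ^ p * gauss t m p"
  have "(\<Sum>p\<le>n. (-1) ^ p * t ^ (p choose 2) * gauss t n p)
      = 1 + (\<Sum>p\<le>m. (-1) ^ Suc p * t ^ (Suc p choose 2) * gauss t (Suc m) (Suc p))"
    unfolding Suc by (subst sum.atMost_Suc_shift) (simp add: numeral_2_eq_2)
  also have "(\<Sum>p\<le>m. (-1) ^ Suc p * t ^ (Suc p choose 2) * gauss t (Suc m) (Suc p))
      = (\<Sum>p\<le>m. ?f (Suc p)) - (\<Sum>p\<le>m. ?f p)"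
    unfolding sum_subtractf[symmetric]
    by (rule sum.cong) (simp_all add: numeral_2_eq_2 power_add algebra_simps)
  also have "(\<Sum>p\<le>m. ?f (Suc p)) = (\<Sum>p\<le>Suc m. ?f p) - ?f 0"
    by (subst sum.atMost_Suc_shift) simp
  also have "(\<Sum>p\<le>Suc m. ?f p) = (\<Sum>p\<le>m. ?f p)"
    by (simp add: gauss_eq_0)
  finally show ?thesis using Suc by (simp add: numeral_2_eq_2)
qed (simp add: numeral_2_eq_2)

section \<open>Quotient form of the Gaussian binomials and the substitution of \<open>1/t\<close>
  for \<open>t\<close>\<close>

lemma t_pochhammer_Suc: "t_pochhammer t (Suc m) = t_pochhammer t m * (1 - t ^ Suc m)"
  by (simp add: t_pochhammer_def)

lemma t_pochhammer_0 [simp]: "t_pochhammer t 0 = 1"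
  by (simp add: t_pochhammer_def)

lemma gauss_times_t_pochhammer:
  "p \<le> n \<Longrightarrow> gauss t n p * t_pochhammer t p * t_pochhammer t (n - p) = t_pochhammer t n"
proof (induction t n p rule: gauss.induct)
  case (3 t n p)
  show ?case
  proof (cases "p = n")
    case False
    then have IH1: "gauss t n p * t_pochhammer t p * t_pochhammer t (n - p) = t_pochhammer t n"
      and IH2: "gauss t n (Suc p) * t_pochhammer t (Suc p) * t_pochhammer t (n - Suc p) = t_pochhammer t n"
      using 3 by auto
    have e: "n - p = Suc (n - Suc p)" using 3(3) False by simp
    have pw: "t ^ Suc p * t ^ (n - p) = t ^ Suc n"
      using 3(3) False by (simp flip: power_add)
    have "gauss t (Suc n) (Suc p) * t_pochhammer t (Suc p) * t_pochhammer t (Suc n - Suc p)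
        = (gauss t n p * t_pochhammer t p * t_pochhammer t (n - p)) * (1 - t ^ Suc p)
        + t ^ Suc p * (gauss t n (Suc p) * t_pochhammer t (Suc p) * t_pochhammer t (n - Suc p)) * (1 - t ^ (n - p))"
      unfolding gauss.simps t_pochhammer_Suc diff_Suc_Suc e by (simp add: algebra_simps)
    also have "\<dots> = t_pochhammer t n * (1 - t ^ Suc p * t ^ (n - p))"
      unfolding IH1 IH2 by (simp add: algebra_simps)
    finally show ?thesis unfolding pw by (simp add: t_pochhammer_Suc)
  qed (simp add: gauss_eq_0)
qed simp_all

text \<open>The parameter \<open>t = 0\<close> is allowed on purpose: there the Hall--Littlewood functions are the
  Schur functions.\<close>

definition not_root_of_unity :: "'a::field \<Rightarrow> bool" where
  "not_root_of_unity t \<longleftrightarrow> (\<forall>j>0. t ^ j \<noteq> 1)"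

lemma t_pochhammer_nonzero: "not_root_of_unity t \<Longrightarrow> t_pochhammer t n \<noteq> 0"
  by (auto simp: t_pochhammer_def not_root_of_unity_def)

lemma gauss_eq_t_binomial:
  assumes "not_root_of_unity t"
  shows "gauss t n p = t_binomial t n p"
proof (cases "p \<le> n")
  case True
  then show ?thesis
    using gauss_times_t_pochhammer[OF True, of t] t_pochhammer_nonzero[OF assms]
    by (simp add: t_binomial_def field_simps)
qed (simp add: gauss_eq_0 t_binomial_def)

lemma gauss_symmetric:
  assumes "not_root_of_unity t" "p \<le> n"
  shows "gauss t n (n - p) = gauss t n p"
  using assms by (simp add: gauss_eq_t_binomial t_binomial_def mult.commute)

text \<open>The \<open>t\<close>-analogue of absorption for binomial coefficients; it closes the
  induction on the size of the subsets in \<open>sum_ksub_D\<close>.\<close>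

lemma gauss_absorption:
  assumes "not_root_of_unity t"
  shows "(1 - t ^ Suc p) * gauss t (Suc n) (Suc p) = (1 - t ^ Suc n) * gauss t n p"
proof (cases "p \<le> n")
  case True
  have nz: "1 - t ^ Suc p \<noteq> 0"
    using assms unfolding not_root_of_unity_def by (metis eq_iff_diff_eq_0 zero_less_Suc)
  show ?thesis
    using True t_pochhammer_nonzero[OF assms] nz
    by (simp add: gauss_eq_t_binomial[OF assms] t_binomial_def t_pochhammer_Suc del: power_Suc gauss.simps)
qed (simp add: gauss_eq_0)

text \<open>Each factor turns around by \<open>t^j (1 - t^(-j)) = -(1 - t^j)\<close>, and the
  exponents add up to \<open>1 + ... + m\<close>.\<close>

lemma t_pochhammer_inverse:
  fixes t :: "'a::field"
  assumes "t \<noteq> 0"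
  shows "t ^ (Suc m choose 2) * t_pochhammer (inverse t) m = (-1) ^ m * t_pochhammer t m"
proof (induction m)
  case (Suc m)
  have "t ^ (Suc (Suc m) choose 2) * t_pochhammer (inverse t) (Suc m)
     = (t ^ (Suc m choose 2) * t_pochhammer (inverse t) m) * (t ^ Suc m * (1 - inverse t ^ Suc m))"
    unfolding t_pochhammer_Suc numeral_2_eq_2 binomial_Suc_Suc[of "Suc m"] power_add
    by (simp add: mult_ac del: power_Suc)
  also have "t ^ Suc m * (1 - inverse t ^ Suc m) = - (1 - t ^ Suc m)"
    using assms by (simp add: right_diff_distrib power_mult_distrib[symmetric] del: power_Suc)
  finally show ?case unfolding Suc.IH t_pochhammer_Suc by (simp add: algebra_simps)
qed (simp add: numeral_2_eq_2)

lemma choose_two_add: "(a + b) choose 2 = (a choose 2) + (b choose 2) + a * b"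
  by (induction a) (auto simp: numeral_2_eq_2)

lemma not_root_of_unity_inverse: "not_root_of_unity t \<Longrightarrow> not_root_of_unity (inverse t)"
  by (auto simp: not_root_of_unity_def power_inverse)

text \<open>In the quotient of Pochhammer symbols the signs cancel, and the triangular exponents of
  \<open>n\<close>, \<open>p\<close> and \<open>n - p\<close> differ by
  \<open>p (n - p)\<close>.\<close>

lemma gauss_inverse:
  assumes "not_root_of_unity t" "t \<noteq> 0" "p \<le> n"
  shows "t ^ (p * (n - p)) * gauss (inverse t) n p = gauss t n p"
proof -
  obtain q where q: "n = p + q" using assms(3) le_Suc_ex by blast
  have tinv: "not_root_of_unity (inverse t)" by (rule not_root_of_unity_inverse[OF assms(1)])
  let ?G = "gauss (inverse t) n p" and ?P = "t_pochhammer (inverse t)"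
  have c: "Suc n choose 2 = (Suc p choose 2) + (Suc q choose 2) + p * q"
    unfolding q by (induction p) (auto simp: numeral_2_eq_2)
  have "(t ^ (p * q) * ?G) * ((t ^ (Suc p choose 2) * ?P p) * (t ^ (Suc q choose 2) * ?P q))
      = t ^ (Suc n choose 2) * (?G * ?P p * ?P (n - p))"
    unfolding c power_add by (simp add: q mult_ac)
  also have "\<dots> = t ^ (Suc n choose 2) * ?P n"
    using gauss_times_t_pochhammer[OF assms(3)] by metis
  finally have "(t ^ (p * q) * ?G) * (t_pochhammer t p * t_pochhammer t q) = t_pochhammer t n"
    unfolding t_pochhammer_inverse[OF assms(2)] by (simp add: q power_add mult_ac)
  also have "\<dots> = gauss t n p * (t_pochhammer t p * t_pochhammer t q)"
    using gauss_times_t_pochhammer[OF assms(3), of t] by (simp add: q mult_ac)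
  finally show ?thesis using t_pochhammer_nonzero[OF assms(1)] by (simp add: q)
qed


section \<open>Summation over subsets of the variables\<close>

definition ksub :: "'i set \<Rightarrow> nat \<Rightarrow> 'i set set" where
  "ksub S k = {T. T \<subseteq> S \<and> card T = k}"

lemma finite_ksub [simp]: "finite S \<Longrightarrow> finite (ksub S k)"
  by (simp add: ksub_def)

lemma ksub_0: "finite S \<Longrightarrow> ksub S 0 = {{}}"
  by (auto simp: ksub_def dest: finite_subset)

lemma ksub_eq_empty: "finite S \<Longrightarrow> card S < k \<Longrightarrow> ksub S k = {}"
  by (auto simp: ksub_def dest: card_mono)

lemma sum_ksub_1: "(\<Sum>A\<in>ksub S 1. g A) = (\<Sum>a\<in>S. g {a})"
proof -
  have "ksub S 1 = (\<lambda>a. {a}) ` S" by (auto simp: ksub_def card_1_singleton_iff)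
  then show ?thesis by (simp add: sum.reindex)
qed

text \<open>Disjoint pairs \<open>(T, W)\<close> are reindexed by their union \<open>M\<close> with
  the marked subset \<open>T\<close>; in this shape the cocycle identity applies.\<close>

lemma sum_Pow_split:
  assumes "finite S"
  shows "(\<Sum>T\<in>Pow S. \<Sum>W\<in>Pow (S - T). f T W) = (\<Sum>M\<in>Pow S. \<Sum>T\<in>Pow M. f T (M - T))"
proof -
  have fin: "\<And>A. A \<in> Pow S \<Longrightarrow> finite (Pow A)" "\<And>A. A \<in> Pow S \<Longrightarrow> finite (Pow (S - A))"
    using assms by (auto dest: finite_subset)
  show ?thesis
    using assms fin
    by (simp add: sum.Sigma,
        intro sum.reindex_bij_witness[of _ "\<lambda>(M, T). (T, M - T)" "\<lambda>(T, W). (T \<union> W, T)"])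
       (auto simp: Un_Diff intro!: arg_cong2[where f = f])
qed

lemma sum_ksub_split:
  assumes "finite S"
  shows "(\<Sum>T\<in>ksub S p. \<Sum>W\<in>ksub (S - T) q. f T W) = (\<Sum>M\<in>ksub S (p + q). \<Sum>T\<in>ksub M p. f T (M - T))"
proof -
  have fin: "\<And>A k. A \<subseteq> S \<Longrightarrow> finite (ksub A k)" "\<And>A k. A \<subseteq> S \<Longrightarrow> finite (ksub (S - A) k)"
    using assms by (auto intro!: finite_ksub dest: finite_subset)
  have "(\<Sum>T\<in>ksub S p. \<Sum>W\<in>ksub (S - T) q. f T W)
      = (\<Sum>(T, W)\<in>Sigma (ksub S p) (\<lambda>T. ksub (S - T) q). f T W)"
    using assms fin by (intro sum.Sigma) (auto simp: ksub_def)
  also have "\<dots> = (\<Sum>(M, T)\<in>Sigma (ksub S (p + q)) (\<lambda>M. ksub M p). f T (M - T))"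
  proof (intro sum.reindex_bij_witness[of _ "\<lambda>(M, T). (T, M - T)" "\<lambda>(T, W). (T \<union> W, T)"], goal_cases)
    case (2 a)
    then obtain T W where a: "a = (T, W)" "T \<subseteq> S" "card T = p" "W \<subseteq> S - T" "card W = q"
      by (auto simp: ksub_def)
    then have "card (T \<union> W) = p + q"
      using assms by (subst card_Un_disjoint) (auto dest: finite_subset)
    then show ?case using a by (auto simp: ksub_def)
  next
    case (4 b)
    then obtain M T where b: "b = (M, T)" "M \<subseteq> S" "card M = p + q" "T \<subseteq> M" "card T = p"
      by (auto simp: ksub_def)
    then have "card (M - T) = q"
      using assms by (subst card_Diff_subset) (auto dest: finite_subset)
    then show ?case using b by (auto simp: ksub_def)
  qed (auto simp: ksub_def Un_Diff intro!: arg_cong2[where f = f])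
  also have "\<dots> = (\<Sum>M\<in>ksub S (p + q). \<Sum>T\<in>ksub M p. f T (M - T))"
    using assms fin by (intro sum.Sigma[symmetric]) (auto simp: ksub_def)
  finally show ?thesis .
qed

definition hl_factor :: "'a::field \<Rightarrow> ('i \<Rightarrow> 'a) \<Rightarrow> 'i set \<Rightarrow> 'i set \<Rightarrow> 'a" where
  "hl_factor t x S R = (\<Prod>a\<in>S. \<Prod>b\<in>R. (x a - t * x b) / (x a - x b))"

lemma hl_factor_empty [simp]: "hl_factor t x {} R = 1" "hl_factor t x S {} = 1"
  by (simp_all add: hl_factor_def)

text \<open>Both sides are the product over the pairs in \<open>T\<close> times
  \<open>M - T\<close>, \<open>T\<close> times \<open>S - M\<close>, and \<open>M - T\<close> times
  \<open>S - M\<close>.\<close>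

lemma hl_factor_cocycle:
  fixes x :: "'i \<Rightarrow> 'a::field"
  assumes "finite S" "T \<subseteq> M" "M \<subseteq> S"
  shows "hl_factor t x T (S - T) * hl_factor t x (M - T) (S - M)
       = hl_factor t x M (S - M) * hl_factor t x T (M - T)"
proof -
  let ?f = "\<lambda>a b. (x a - t * x b) / (x a - x b)"
  have fin: "finite T" "finite M" "finite (M - T)" "finite (S - M)"
    using assms by (auto dest: finite_subset)
  have 1: "(\<Prod>b\<in>S - T. ?f a b) = (\<Prod>b\<in>M - T. ?f a b) * (\<Prod>b\<in>S - M. ?f a b)" for a
  proof -
    have "S - T = (M - T) \<union> (S - M)" using assms by auto
    then show ?thesis using fin by (simp add: prod.union_disjoint disjoint_iff)
  qed
  have 2: "(\<Prod>a\<in>M. g a) = (\<Prod>a\<in>T. g a) * (\<Prod>a\<in>M - T. g a)" for g :: "'i \<Rightarrow> 'a"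
    using assms fin by (simp add: prod.subset_diff mult.commute)
  show ?thesis
    unfolding hl_factor_def 1 2[of "\<lambda>a. \<Prod>b\<in>S - M. ?f a b"] by (simp add: prod.distrib mult_ac)
qed

lemma fps_const_sum: "fps_const (sum f A) = (\<Sum>a\<in>A. fps_const (f a))"
  by (induction A rule: infinite_finite_induct) (simp_all flip: fps_const_add)

section \<open>Lagrange interpolation and weighted sums over subsets\<close>

locale hall_littlewood =
  fixes t :: "'a::field" and x :: "'i \<Rightarrow> 'a"
  assumes inj_x: "inj x" and x_nonzero: "x i \<noteq> 0" and t_not_root: "not_root_of_unity t"
begin

abbreviation D :: "'i set \<Rightarrow> 'i set \<Rightarrow> 'a" where "D \<equiv> hl_factor t x"

abbreviation px :: "'i set \<Rightarrow> 'a" where "px S \<equiv> \<Prod>a\<in>S. x a"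

lemma x_eq_iff: "x a = x b \<longleftrightarrow> a = b"
  using inj_x by (auto dest: injD)

lemma t_neq: "j > 0 \<Longrightarrow> t ^ j \<noteq> 1"
  using t_not_root by (auto simp: not_root_of_unity_def)

text \<open>Both sides have degree at most \<open>card Z\<close> and are compared at the
  \<open>card Z + 1\<close> points \<open>0\<close> and \<open>- 1 / x c\<close> for
  \<open>c\<close> in \<open>Z\<close>. At the latter the first product vanishes and only the
  summand \<open>a = c\<close> survives on the right.\<close>

lemma lagrange:
  assumes "finite Z"
  shows "(\<Prod>b\<in>Z. [:1, x b:]) - (\<Prod>b\<in>Z. [:1, t * x b:])
       = smult (1 - t) (pCons 0 (\<Sum>a\<in>Z. smult (x a * D {a} (Z - {a})) (\<Prod>b\<in>Z - {a}. [:1, x b:])))"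
    (is "?l = ?r")
proof (rule poly_eqI_degree)
  let ?A = "insert 0 ((\<lambda>a. - inverse (x a)) ` Z)"
  have "inj_on (\<lambda>a. - inverse (x a)) Z" by (auto simp: inj_on_def x_eq_iff)
  moreover have "0 \<notin> (\<lambda>a. - inverse (x a)) ` Z" using x_nonzero by auto
  ultimately have cA: "card ?A = Suc (card Z)" using assms by (simp add: card_image)
  have deg: "degree (\<Prod>b\<in>W. [:1, c b:]) \<le> card W" if "finite W" for W and c :: "'i \<Rightarrow> 'a"
  proof -
    have "degree (\<Prod>b\<in>W. [:1, c b:]) \<le> (\<Sum>b\<in>W. degree [:1, c b:])"
      using degree_prod_sum_le[OF that, of "\<lambda>b. [:1, c b:]"] by simp
    also have "\<dots> \<le> (\<Sum>b\<in>W. 1)" by (intro sum_mono) auto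
    finally show ?thesis by simp
  qed
  have "degree ?l \<le> card Z" by (intro degree_diff_le deg assms)
  then show "degree ?l < card ?A" unfolding cA by simp
  have "degree ?r \<le> card Z"
  proof (cases "Z = {}")
    case False
    then have "card Z > 0" using assms by (simp add: card_gt_0_iff)
    have "degree (\<Sum>a\<in>Z. smult (x a * D {a} (Z - {a})) (\<Prod>b\<in>Z - {a}. [:1, x b:])) \<le> card Z - 1"
    proof (intro degree_sum_le assms order.trans[OF degree_smult_le])
      fix a assume "a \<in> Z"
      then show "degree (\<Prod>b\<in>Z - {a}. [:1, x b:]) \<le> card Z - 1"
        using deg[of "Z - {a}" x] assms by simp
    qed
    then show ?thesis using \<open>card Z > 0\<close>
      by (intro order.trans[OF degree_smult_le] order.trans[OF degree_pCons_le]) simp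
  qed simp
  then show "degree ?r < card ?A" unfolding cA by simp
  fix y assume "y \<in> ?A"
  then consider "y = 0" | c where "c \<in> Z" "y = - inverse (x c)" by auto
  then show "poly ?l y = poly ?r y"
  proof cases
    case 1
    then show ?thesis by (simp add: poly_prod)
  next
    case 2
    let ?z = "\<lambda>a. \<Prod>b\<in>Z - {a}. 1 - x b / x c"
    have l: "poly ?l y = - ((1 - t) * (\<Prod>b\<in>Z - {c}. 1 - t * x b / x c))"
    proof -
      have "poly [:1, d * x b:] y = 1 - d * x b / x c" for b d
        using 2 by (simp add: divide_inverse)
      from this[of t] this[of 1] have e: "poly [:1, t * x b:] y = 1 - t * x b / x c"
        "poly [:1, x b:] y = 1 - x b / x c" for b by (simp_all del: poly_pCons)
      have "(\<Prod>b\<in>Z. 1 - x b / x c) = 0"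
        using 2 assms x_nonzero by (intro prod_zero) auto
      moreover have "(\<Prod>b\<in>Z. 1 - t * x b / x c) = (1 - t) * (\<Prod>b\<in>Z - {c}. 1 - t * x b / x c)"
        using 2 assms x_nonzero[of c] by (simp add: prod.remove[of Z c])
      ultimately show ?thesis by (simp only: poly_diff poly_prod e) simp
    qed
    have "(\<Sum>a\<in>Z. x a * D {a} (Z - {a}) * ?z a) = x c * D {c} (Z - {c}) * ?z c"
    proof -
      have z0: "?z a = 0" if "a \<in> Z - {c}" for a
        using that 2 assms x_nonzero by (intro prod_zero) auto
      have "(\<Sum>a\<in>Z - {c}. x a * D {a} (Z - {a}) * ?z a) = 0"
        by (intro sum.neutral ballI) (simp only: z0 mult_zero_right)
      then show ?thesis using 2 assms by (subst sum.remove[of Z c]) auto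
    qed
    also have "\<dots> = x c * (\<Prod>b\<in>Z - {c}. 1 - t * x b / x c)"
    proof -
      have "(x c - t * x b) / (x c - x b) * (1 - x b / x c) = 1 - t * x b / x c" if "b \<in> Z - {c}" for b
      proof -
        have "x c \<noteq> x b" using that by (auto simp: x_eq_iff)
        then show ?thesis using x_nonzero[of c] by (simp add: field_simps)
      qed
      then show ?thesis by (simp add: hl_factor_def mult.assoc prod.distrib[symmetric])
    qed
    finally have s: "(\<Sum>a\<in>Z. x a * D {a} (Z - {a}) * ?z a) = x c * (\<Prod>b\<in>Z - {c}. 1 - t * x b / x c)" .
    have "poly ?r y = - ((1 - t) * (inverse (x c) * (\<Sum>a\<in>Z. x a * D {a} (Z - {a}) * ?z a)))"
      using 2 by (simp add: poly_prod poly_sum divide_inverse mult_ac)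
    also have "\<dots> = poly ?l y" unfolding s l using x_nonzero[of c] by simp
    finally show ?thesis by simp
  qed
qed

definition elem :: "nat \<Rightarrow> 'i set \<Rightarrow> 'a" where
  "elem p Z = coeff (\<Prod>b\<in>Z. [:1, x b:]) p"

lemma elem_0 [simp]: "finite Z \<Longrightarrow> elem 0 Z = 1"
  unfolding elem_def poly_0_coeff_0[symmetric] by (simp add: poly_prod)

lemma coeff_prod_scaled: "coeff (\<Prod>b\<in>Z. [:1, c * x b:]) p = c ^ p * elem p Z"
proof -
  have "(\<Prod>b\<in>Z. [:1, c * x b:]) = pcompose (\<Prod>b\<in>Z. [:1, x b:]) [:0, c:]"
    by (simp add: pcompose_prod pcompose_pCons mult.commute)
  then show ?thesis by (simp add: coeff_pcompose_linear elem_def)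
qed

lemma elem_recursion:
  assumes "finite Z"
  shows "(1 - t ^ Suc p) * elem (Suc p) Z = (1 - t) * (\<Sum>a\<in>Z. x a * D {a} (Z - {a}) * elem p (Z - {a}))"
proof -
  have "coeff ((\<Prod>b\<in>Z. [:1, x b:]) - (\<Prod>b\<in>Z. [:1, t * x b:])) (Suc p) = (1 - t ^ Suc p) * elem (Suc p) Z"
    by (simp add: coeff_prod_scaled left_diff_distrib del: power_Suc) (simp add: elem_def)
  then show ?thesis unfolding lagrange[OF assms] by (simp add: coeff_sum elem_def)
qed

lemma elem_card: "finite Z \<Longrightarrow> elem (card Z) Z = px Z \<and> (\<forall>p > card Z. elem p Z = 0)"
proof (induction Z rule: finite_induct)
  case (insert a Z)
  have "elem (Suc p) (insert a Z) = elem (Suc p) Z + x a * elem p Z" for p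
    using insert by (simp add: elem_def mult_pCons_left)
  moreover have "p > card (insert a Z) \<Longrightarrow> \<exists>q. p = Suc q \<and> q > card Z" for p
    using insert by (cases p) auto
  ultimately show ?case using insert by fastforce
qed (auto simp: elem_def)

text \<open>The top coefficient of \<open>lagrange\<close>: for \<open>p + 1 = card Z\<close> the
  product \<open>x a * elem p (Z - {a})\<close> is \<open>px Z\<close> for every \<open>a\<close>,
  and \<open>px Z\<close> cancels because the \<open>x i\<close> are nonzero.\<close>

lemma sum_D_singleton:
  assumes "finite Z"
  shows "(1 - t) * (\<Sum>A\<in>ksub Z 1. D A (Z - A)) = 1 - t ^ card Z"
proof (cases "Z = {}")
  case False
  then obtain n where n: "card Z = Suc n" using assms by (cases "card Z") auto
  have "x a * D {a} (Z - {a}) * elem n (Z - {a}) = px Z * D {a} (Z - {a})" if "a \<in> Z" for a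
    using elem_card[of "Z - {a}"] that n assms by (simp add: prod.remove[of Z a])
  then have "(\<Sum>a\<in>Z. x a * D {a} (Z - {a}) * elem n (Z - {a})) = (\<Sum>a\<in>Z. px Z * D {a} (Z - {a}))"
    by (intro sum.cong refl)
  then have "(1 - t ^ Suc n) * px Z = (1 - t) * (\<Sum>a\<in>Z. px Z * D {a} (Z - {a}))"
    using elem_recursion[OF assms, of n] elem_card[OF assms] n by simp
  also have "\<dots> = px Z * ((1 - t) * (\<Sum>A\<in>ksub Z 1. D A (Z - A)))"
    unfolding sum_ksub_1 by (simp add: sum_distrib_left mult_ac)
  finally show ?thesis using assms x_nonzero n by (simp add: mult.commute)
qed (simp add: ksub_eq_empty)

text \<open>Double counting of the pairs \<open>(T, a)\<close> with \<open>a \<in> T\<close>; the cocycle identity makes the weights match.\<close>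

lemma sum_ksub_Suc:
  assumes "finite S"
  shows "(1 - t ^ Suc p) * (\<Sum>T\<in>ksub S (Suc p). D T (S - T) * (\<Prod>a\<in>T. g a))
       = (1 - t) * (\<Sum>a\<in>S. D {a} (S - {a}) * g a * (\<Sum>W\<in>ksub (S - {a}) p. D W (S - {a} - W) * (\<Prod>a\<in>W. g a)))"
proof -
  have "(1 - t) * (\<Sum>a\<in>S. D {a} (S - {a}) * g a * (\<Sum>W\<in>ksub (S - {a}) p. D W (S - {a} - W) * (\<Prod>a\<in>W. g a)))
      = (1 - t) * (\<Sum>A\<in>ksub S 1. \<Sum>W\<in>ksub (S - A) p.
          D A (S - A) * D W (S - A - W) * ((\<Prod>a\<in>A. g a) * (\<Prod>a\<in>W. g a)))"
    unfolding sum_ksub_1 by (simp add: sum_distrib_left mult_ac)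
  also have "\<dots> = (1 - t) * (\<Sum>M\<in>ksub S (Suc p). \<Sum>A\<in>ksub M 1.
          D A (S - A) * D (M - A) (S - A - (M - A)) * ((\<Prod>a\<in>A. g a) * (\<Prod>a\<in>M - A. g a)))"
    by (subst sum_ksub_split[OF assms]) simp
  also have "\<dots> = (\<Sum>M\<in>ksub S (Suc p). (1 - t) * (\<Sum>A\<in>ksub M 1. D A (M - A)) * (D M (S - M) * (\<Prod>a\<in>M. g a)))"
    unfolding sum_distrib_left sum_distrib_right
  proof (intro sum.cong refl)
    fix M A assume M: "M \<in> ksub S (Suc p)" and A: "A \<in> ksub M 1"
    then have sub: "A \<subseteq> M" "M \<subseteq> S" "finite M" using assms by (auto simp: ksub_def dest: finite_subset)
    then have e: "S - A - (M - A) = S - M" by auto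
    have "(\<Prod>a\<in>A. g a) * (\<Prod>a\<in>M - A. g a) = (\<Prod>a\<in>M. g a)"
      using sub by (metis mult.commute prod.subset_diff)
    then show "(1 - t) * (D A (S - A) * D (M - A) (S - A - (M - A)) * ((\<Prod>a\<in>A. g a) * (\<Prod>a\<in>M - A. g a)))
        = (1 - t) * D A (M - A) * (D M (S - M) * (\<Prod>a\<in>M. g a))"
      unfolding e hl_factor_cocycle[OF assms sub(1,2)] by simp
  qed
  also have "\<dots> = (\<Sum>M\<in>ksub S (Suc p). (1 - t ^ Suc p) * (D M (S - M) * (\<Prod>a\<in>M. g a)))"
  proof (intro sum.cong refl)
    fix M assume "M \<in> ksub S (Suc p)"
    then have "finite M" "card M = Suc p" using assms by (auto simp: ksub_def dest: finite_subset)
    then show "(1 - t) * (\<Sum>A\<in>ksub M 1. D A (M - A)) * (D M (S - M) * (\<Prod>a\<in>M. g a))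
        = (1 - t ^ Suc p) * (D M (S - M) * (\<Prod>a\<in>M. g a))"
      using sum_D_singleton[of M] by simp
  qed
  finally show ?thesis by (simp add: sum_distrib_left)
qed

text \<open>\<open>sum_ksub_Suc\<close> with \<open>g = 1\<close> leads to subsets and a ground set
  with one element less. The factor \<open>1 - t ^ card S\<close> from
  \<open>sum_D_singleton\<close> then fits \<open>gauss_absorption\<close>.\<close>

lemma sum_ksub_D:
  assumes "finite S"
  shows "(\<Sum>T\<in>ksub S p. D T (S - T)) = gauss t (card S) p"
  using assms
proof (induction p arbitrary: S)
  case 0
  then show ?case by (simp add: ksub_0)
next
  case (Suc p)
  have ne: "1 - t ^ Suc p \<noteq> 0" using t_neq[of "Suc p"] by simp
  show ?case
  proof (cases "card S")
    case 0
    then show ?thesis using Suc.prems by (simp add: ksub_eq_empty)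
  next
    case (Suc n)
    have "(1 - t ^ Suc p) * (\<Sum>T\<in>ksub S (Suc p). D T (S - T))
        = (1 - t) * (\<Sum>a\<in>S. D {a} (S - {a}) * (\<Sum>W\<in>ksub (S - {a}) p. D W (S - {a} - W)))"
      using sum_ksub_Suc[OF Suc.prems, of p "\<lambda>_. 1"] by simp
    also have "\<dots> = (1 - t) * (\<Sum>a\<in>S. D {a} (S - {a}) * gauss t n p)"
      using Suc.IH Suc.prems Suc by simp
    also have "\<dots> = (1 - t ^ card S) * gauss t n p"
      unfolding sum_D_singleton[OF Suc.prems, symmetric] sum_ksub_1
      by (simp add: sum_distrib_right mult.assoc)
    also have "\<dots> = (1 - t ^ Suc p) * gauss t (card S) (Suc p)"
      unfolding Suc using gauss_absorption[OF t_not_root] by metis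
    finally show ?thesis using ne by simp
  qed
qed

text \<open>The left side is the Hall-Littlewood function of a single column, so this is
  \<open>P_(1^p) = e_p\<close>. It satisfies the recursion that \<open>lagrange\<close> yields for
  the elementary symmetric polynomials.\<close>

lemma sum_ksub_elem:
  assumes "finite Z"
  shows "(\<Sum>W\<in>ksub Z p. D W (Z - W) * px W) = elem p Z"
  using assms
proof (induction p arbitrary: Z)
  case 0
  then show ?case by (simp add: ksub_0)
next
  case (Suc p)
  have ne: "1 - t ^ Suc p \<noteq> 0" using t_neq[of "Suc p"] by simp
  have "(1 - t ^ Suc p) * (\<Sum>W\<in>ksub Z (Suc p). D W (Z - W) * px W)
      = (1 - t) * (\<Sum>a\<in>Z. D {a} (Z - {a}) * x a * elem p (Z - {a}))"
    using sum_ksub_Suc[OF Suc.prems, of p x] Suc.IH Suc.prems by simp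
  also have "\<dots> = (1 - t ^ Suc p) * elem (Suc p) Z"
    unfolding elem_recursion[OF Suc.prems] by (simp add: mult_ac)
  finally show ?case using ne by simp
qed

lemma sum_Pow_card:
  assumes "finite S"
  shows "(\<Sum>T\<in>Pow S. f (card T) T) = (\<Sum>p\<le>card S. \<Sum>T\<in>ksub S p. f p T)"
proof -
  have "(\<Sum>p\<le>card S. \<Sum>T\<in>ksub S p. f p T) = (\<Sum>p\<in>{..card S}. \<Sum>T | T \<in> Pow S \<and> card T = p. f (card T) T)"
    by (intro sum.cong) (auto simp: ksub_def)
  also have "\<dots> = (\<Sum>T\<in>Pow S. f (card T) T)"
    using assms by (intro sum.group) (auto intro: card_mono)
  finally show ?thesis by simp
qed

section \<open>The generating function of the complete symmetric functions:
  \<open>cauchy Z $ r\<close> is \<open>h_r\<close>\<close>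

definition cauchy :: "'i set \<Rightarrow> 'a fps" where
  "cauchy Z = (\<Prod>b\<in>Z. inverse (1 - fps_const (x b) * fps_X))"

lemma cauchy_union: "finite A \<Longrightarrow> finite B \<Longrightarrow> A \<inter> B = {} \<Longrightarrow> cauchy (A \<union> B) = cauchy A * cauchy B"
  by (simp add: cauchy_def prod.union_disjoint)

lemma cauchy_times: "finite Z \<Longrightarrow> cauchy Z * (\<Prod>b\<in>Z. 1 - fps_const (x b) * fps_X) = 1"
  unfolding cauchy_def prod.distrib[symmetric] by (simp add: inverse_mult_eq_1)

text \<open>The coefficients \<open>(-1)^p e_p(Z)\<close> are spread over subsets by
  \<open>sum_ksub_elem\<close>. This puts the reciprocal of \<open>cauchy\<close> into a form whose
  terms the cocycle identity can merge with others.\<close>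

lemma prod_one_minus:
  assumes "finite Z"
  shows "(\<Prod>b\<in>Z. 1 - fps_const (x b) * fps_X)
       = (\<Sum>W\<in>Pow Z. fps_const ((-1) ^ card W * (D W (Z - W) * px W)) * fps_X ^ card W)"
proof (rule fps_ext)
  fix p
  have "(\<Prod>b\<in>Z. 1 - fps_const (x b) * fps_X) = fps_of_poly (\<Prod>b\<in>Z. [:1, (-1) * x b:])"
    by (simp add: fps_of_poly_prod fps_of_poly_pCons flip: fps_const_neg)
  then have "(\<Prod>b\<in>Z. 1 - fps_const (x b) * fps_X) $ p = (-1) ^ p * elem p Z"
    by (simp only: fps_of_poly_nth coeff_prod_scaled)
  also have "\<dots> = (\<Sum>W\<in>ksub Z p. (-1) ^ p * (D W (Z - W) * px W))"
    unfolding sum_ksub_elem[OF assms, symmetric] by (simp add: sum_distrib_left)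
  also have "\<dots> = (\<Sum>W\<in>Pow Z. if card W = p then (-1) ^ card W * (D W (Z - W) * px W) else 0)"
    using assms by (intro sum.mono_neutral_cong_left) (auto simp: ksub_def)
  also have "\<dots> = (\<Sum>W\<in>Pow Z. fps_const ((-1) ^ card W * (D W (Z - W) * px W)) * fps_X ^ card W) $ p"
    by (simp add: fps_sum_nth fps_X_power_iff if_distrib cong: if_cong) (intro sum.cong, auto)
  finally show "(\<Prod>b\<in>Z. 1 - fps_const (x b) * fps_X) $ p = \<dots>" .
qed

text \<open>Grouping by the size of \<open>S\<close> turns the weights into Gaussian binomials, and
  the sum into \<open>sum_alternating_gauss\<close>.\<close>

lemma sum_Pow_alternating:
  assumes "finite M"
  shows "(\<Sum>S\<in>Pow M. t ^ (card S choose 2) * (-1) ^ card (M - S) * D S (M - S)) = (if M = {} then 1 else 0)"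
proof -
  let ?n = "card M"
  have "(\<Sum>S\<in>Pow M. t ^ (card S choose 2) * (-1) ^ card (M - S) * D S (M - S))
      = (\<Sum>S\<in>Pow M. t ^ (card S choose 2) * (-1) ^ (?n - card S) * D S (M - S))"
    by (intro sum.cong refl) (metis PowD assms card_Diff_subset finite_subset)
  also have "\<dots> = (\<Sum>p\<le>?n. t ^ (p choose 2) * (-1) ^ (?n - p) * gauss t ?n p)"
    by (subst sum_Pow_card[OF assms, of "\<lambda>p S. t ^ (p choose 2) * (-1) ^ (?n - p) * D S (M - S)"])
       (simp add: sum_ksub_D[OF assms] flip: sum_distrib_left)
  also have "\<dots> = (-1) ^ ?n * (\<Sum>p\<le>?n. (-1) ^ p * t ^ (p choose 2) * gauss t ?n p)"
    unfolding sum_distrib_left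
  proof (intro sum.cong refl)
    fix p assume "p \<in> {..?n}"
    then have "(-1 :: 'a) ^ ?n = (-1) ^ (?n - p) * (-1) ^ p" by (simp flip: power_add)
    moreover have "(-1 :: 'a) ^ p * (-1) ^ p = 1" by (simp flip: power_mult_distrib)
    ultimately have "(-1) ^ (?n - p) = (-1 :: 'a) ^ ?n * (-1) ^ p" by (simp add: mult.assoc)
    then show "t ^ (p choose 2) * (-1) ^ (?n - p) * gauss t ?n p
        = (-1) ^ ?n * ((-1) ^ p * t ^ (p choose 2) * gauss t ?n p)" by simp
  qed
  finally show ?thesis using assms by (simp add: sum_alternating_gauss)
qed

text \<open>After multiplication by the reciprocal of \<open>cauchy Y\<close>, a sum over
  \<open>S\<close> containing the product of \<open>1 - x b v\<close> over \<open>Y - S\<close> has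
  to equal \<open>1\<close>. Expanding that product over \<open>W\<close> and merging
  \<open>M = S \<union> W\<close> by the cocycle identity leaves an inner alternating sum, which
  vanishes unless \<open>M\<close> is empty.\<close>

lemma cauchy_expansion:
  assumes "finite Y"
  shows "cauchy Y = (\<Sum>S\<in>Pow Y. fps_const (t ^ (card S choose 2) * (D S (Y - S) * px S)) * fps_X ^ card S * cauchy S)"
proof -
  let ?E = "\<lambda>S. \<Prod>b\<in>S. 1 - fps_const (x b) * fps_X"
  let ?c = "\<lambda>S. t ^ (card S choose 2) * (D S (Y - S) * px S)"
  have "(\<Sum>S\<in>Pow Y. fps_const (?c S) * fps_X ^ card S * ?E (Y - S))
      = (\<Sum>S\<in>Pow Y. \<Sum>W\<in>Pow (Y - S). fps_const (?c S * ((-1) ^ card W * (D W (Y - S - W) * px W)))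
            * fps_X ^ (card S + card W))"
    unfolding prod_one_minus[OF finite_Diff[OF assms]] sum_distrib_left
    by (intro sum.cong refl) (simp add: power_add mult_ac flip: fps_const_mult)
  also have "\<dots> = (\<Sum>M\<in>Pow Y. \<Sum>S\<in>Pow M. fps_const (?c S * ((-1) ^ card (M - S) * (D (M - S) (Y - S - (M - S)) * px (M - S))))
            * fps_X ^ (card S + card (M - S)))"
    by (rule sum_Pow_split[OF assms])
  also have "\<dots> = (\<Sum>M\<in>Pow Y. fps_const (D M (Y - M) * px M *
        (\<Sum>S\<in>Pow M. t ^ (card S choose 2) * (-1) ^ card (M - S) * D S (M - S))) * fps_X ^ card M)"
  proof (intro sum.cong refl)
    fix M assume "M \<in> Pow Y"
    then have M: "M \<subseteq> Y" "finite M" using assms by (auto dest: finite_subset)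
    have "fps_const (?c S * ((-1) ^ card (M - S) * (D (M - S) (Y - S - (M - S)) * px (M - S)))) * fps_X ^ (card S + card (M - S))
       = fps_const (D M (Y - M) * px M * (t ^ (card S choose 2) * (-1) ^ card (M - S) * D S (M - S))) * fps_X ^ card M"
      if "S \<in> Pow M" for S
    proof -
      have S: "S \<subseteq> M" "finite S" using that M by (auto dest: finite_subset)
      have 1: "Y - S - (M - S) = Y - M" using S M by auto
      have 2: "card S + card (M - S) = card M" using S M by (simp add: card_Diff_subset card_mono)
      have 3: "px M = px S * px (M - S)" using S M by (metis mult.commute prod.subset_diff)
      have "?c S * ((-1) ^ card (M - S) * (D (M - S) (Y - M) * px (M - S)))
          = (D S (Y - S) * D (M - S) (Y - M)) * px M * (t ^ (card S choose 2) * (-1) ^ card (M - S))"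
        unfolding 3 by simp
      also have "\<dots> = D M (Y - M) * px M * (t ^ (card S choose 2) * (-1) ^ card (M - S) * D S (M - S))"
        unfolding hl_factor_cocycle[OF assms S(1) M(1)] by simp
      finally show ?thesis unfolding 1 2 by simp
    qed
    then show "(\<Sum>S\<in>Pow M. fps_const (?c S * ((-1) ^ card (M - S) * (D (M - S) (Y - S - (M - S)) * px (M - S)))) * fps_X ^ (card S + card (M - S)))
       = fps_const (D M (Y - M) * px M * (\<Sum>S\<in>Pow M. t ^ (card S choose 2) * (-1) ^ card (M - S) * D S (M - S))) * fps_X ^ card M"
      unfolding sum_distrib_left fps_const_sum sum_distrib_right by (intro sum.cong refl)
  qed
  also have "\<dots> = (\<Sum>M\<in>Pow Y. if M = {} then 1 else 0)"
  proof (intro sum.cong refl)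
    fix M assume "M \<in> Pow Y"
    then have M: "finite M" using assms by (auto dest: finite_subset)
    show "fps_const (D M (Y - M) * px M * (\<Sum>S\<in>Pow M. t ^ (card S choose 2) * (-1) ^ card (M - S) * D S (M - S)))
        * fps_X ^ card M = (if M = {} then 1 else 0)"
      unfolding sum_Pow_alternating[OF M] by simp
  qed
  also have "\<dots> = 1" using assms by simp
  finally have A: "(\<Sum>S\<in>Pow Y. fps_const (?c S) * fps_X ^ card S * ?E (Y - S)) = 1" .
  have "cauchy Y = (\<Sum>S\<in>Pow Y. cauchy Y * (fps_const (?c S) * fps_X ^ card S * ?E (Y - S)))"
    unfolding sum_distrib_left[symmetric] A by simp
  also have "\<dots> = (\<Sum>S\<in>Pow Y. fps_const (?c S) * fps_X ^ card S * cauchy S)"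
  proof (intro sum.cong refl)
    fix S assume "S \<in> Pow Y"
    then have 1: "cauchy Y = cauchy S * cauchy (Y - S)"
      using assms cauchy_union[of S "Y - S"] by (auto simp: Un_absorb1 dest: finite_subset)
    have 2: "cauchy (Y - S) * ?E (Y - S) = 1" using assms by (intro cauchy_times) auto
    have "cauchy Y * (fps_const (?c S) * fps_X ^ card S * ?E (Y - S))
        = fps_const (?c S) * fps_X ^ card S * cauchy S * (cauchy (Y - S) * ?E (Y - S))"
      unfolding 1 by (simp only: mult_ac)
    then show "cauchy Y * (fps_const (?c S) * fps_X ^ card S * ?E (Y - S))
        = fps_const (?c S) * fps_X ^ card S * cauchy S"
      unfolding 2 by simp
  qed
  finally show ?thesis .
qed

end


section \<open>The Pieri rule\<close>

text \<open>\<open>hl_cols t x cs X\<close> is the Hall--Littlewood function of the partition with columns \<open>cs\<close> in the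
  variables indexed by \<open>X\<close>: the set \<open>S\<close> chosen first carries the variables with a nonzero
  exponent.\<close>

fun hl_cols :: "'a::field \<Rightarrow> ('i \<Rightarrow> 'a) \<Rightarrow> nat list \<Rightarrow> 'i set \<Rightarrow> 'a" where
  "hl_cols t x [] X = 1"
| "hl_cols t x (m # ms) X = (\<Sum>S\<in>ksub X m. (\<Prod>a\<in>S. x a) * hl_factor t x S (X - S) * hl_cols t x ms S)"

text \<open>The default \<open>0\<close> treats a list of columns as if zeros followed it.\<close>

definition hd0 :: "nat list \<Rightarrow> nat" where
  "hd0 ms = (case ms of [] \<Rightarrow> 0 | m # _ \<Rightarrow> m)"

lemma hd0_simps [simp]: "hd0 [] = 0" "hd0 (m # ms) = m"
  by (simp_all add: hd0_def)

lemma hl_cols_hd0: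
  "finite X \<Longrightarrow> hl_cols t x ms X
     = (\<Sum>U\<in>ksub X (hd0 ms). (\<Prod>a\<in>U. x a) * hl_factor t x U (X - U) * hl_cols t x (tl ms) U)"
  by (cases ms) (simp_all add: ksub_0)

abbreviation decreasing :: "nat list \<Rightarrow> bool" where
  "decreasing ms \<equiv> sorted_wrt (\<ge>) ms"

lemma decreasing_Cons: "decreasing (m # ms) \<longleftrightarrow> hd0 ms \<le> m \<and> decreasing ms"
  by (cases ms) auto

text \<open>The sets in a chain cannot grow, so a column longer than the one before it leaves
  nothing to sum over. Hence the Pieri rule may range over all lists of a given sum, which can be
  summed entry by entry.\<close>

lemma hl_cols_not_decreasing:
  "finite X \<Longrightarrow> \<not> decreasing ms \<Longrightarrow> hl_cols t x ms X = 0"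
proof (induction ms arbitrary: X)
  case (Cons m ms)
  have "hl_cols t x ms S = 0" if "S \<in> ksub X m" for S
  proof -
    have S: "finite S" "card S = m" using that Cons.prems by (auto simp: ksub_def dest: finite_subset)
    show ?thesis
    proof (cases "decreasing ms")
      case True
      then have "m < hd0 ms" using Cons.prems(2) unfolding decreasing_Cons by auto
      then show ?thesis using S by (subst hl_cols_hd0) (simp_all add: ksub_eq_empty)
    qed (use Cons.IH S in auto)
  qed
  then show ?case by simp
qed simp

text \<open>\<open>pieri_coeff t ls ms\<close> is the coefficient of \<open>P\<^sub>\<lambda>\<close> in \<open>h\<^sub>r P\<^sub>\<mu>\<close>, for \<open>\<lambda>' = ls\<close>, \<open>\<mu>' = ms\<close>.\<close>

fun pieri_coeff :: "'a::comm_ring_1 \<Rightarrow> nat list \<Rightarrow> nat list \<Rightarrow> 'a" where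
  "pieri_coeff t (l # ls) (m # ms) =
     (if m \<le> l then t ^ ((l - m) choose 2) * gauss t (l - hd0 ms) (m - hd0 ms) * pieri_coeff t ls ms else 0)"
| "pieri_coeff t _ _ = 1"

lemma pieri_coeff_sum_list:
  "length ls = length ms \<Longrightarrow> sum_list ls < sum_list ms \<Longrightarrow> pieri_coeff t ls ms = 0"
  by (induction ls ms rule: list_induct2) auto

definition lists_sum :: "nat \<Rightarrow> nat \<Rightarrow> nat list set" where
  "lists_sum k N = {ls. length ls = k \<and> sum_list ls = N}"

lemma finite_lists_sum [simp]: "finite (lists_sum k N)"
proof (rule finite_subset)
  show "lists_sum k N \<subseteq> {ls. set ls \<subseteq> {..N} \<and> length ls = k}"
    using member_le_sum_list by (auto simp: lists_sum_def)
  show "finite {ls. set ls \<subseteq> {..N} \<and> length ls = k}" by (rule finite_lists_length_eq) simp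
qed

lemma lists_sum_0: "lists_sum 0 N = (if N = 0 then {[]} else {})"
  by (auto simp: lists_sum_def)

lemma sum_lists_sum_Suc:
  "(\<Sum>ls\<in>lists_sum (Suc k) N. g ls) = (\<Sum>l\<le>N. \<Sum>ls\<in>lists_sum k (N - l). g (l # ls))"
proof -
  have "(\<Sum>l\<le>N. \<Sum>ls\<in>lists_sum k (N - l). g (l # ls))
      = (\<Sum>(l, ls)\<in>Sigma {..N} (\<lambda>l. lists_sum k (N - l)). g (l # ls))"
    by (rule sum.Sigma) auto
  also have "\<dots> = (\<Sum>ls\<in>lists_sum (Suc k) N. g ls)"
    by (rule sum.reindex_bij_witness[of _ "\<lambda>ls. (hd ls, tl ls)" "\<lambda>(l, ls). l # ls"])
       (auto simp: lists_sum_def length_Suc_conv)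
  finally show ?thesis by simp
qed

lemma sum_Pow_card_restrict:
  assumes "finite X" "finite A"
  shows "(\<Sum>S\<in>Pow X. if card S \<in> A then F (card S) S else 0) = (\<Sum>l\<in>A. \<Sum>S\<in>ksub X l. F l S)"
proof -
  have "(\<Sum>l\<in>A. \<Sum>S\<in>ksub X l. F l S) = (\<Sum>l\<in>A. \<Sum>S\<in>Pow X. if card S = l then F l S else 0)"
    using assms by (intro sum.cong refl sum.mono_neutral_cong_left) (auto simp: ksub_def)
  also have "\<dots> = (\<Sum>S\<in>Pow X. \<Sum>l\<in>A. if card S = l then F l S else 0)"
    by (rule sum.swap)
  finally show ?thesis using assms by simp
qed

context hall_littlewood
begin

abbreviation Q :: "nat list \<Rightarrow> 'i set \<Rightarrow> 'a" where "Q \<equiv> hl_cols t x"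

text \<open>Write \<open>T = U \<union> W\<close>, where \<open>U\<close> carries the first column
  of \<open>Q ms T\<close>. By the cocycle identity the weight of \<open>U\<close> refers to
  \<open>S\<close> alone, and a free sum over \<open>W\<close> in \<open>S - U\<close> remains,
  which \<open>sum_ksub_D\<close> evaluates. This is the origin of the Gaussian binomial in
  \<open>pieri_coeff\<close>.\<close>

lemma sum_ksub_D_hl_cols:
  assumes "finite S" "hd0 ms \<le> m"
  shows "(\<Sum>T\<in>ksub S m. D T (S - T) * Q ms T) = gauss t (card S - hd0 ms) (m - hd0 ms) * Q ms S"
proof -
  let ?p = "hd0 ms"
  let ?f = "\<lambda>U W. D (U \<union> W) (S - (U \<union> W)) * (px U * D U W * Q (tl ms) U)"
  have "(\<Sum>T\<in>ksub S m. D T (S - T) * Q ms T)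
      = (\<Sum>T\<in>ksub S (?p + (m - ?p)). \<Sum>U\<in>ksub T ?p. ?f U (T - U))"
  proof (rule sum.cong)
    fix T assume "T \<in> ksub S (?p + (m - ?p))"
    then have "finite T" using assms by (auto simp: ksub_def dest: finite_subset)
    then have "D T (S - T) * Q ms T = (\<Sum>U\<in>ksub T ?p. D T (S - T) * (px U * D U (T - U) * Q (tl ms) U))"
      by (subst hl_cols_hd0) (simp_all add: sum_distrib_left)
    also have "\<dots> = (\<Sum>U\<in>ksub T ?p. ?f U (T - U))"
      by (intro sum.cong refl) (auto simp: ksub_def Un_absorb1)
    finally show "D T (S - T) * Q ms T = (\<Sum>U\<in>ksub T ?p. ?f U (T - U))" .
  qed (use assms in simp)
  also have "\<dots> = (\<Sum>U\<in>ksub S ?p. \<Sum>W\<in>ksub (S - U) (m - ?p). ?f U W)"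
    by (rule sum_ksub_split[OF assms(1), symmetric])
  also have "\<dots> = (\<Sum>U\<in>ksub S ?p. gauss t (card S - ?p) (m - ?p) * (px U * D U (S - U) * Q (tl ms) U))"
  proof (intro sum.cong refl)
    fix U assume U: "U \<in> ksub S ?p"
    then have fU: "finite U" "U \<subseteq> S" "card U = ?p" using assms by (auto simp: ksub_def dest: finite_subset)
    have "?f U W = D W (S - U - W) * (px U * D U (S - U) * Q (tl ms) U)" if "W \<in> ksub (S - U) (m - ?p)" for W
    proof -
      have W: "W \<subseteq> S - U" using that by (simp add: ksub_def)
      have e: "U \<union> W - U = W" "S - (U \<union> W) = S - U - W" using W by auto
      have "D U (S - U) * D W (S - U - W) = D (U \<union> W) (S - (U \<union> W)) * D U W"
        using hl_factor_cocycle[OF assms(1), of U "U \<union> W" t x] W fU e by auto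
      then show ?thesis by (simp add: mult_ac)
    qed
    then have "(\<Sum>W\<in>ksub (S - U) (m - ?p). ?f U W)
       = (\<Sum>W\<in>ksub (S - U) (m - ?p). D W (S - U - W)) * (px U * D U (S - U) * Q (tl ms) U)"
      unfolding sum_distrib_right by (intro sum.cong refl)
    also have "(\<Sum>W\<in>ksub (S - U) (m - ?p). D W (S - U - W)) = gauss t (card S - ?p) (m - ?p)"
      using assms fU by (subst sum_ksub_D) (auto simp: card_Diff_subset)
    finally show "(\<Sum>W\<in>ksub (S - U) (m - ?p). ?f U W)
       = gauss t (card S - ?p) (m - ?p) * (px U * D U (S - U) * Q (tl ms) U)" .
  qed
  also have "\<dots> = gauss t (card S - ?p) (m - ?p) * Q ms S"
    using assms by (subst (2) hl_cols_hd0) (simp_all add: sum_distrib_left)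
  finally show ?thesis .
qed

text \<open>One column of the Pieri rule: \<open>T\<close> carries the old first column,
  \<open>W\<close> the boxes added to it, and \<open>S = T \<union> W\<close> the new first column.
  The remaining factor \<open>cauchy S\<close> acts on the later columns, in the variables of
  \<open>S\<close> alone.\<close>

lemma cauchy_times_hl_cols:
  assumes "finite X" "hd0 ms \<le> m"
  shows "cauchy X * fps_const (Q (m # ms) X)
       = (\<Sum>S\<in>Pow X. if m \<le> card S then
            fps_const (t ^ ((card S - m) choose 2) * gauss t (card S - hd0 ms) (m - hd0 ms) * (px S * D S (X - S)) * Q ms S)
            * fps_X ^ (card S - m) * cauchy S else 0)"
proof -
  let ?b = "\<lambda>Y W. t ^ (card W choose 2) * (D W (Y - W) * px W)"
  let ?f = "\<lambda>T W. if card T = m then fps_const (px T * D T (X - T) * Q ms T * ?b (X - T) W)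
      * fps_X ^ card W * cauchy (T \<union> W) else 0"
  have "cauchy X * fps_const (Q (m # ms) X)
      = (\<Sum>T\<in>ksub X m. cauchy X * fps_const (px T * D T (X - T) * Q ms T))"
    by (simp only: hl_cols.simps fps_const_sum sum_distrib_left)
  also have "\<dots> = (\<Sum>T\<in>ksub X m. \<Sum>W\<in>Pow (X - T). ?f T W)"
  proof (intro sum.cong refl)
    fix T assume "T \<in> ksub X m"
    then have T: "finite T" "T \<subseteq> X" "card T = m" using assms by (auto simp: ksub_def dest: finite_subset)
    have "cauchy X = cauchy T * cauchy (X - T)"
      using T assms cauchy_union[of T "X - T"] by (auto simp: Un_absorb1)
    \<comment> \<open>Only \<open>cauchy (X - T)\<close> is expanded; \<open>cauchy T\<close> is
      kept so that it recombines with \<open>cauchy W\<close>.\<close>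
    also have "\<dots> = (\<Sum>W\<in>Pow (X - T). cauchy T * (fps_const (?b (X - T) W) * fps_X ^ card W * cauchy W))"
      using assms by (subst cauchy_expansion[of "X - T"]) (simp_all add: sum_distrib_left)
    also have "\<dots> = (\<Sum>W\<in>Pow (X - T). fps_const (?b (X - T) W) * fps_X ^ card W * cauchy (T \<union> W))"
    proof (intro sum.cong refl)
      fix W assume "W \<in> Pow (X - T)"
      then have "cauchy (T \<union> W) = cauchy T * cauchy W"
        using T assms by (intro cauchy_union) (auto dest: finite_subset)
      then show "cauchy T * (fps_const (?b (X - T) W) * fps_X ^ card W * cauchy W)
          = fps_const (?b (X - T) W) * fps_X ^ card W * cauchy (T \<union> W)"
        by (simp only: mult_ac)
    qed
    finally show "cauchy X * fps_const (px T * D T (X - T) * Q ms T) = (\<Sum>W\<in>Pow (X - T). ?f T W)"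
      using T(3)
      by (simp only: sum_distrib_right)
         (intro sum.cong refl, simp only: fps_const_mult[symmetric] mult_ac simp_thms if_True)
  qed
  also have "\<dots> = (\<Sum>T\<in>Pow X. \<Sum>W\<in>Pow (X - T). ?f T W)"
    using assms by (intro sum.mono_neutral_left) (auto simp: ksub_def)
  also have "\<dots> = (\<Sum>S\<in>Pow X. \<Sum>T\<in>Pow S. ?f T (S - T))"
    by (rule sum_Pow_split[OF assms(1)])
  also have "\<dots> = (\<Sum>S\<in>Pow X. if m \<le> card S then
            fps_const (t ^ ((card S - m) choose 2) * gauss t (card S - hd0 ms) (m - hd0 ms) * (px S * D S (X - S)) * Q ms S)
            * fps_X ^ (card S - m) * cauchy S else 0)"
  proof (intro sum.cong refl)
    fix S assume "S \<in> Pow X"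
    then have S: "S \<subseteq> X" "finite S" using assms by (auto dest: finite_subset)
    let ?K = "\<lambda>z. fps_const (t ^ ((card S - m) choose 2) * (px S * D S (X - S)) * z) * fps_X ^ (card S - m) * cauchy S"
    have "(\<Sum>T\<in>Pow S. ?f T (S - T)) = (\<Sum>T\<in>ksub S m. ?f T (S - T))"
      using S by (intro sum.mono_neutral_right) (auto simp: ksub_def)
    also have "\<dots> = (\<Sum>T\<in>ksub S m. ?K (D T (S - T) * Q ms T))"
    proof (intro sum.cong refl)
      fix T assume "T \<in> ksub S m"
      then have T: "T \<subseteq> S" "finite T" "card T = m" using S by (auto simp: ksub_def dest: finite_subset)
      have e: "X - T - (S - T) = X - S" "card (S - T) = card S - m" "T \<union> (S - T) = S"
        using T S by (auto simp: card_Diff_subset)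
      have p: "px S = px T * px (S - T)" using S T by (metis mult.commute prod.subset_diff)
      have "px T * D T (X - T) * Q ms T * ?b (X - T) (S - T)
          = t ^ ((card S - m) choose 2) * px S * (D T (X - T) * D (S - T) (X - S)) * Q ms T"
        unfolding e p by simp
      also have "\<dots> = t ^ ((card S - m) choose 2) * (px S * D S (X - S)) * (D T (S - T) * Q ms T)"
        unfolding hl_factor_cocycle[OF assms(1) T(1) S(1)] by simp
      finally show "?f T (S - T) = ?K (D T (S - T) * Q ms T)"
        using T(3) by (simp only: e simp_thms if_True)
    qed
    also have "\<dots> = ?K (\<Sum>T\<in>ksub S m. D T (S - T) * Q ms T)"
      by (simp only: fps_const_sum sum_distrib_left sum_distrib_right)
    finally have s: "(\<Sum>T\<in>Pow S. ?f T (S - T)) = ?K (\<Sum>T\<in>ksub S m. D T (S - T) * Q ms T)" .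
    show "(\<Sum>T\<in>Pow S. ?f T (S - T)) = (if m \<le> card S then
            fps_const (t ^ ((card S - m) choose 2) * gauss t (card S - hd0 ms) (m - hd0 ms) * (px S * D S (X - S)) * Q ms S)
            * fps_X ^ (card S - m) * cauchy S else 0)"
    proof (cases "m \<le> card S")
      case True
      then show ?thesis unfolding s sum_ksub_D_hl_cols[OF S(2) assms(2)] by (simp add: mult_ac)
    next
      case False
      then show ?thesis unfolding s using S by (simp add: ksub_eq_empty)
    qed
  qed
  finally show ?thesis .
qed

lemma cauchy_nth_0: "finite X \<Longrightarrow> cauchy X $ 0 = 1"
  unfolding cauchy_def by (induction X rule: finite_induct) simp_all

lemma cauchy_empty: "cauchy {} = 1"
  by (simp add: cauchy_def)

text \<open>The bound on \<open>r + sum_list ms\<close> makes \<open>k\<close> columns enough for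
  every partition that occurs. Removing a first column of length \<open>0\<close> may break it, but
  then no variables are left; hence the alternative \<open>X = {}\<close>.\<close>

theorem pieri:
  assumes "length ms = k" "decreasing ms" "finite X" "X = {} \<or> r + sum_list ms \<le> k"
  shows "cauchy X $ r * Q ms X = (\<Sum>ls\<in>lists_sum k (r + sum_list ms). pieri_coeff t ls ms * Q ls X)"
  using assms
proof (induction k arbitrary: ms X r)
  case 0
  then show ?case by (auto simp: lists_sum_0 cauchy_nth_0 cauchy_empty)
next
  case (Suc k)
  then obtain m ms' where ms: "ms = m # ms'" "length ms' = k" by (cases ms) auto
  have dec: "hd0 ms' \<le> m" "decreasing ms'" using Suc.prems(2) unfolding ms decreasing_Cons by auto
  let ?N = "r + sum_list ms"
  let ?w = "\<lambda>l. t ^ ((l - m) choose 2) * gauss t (l - hd0 ms') (m - hd0 ms')"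
  \<comment> \<open>The factor \<open>fps_X ^ (card S - m)\<close> contributes to the coefficient at
    \<open>r\<close> only if at most \<open>r\<close> boxes are added to the first column.\<close>
  let ?A = "{m..m + r}"
  have "cauchy X $ r * Q ms X = (cauchy X * fps_const (Q (m # ms') X)) $ r"
    unfolding ms by simp
  also have "\<dots> = (\<Sum>S\<in>Pow X. if card S \<in> ?A then
      ?w (card S) * (px S * D S (X - S)) * (cauchy S $ (r - (card S - m)) * Q ms' S) else 0)"
    unfolding cauchy_times_hl_cols[OF Suc.prems(3) dec(1)] fps_sum_nth
    by (intro sum.cong refl) (auto simp: mult.assoc fps_X_power_mult_nth)
  also have "\<dots> = (\<Sum>l\<in>?A. \<Sum>S\<in>ksub X l. ?w l * (px S * D S (X - S)) * (cauchy S $ (r - (l - m)) * Q ms' S))"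
    by (rule sum_Pow_card_restrict) (use Suc.prems in auto)
  also have "\<dots> = (\<Sum>l\<in>?A. \<Sum>S\<in>ksub X l. ?w l * (px S * D S (X - S)) *
      (\<Sum>ls\<in>lists_sum k (?N - l). pieri_coeff t ls ms' * Q ls S))"
  proof (intro sum.cong refl)
    fix l S assume l: "l \<in> ?A" and S: "S \<in> ksub X l"
    have fS: "finite S" using S Suc.prems by (auto simp: ksub_def dest: finite_subset)
    have "S = {} \<or> r - (l - m) + sum_list ms' \<le> k"
    proof (cases "S = {}")
      case False
      then have "l \<noteq> 0" "X \<noteq> {}" using S fS by (auto simp: ksub_def)
      then show ?thesis using Suc.prems(4) l unfolding ms by auto
    qed simp
    moreover have "r - (l - m) + sum_list ms' = ?N - l" using l unfolding ms by auto
    ultimately show "?w l * (px S * D S (X - S)) * (cauchy S $ (r - (l - m)) * Q ms' S)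
        = ?w l * (px S * D S (X - S)) * (\<Sum>ls\<in>lists_sum k (?N - l). pieri_coeff t ls ms' * Q ls S)"
      using Suc.IH[OF ms(2) dec(2) fS, of "r - (l - m)"] by simp
  qed
  also have "\<dots> = (\<Sum>l\<in>?A. \<Sum>ls\<in>lists_sum k (?N - l). pieri_coeff t (l # ls) ms * Q (l # ls) X)"
  proof (intro sum.cong refl)
    fix l assume "l \<in> ?A"
    then have "pieri_coeff t (l # ls) ms = ?w l * pieri_coeff t ls ms'" for ls unfolding ms by simp
    then have "(\<Sum>ls\<in>lists_sum k (?N - l). pieri_coeff t (l # ls) ms * Q (l # ls) X)
        = (\<Sum>ls\<in>lists_sum k (?N - l). \<Sum>S\<in>ksub X l. ?w l * (px S * D S (X - S)) * (pieri_coeff t ls ms' * Q ls S))"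
      by (simp add: sum_distrib_left mult_ac)
    also have "\<dots> = (\<Sum>S\<in>ksub X l. \<Sum>ls\<in>lists_sum k (?N - l). ?w l * (px S * D S (X - S)) * (pieri_coeff t ls ms' * Q ls S))"
      by (rule sum.swap)
    finally show "(\<Sum>S\<in>ksub X l. ?w l * (px S * D S (X - S)) * (\<Sum>ls\<in>lists_sum k (?N - l). pieri_coeff t ls ms' * Q ls S))
       = (\<Sum>ls\<in>lists_sum k (?N - l). pieri_coeff t (l # ls) ms * Q (l # ls) X)"
      by (simp add: sum_distrib_left)
  qed
  \<comment> \<open>A first column beyond \<open>m + r\<close> would force the later columns to lose
    boxes, so its coefficient vanishes.\<close>
  also have "\<dots> = (\<Sum>l\<le>?N. \<Sum>ls\<in>lists_sum k (?N - l). pieri_coeff t (l # ls) ms * Q (l # ls) X)"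
  proof (rule sum.mono_neutral_left)
    show "\<forall>l\<in>{..?N} - ?A. (\<Sum>ls\<in>lists_sum k (?N - l). pieri_coeff t (l # ls) ms * Q (l # ls) X) = 0"
    proof (intro ballI sum.neutral)
      fix l ls assume l: "l \<in> {..?N} - ?A" and ls: "ls \<in> lists_sum k (?N - l)"
      have "pieri_coeff t (l # ls) ms = 0"
      proof (cases "m \<le> l")
        case True
        then have "sum_list ls < sum_list ms'" using l ls unfolding ms lists_sum_def by auto
        then have "pieri_coeff t ls ms' = 0"
          using ms ls by (intro pieri_coeff_sum_list) (auto simp: lists_sum_def)
        then show ?thesis unfolding ms by simp
      qed (simp add: ms)
      then show "pieri_coeff t (l # ls) ms * Q (l # ls) X = 0" by simp
    qed
  qed (auto simp: ms)
  also have "\<dots> = (\<Sum>ls\<in>lists_sum (Suc k) ?N. pieri_coeff t ls ms * Q ls X)"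
    by (rule sum_lists_sum_Suc[symmetric])
  finally show ?case .
qed

end

section \<open>The expansion of \<open>h_p h_q\<close> in Hall-Littlewood functions\<close>

definition cols :: "nat \<Rightarrow> nat \<Rightarrow> nat list set" where
  "cols k N = {ls \<in> lists_sum k N. decreasing ls}"

lemma finite_cols [simp]: "finite (cols k N)"
  by (simp add: cols_def)

text \<open>The coefficient of \<open>P\<^sub>\<lambda>\<close> in \<open>h\<^sub>p h\<^sub>q\<close>, for \<open>\<lambda>' = cs\<close> and \<open>q = |\<lambda>| - p\<close>; the power of \<open>t\<close> is
  the coefficient of \<open>P\<^sub>\<nu>\<close> in \<open>h\<^sub>p\<close>.\<close>

definition hh_coeff :: "'a::comm_ring_1 \<Rightarrow> nat \<Rightarrow> nat list \<Rightarrow> 'a" where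
  "hh_coeff t p cs = (\<Sum>ms\<in>cols (length cs) p. t ^ (\<Sum>m\<leftarrow>ms. m choose 2) * pieri_coeff t cs ms)"

text \<open>This is the Pieri rule for \<open>P_0 = 1\<close>: all Gaussian binomials are
  \<open>1\<close>, and the exponents add up to \<open>n(\<lambda>)\<close>.\<close>

lemma pieri_coeff_zeros: "pieri_coeff t ls (replicate (length ls) 0) = t ^ (\<Sum>l\<leftarrow>ls. l choose 2)"
proof (induction ls)
  case (Cons l ls)
  have "hd0 (replicate (length ls) 0) = 0" by (cases ls) auto
  then show ?case using Cons by (simp add: power_add)
qed simp

text \<open>Plays the part of \<open>h_q = 0\<close> for negative \<open>q\<close>. The case
  \<open>p = N + 1\<close> occurs in the difference that yields the one-row shape.\<close>

lemma hh_coeff_large: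
  assumes "sum_list cs < p"
  shows "hh_coeff t p cs = 0"
  unfolding hh_coeff_def
proof (intro sum.neutral ballI)
  fix ms assume "ms \<in> cols (length cs) p"
  then have "pieri_coeff t cs ms = 0"
    using assms by (intro pieri_coeff_sum_list) (auto simp: cols_def lists_sum_def)
  then show "t ^ (\<Sum>m\<leftarrow>ms. m choose 2) * pieri_coeff t cs ms = 0" by simp
qed

context hall_littlewood
begin

lemma hl_cols_zeros: "finite X \<Longrightarrow> Q (replicate k 0) X = 1"
  by (induction k arbitrary: X) (simp_all add: ksub_0)

lemma sum_lists_sum_cols:
  assumes "finite X"
  shows "(\<Sum>ls\<in>lists_sum k N. f ls * Q ls X) = (\<Sum>ls\<in>cols k N. f ls * Q ls X)"
  by (rule sum.mono_neutral_right) (auto simp: cols_def hl_cols_not_decreasing assms)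

theorem cauchy_product:
  assumes "finite X" "p \<le> N" "N \<le> k"
  shows "cauchy X $ p * cauchy X $ (N - p) = (\<Sum>cs\<in>cols k N. hh_coeff t p cs * Q cs X)"
proof -
  have "cauchy X $ p = cauchy X $ p * Q (replicate k 0) X"
    using assms by (simp add: hl_cols_zeros)
  also have "\<dots> = (\<Sum>ms\<in>lists_sum k p. pieri_coeff t ms (replicate k 0) * Q ms X)"
    using assms pieri[of "replicate k 0" k X p] by (simp add: sorted_wrt_iff_nth_less sum_list_replicate)
  also have "\<dots> = (\<Sum>ms\<in>lists_sum k p. t ^ (\<Sum>m\<leftarrow>ms. m choose 2) * Q ms X)"
    by (intro sum.cong refl) (auto simp: lists_sum_def pieri_coeff_zeros)
  also have "\<dots> = (\<Sum>ms\<in>cols k p. t ^ (\<Sum>m\<leftarrow>ms. m choose 2) * Q ms X)"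
    by (rule sum_lists_sum_cols[OF assms(1)])
  finally have "cauchy X $ p * cauchy X $ (N - p)
      = (\<Sum>ms\<in>cols k p. t ^ (\<Sum>m\<leftarrow>ms. m choose 2) * (cauchy X $ (N - p) * Q ms X))"
    by (simp add: sum_distrib_left sum_distrib_right mult_ac)
  also have "\<dots> = (\<Sum>ms\<in>cols k p. t ^ (\<Sum>m\<leftarrow>ms. m choose 2) *
      (\<Sum>ls\<in>lists_sum k N. pieri_coeff t ls ms * Q ls X))"
  proof (intro sum.cong refl)
    fix ms assume "ms \<in> cols k p"
    then have "length ms = k" "decreasing ms" "sum_list ms = p" by (auto simp: cols_def lists_sum_def)
    then show "t ^ (\<Sum>m\<leftarrow>ms. m choose 2) * (cauchy X $ (N - p) * Q ms X)
        = t ^ (\<Sum>m\<leftarrow>ms. m choose 2) * (\<Sum>ls\<in>lists_sum k N. pieri_coeff t ls ms * Q ls X)"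
      using assms pieri[of ms k X "N - p"] by simp
  qed
  also have "\<dots> = (\<Sum>ls\<in>lists_sum k N. (\<Sum>ms\<in>cols k p. t ^ (\<Sum>m\<leftarrow>ms. m choose 2) * pieri_coeff t ls ms) * Q ls X)"
    by (simp add: sum_distrib_left sum_distrib_right mult_ac) (rule sum.swap)
  also have "\<dots> = (\<Sum>ls\<in>lists_sum k N. hh_coeff t p ls * Q ls X)"
    by (intro sum.cong refl) (auto simp: lists_sum_def hh_coeff_def)
  finally show ?thesis unfolding sum_lists_sum_cols[OF assms(1)] .
qed

end

text \<open>The product \<open>h_p h_(N-p)\<close> does not involve the parameter, so its expansions
  at two parameters agree. For \<open>p > N\<close> all coefficients vanish.\<close>

lemma cauchy_transfer:
  fixes t u :: "'a::field" and x :: "'i \<Rightarrow> 'a"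
  assumes "hall_littlewood t x" "hall_littlewood u x" "finite X" "N \<le> k"
  shows "(\<Sum>cs\<in>cols k N. hh_coeff t p cs * hl_cols t x cs X) = (\<Sum>cs\<in>cols k N. hh_coeff u p cs * hl_cols u x cs X)"
proof (cases "p \<le> N")
  case True
  then show ?thesis
    using hall_littlewood.cauchy_product[OF assms(1,3) True assms(4)]
      hall_littlewood.cauchy_product[OF assms(2,3) True assms(4)] by simp
next
  case False
  then have "hh_coeff v p cs = 0" if "cs \<in> cols k N" for v :: 'a and cs
    using that by (intro hh_coeff_large) (auto simp: cols_def lists_sum_def)
  then show ?thesis by simp
qed


section \<open>Columns and symmetrisation\<close>

definition pad :: "nat \<Rightarrow> nat list \<Rightarrow> nat list" where
  "pad l mu = mu @ replicate (l - length mu) 0"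

fun of_cols :: "nat list \<Rightarrow> nat list" where
  "of_cols [] = []"
| "of_cols (l # cs) = map Suc (pad l (of_cols cs))"

lemma length_pad: "length mu \<le> l \<Longrightarrow> length (pad l mu) = l"
  by (simp add: pad_def)

lemma part_pad: "part (pad l mu) i = part mu i"
  by (auto simp: part_def pad_def nth_append)

lemma sum_list_map_Suc: "sum_list (map Suc xs) = length xs + sum_list xs"
  by (induction xs) auto

lemma sum_list_pad: "sum_list (pad l mu) = sum_list mu"
  by (simp add: pad_def sum_list_replicate)

lemma of_cols_partition:
  "decreasing cs \<Longrightarrow> length (of_cols cs) = hd0 cs \<and> is_partition (of_cols cs) \<and> sum_list (of_cols cs) = sum_list cs"
proof (induction cs)
  case (Cons l cs)
  then have *: "length (of_cols cs) = hd0 cs" "is_partition (of_cols cs)"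
    "sum_list (of_cols cs) = sum_list cs" "hd0 cs \<le> l"
    unfolding decreasing_Cons by auto
  have "decreasing (pad l (of_cols cs))"
    using *(2) by (auto simp: pad_def is_partition_def sorted_wrt_append) (auto simp: sorted_wrt_iff_nth_less)
  then have "decreasing (of_cols (l # cs))"
    by (simp add: sorted_wrt_map)
  then show ?case using *
    by (auto simp: is_partition_def length_pad sum_list_map_Suc sum_list_pad)
qed (simp add: is_partition_def)

lemma length_of_cols: "decreasing cs \<Longrightarrow> length (of_cols cs) = hd0 cs"
  using of_cols_partition by blast

lemma conj_part_1: "is_partition lam \<Longrightarrow> conj_part lam (Suc 0) = length lam"
proof -
  assume "is_partition lam"
  then have "{r. r < length lam \<and> Suc 0 \<le> lam ! r} = {..<length lam}"
    by (auto simp: is_partition_def in_set_conv_nth Suc_le_eq)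
  then show ?thesis by (simp add: conj_part_def)
qed

lemma conj_part_map_Suc_pad:
  assumes "length mu \<le> l"
  shows "conj_part (map Suc (pad l mu)) (Suc (Suc i)) = conj_part mu (Suc i)"
proof -
  have "{r. r < length (map Suc (pad l mu)) \<and> Suc (Suc i) \<le> map Suc (pad l mu) ! r}
      = {r. r < length mu \<and> Suc i \<le> mu ! r}"
    using assms by (auto simp: length_pad) (auto simp: pad_def nth_append split: if_splits)
  then show ?thesis by (simp add: conj_part_def)
qed

lemma conj_part_of_cols:
  "decreasing cs \<Longrightarrow> conj_part (of_cols cs) (Suc i) = (if i < length cs then cs ! i else 0)"
proof (induction cs arbitrary: i)
  case Nil
  then show ?case by (simp add: conj_part_def)
next
  case (Cons l cs)
  then have "decreasing cs" "hd0 cs \<le> l" unfolding decreasing_Cons by auto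
  then show ?case
    using of_cols_partition[OF Cons.prems] of_cols_partition[of cs] Cons.IH
    by (cases i) (auto simp: conj_part_1 conj_part_map_Suc_pad simp del: of_cols.simps(2),
        simp_all add: conj_part_map_Suc_pad)
qed

definition cols_of :: "nat \<Rightarrow> nat list \<Rightarrow> nat list" where
  "cols_of k lam = map (\<lambda>i. conj_part lam (Suc i)) [0..<k]"

lemma length_cols_of [simp]: "length (cols_of k lam) = k"
  by (simp add: cols_of_def)

lemma decreasing_cols_of: "decreasing (cols_of k lam)"
  unfolding sorted_wrt_iff_nth_less
proof (intro allI impI)
  fix i j assume "i < j" "j < length (cols_of k lam)"
  moreover have "conj_part lam (Suc j) \<le> conj_part lam (Suc i)" if "i < j" for i j
    unfolding conj_part_def using that by (intro card_mono) auto
  ultimately show "cols_of k lam ! j \<le> cols_of k lam ! i"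
    by (simp add: cols_of_def)
qed

lemma decreasing_split_zeros:
  "decreasing xs \<Longrightarrow> xs = pad (length xs) (filter (\<lambda>x. x \<noteq> 0) xs)"
proof (induction xs)
  case (Cons a xs)
  show ?case
  proof (cases "a = 0")
    case True
    then have "\<forall>x\<in>set (a # xs). x = 0" using Cons.prems by auto
    then have "filter (\<lambda>x. x \<noteq> 0) (a # xs) = []" "a # xs = replicate (length (a # xs)) 0"
      by (auto simp: filter_empty_conv intro!: replicate_eqI)
    then show ?thesis by (metis append_Nil diff_zero list.size(3) pad_def)
  next
    case False
    then show ?thesis using Cons by (simp add: pad_def)
  qed
qed (simp add: pad_def)

text \<open>Induction on the number of columns. Lowering every part by one and dropping the zeros
  gives the partition \<open>mu\<close> without its first column; the dropped zeros sit at the end,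
  where \<open>pad\<close> restores them.\<close>

lemma of_cols_cols_of:
  "is_partition lam \<Longrightarrow> (\<And>p. p \<in> set lam \<Longrightarrow> p \<le> k) \<Longrightarrow> of_cols (cols_of k lam) = lam"
proof (induction k arbitrary: lam)
  case 0
  then show ?case by (cases lam) (auto simp: cols_of_def is_partition_def)
next
  case (Suc k)
  let ?ys = "map (\<lambda>p. p - 1) lam"
  define mu where "mu = filter (\<lambda>x. x \<noteq> 0) ?ys"
  have "decreasing ?ys" using Suc.prems(1)
    by (auto simp: is_partition_def sorted_wrt_map intro: sorted_wrt_mono_rel[rotated])
  then have ys: "?ys = pad (length lam) mu"
    using decreasing_split_zeros[of ?ys] by (simp add: mu_def)
  have "map Suc ?ys = lam"
    using Suc.prems(1) by (auto simp: is_partition_def intro!: map_idI) (metis Suc_pred not_gr_zero)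
  then have lam: "lam = map Suc (pad (length lam) mu)" using ys by metis
  have mu: "is_partition mu" "length mu \<le> length lam"
    using \<open>decreasing ?ys\<close> by (auto simp: is_partition_def mu_def intro!: sorted_wrt_filter)
  have "p \<le> k" if "p \<in> set mu" for p
    using that Suc.prems(2) by (fastforce simp: mu_def)
  then have IH: "of_cols (cols_of k mu) = mu" by (rule Suc.IH[OF mu(1)])
  have "cols_of (Suc k) lam = conj_part lam (Suc 0) # map (\<lambda>i. conj_part lam (Suc (Suc i))) [0..<k]"
    unfolding cols_of_def by (simp add: upt_conv_Cons flip: map_Suc_upt del: upt_Suc)
  also have "map (\<lambda>i. conj_part lam (Suc (Suc i))) [0..<k] = cols_of k mu"
    unfolding cols_of_def by (subst lam) (simp add: conj_part_map_Suc_pad[OF mu(2)])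
  also have "conj_part lam (Suc 0) = length lam" by (rule conj_part_1[OF Suc.prems(1)])
  finally show ?case using IH lam by simp
qed

lemma cols_of_of_cols:
  assumes "decreasing cs" "length cs = k"
  shows "cols_of k (of_cols cs) = cs"
  using assms by (intro nth_equalityI) (auto simp: cols_of_def conj_part_of_cols)

lemma cols_of_in_cols:
  assumes "is_partition lam" "\<And>p. p \<in> set lam \<Longrightarrow> p \<le> k"
  shows "cols_of k lam \<in> cols k (sum_list lam)"
  using of_cols_partition[OF decreasing_cols_of, of k lam] of_cols_cols_of[OF assms]
  by (auto simp: cols_def lists_sum_def decreasing_cols_of)

lemma bij_betw_of_cols:
  assumes "N \<le> k"
  shows "bij_betw of_cols (cols k N) (partitions_of N)"
proof (rule bij_betw_byWitness[where f' = "cols_of k"])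
  have *: "p \<le> k" if "lam \<in> partitions_of N" "p \<in> set lam" for lam p
    using member_le_sum_list[OF that(2)] that(1) assms by (simp add: partitions_of_def)
  show "\<forall>cs\<in>cols k N. cols_of k (of_cols cs) = cs"
    by (auto simp: cols_def lists_sum_def cols_of_of_cols)
  show "\<forall>lam\<in>partitions_of N. of_cols (cols_of k lam) = lam"
    using * of_cols_cols_of by (auto simp: partitions_of_def)
  show "of_cols ` cols k N \<subseteq> partitions_of N"
    using of_cols_partition by (auto simp: cols_def lists_sum_def partitions_of_def)
  show "cols_of k ` partitions_of N \<subseteq> cols k N"
    using * cols_of_in_cols by (fastforce simp: partitions_of_def)
qed

lemma finite_partitions_of [simp]: "finite (partitions_of N)"
  using bij_betw_finite[OF bij_betw_of_cols[of N N]] by simp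

lemma sum_partitions_of:
  assumes "N \<le> k"
  shows "(\<Sum>lam\<in>partitions_of N. f (cols_of k lam) lam) = (\<Sum>cs\<in>cols k N. f cs (of_cols cs))"
  by (subst sum.reindex_bij_betw[OF bij_betw_of_cols[OF assms], symmetric])
     (auto intro!: sum.cong simp: cols_def lists_sum_def cols_of_of_cols)

text \<open>Down a column of length \<open>c\<close> the row indices add up to
  \<open>0 + ... + (c - 1) = (c choose 2)\<close>.\<close>

lemma n_stat_of_cols: "decreasing cs \<Longrightarrow> n_stat (of_cols cs) = (\<Sum>c\<leftarrow>cs. c choose 2)"
proof (induction cs)
  case (Cons l cs)
  let ?mu = "of_cols cs"
  have *: "decreasing cs" "length ?mu \<le> l"
    using Cons.prems of_cols_partition[of cs] unfolding decreasing_Cons by auto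
  have "n_stat (of_cols (l # cs)) = (\<Sum>i<l. i * Suc (pad l ?mu ! i))"
    using * by (simp add: n_stat_def length_pad)
  also have "\<dots> = (\<Sum>i<l. i) + (\<Sum>i<l. i * part ?mu i)"
  proof -
    have "pad l ?mu ! i = part ?mu i" if "i < l" for i
      using part_pad[of l ?mu i] that by (simp add: part_def length_pad[OF *(2)])
    then show ?thesis by (simp add: sum.distrib)
  qed
  also have "(\<Sum>i<l. i) = l choose 2"
    by (induction l) (auto simp: numeral_2_eq_2)
  also have "(\<Sum>i<l. i * part ?mu i) = n_stat ?mu"
    unfolding n_stat_def using * by (intro sum.mono_neutral_cong_right) (auto simp: part_def)
  finally show ?case using Cons.IH * by simp
qed (simp add: n_stat_def)

section \<open>The normalising factor and the sum over all orderings of the variables\<close>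

definition vfac :: "'a::field \<Rightarrow> nat \<Rightarrow> 'a" where
  "vfac t m = (\<Prod>j=1..m. (1 - t ^ j) / (1 - t))"

text \<open>The multiplicity of a part \<open>i\<close> is the difference of the columns
  \<open>i\<close> and \<open>i + 1\<close>; that of \<open>0\<close> is the number of variables
  minus the first column. In contrast to \<open>v_part\<close> the parameter is free, so that it can
  be set to \<open>0\<close>.\<close>

fun vcols :: "'a::field \<Rightarrow> nat list \<Rightarrow> nat \<Rightarrow> 'a" where
  "vcols t [] m = vfac t m"
| "vcols t (l # cs) m = vfac t (m - l) * vcols t cs l"

lemma v_part_of_cols:
  "decreasing cs \<Longrightarrow> v_part n (of_cols cs) = vcols tvar cs n"
proof (induction cs arbitrary: n)
  case Nil
  then show ?case by (simp add: v_part_def v_fac_def vfac_def)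
next
  case (Cons l cs)
  let ?mu = "of_cols cs"
  have *: "decreasing cs" "length ?mu \<le> l"
    using Cons.prems of_cols_partition[of cs] unfolding decreasing_Cons by auto
  have rep: "count_list (replicate m b) i = (if i = b then m else 0)" for m and b i :: nat
    by (induction m) auto
  have p: "0 \<notin> set ?mu" using of_cols_partition[OF *(1)] by (simp add: is_partition_def)
  \<comment> \<open>The padding zeros become parts \<open>1\<close> under \<open>map Suc\<close>.
    Including the index \<open>0\<close> when nothing is padded costs only
    \<open>v_fac 0 = 1\<close>.\<close>
  have "(\<Prod>i\<in>set (pad l ?mu). v_fac (count_list (pad l ?mu) i))
      = (\<Prod>i\<in>insert 0 (set ?mu). v_fac (count_list (pad l ?mu) i))"
    by (rule prod.mono_neutral_left) (auto simp: pad_def v_fac_def)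
  also have "\<dots> = v_fac (count_list (pad l ?mu) 0) * (\<Prod>i\<in>set ?mu. v_fac (count_list (pad l ?mu) i))"
    using p by simp
  also have "count_list (pad l ?mu) 0 = l - length ?mu"
    using p by (simp add: pad_def rep)
  also have "(\<Prod>i\<in>set ?mu. v_fac (count_list (pad l ?mu) i)) = (\<Prod>i\<in>set ?mu. v_fac (count_list ?mu i))"
    using p by (intro prod.cong refl) (auto simp: pad_def rep)
  finally have "(\<Prod>i\<in>set (pad l ?mu). v_fac (count_list (pad l ?mu) i)) = v_part l ?mu"
    by (simp add: v_part_def)
  moreover have "count_list (map Suc xs) (Suc i) = count_list xs i" for xs i
    by (rule count_list_map_conv) simp
  ultimately have "v_part n (of_cols (l # cs)) = v_fac (n - l) * v_part l ?mu"
    using * by (simp add: v_part_def length_pad prod.reindex)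
  then show ?case using Cons.IH[OF *(1)] by (simp add: v_fac_def vfac_def)
qed

definition hl_sum :: "'a::field \<Rightarrow> (nat \<Rightarrow> 'a) \<Rightarrow> nat \<Rightarrow> nat list \<Rightarrow> 'a" where
  "hl_sum t x n lam = (\<Sum>w | w permutes {..<n}. (\<Prod>i<n. x (w i) ^ part lam i) *
     (\<Prod>j<n. \<Prod>i<j. (x (w i) - t * x (w j)) / (x (w i) - x (w j))))"

fun hl_prod :: "'a::field \<Rightarrow> ('i \<Rightarrow> 'a) \<Rightarrow> 'i list \<Rightarrow> 'a" where
  "hl_prod t x [] = 1"
| "hl_prod t x (a # as) = hl_factor t x {a} (set as) * hl_prod t x as"

definition monomial :: "('i \<Rightarrow> 'a::field) \<Rightarrow> nat list \<Rightarrow> 'i list \<Rightarrow> 'a" where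
  "monomial x lam as = (\<Prod>i<length as. x (as ! i) ^ part lam i)"

lemma hl_prod_append:
  "distinct (us @ vs) \<Longrightarrow> hl_prod t x (us @ vs) = hl_prod t x us * hl_factor t x (set us) (set vs) * hl_prod t x vs"
proof (induction us)
  case (Cons a us)
  have "hl_factor t x {a} (set us \<union> set vs) = hl_factor t x {a} (set us) * hl_factor t x {a} (set vs)"
    using Cons.prems by (simp add: hl_factor_def prod.union_disjoint)
  moreover have "hl_factor t x (insert a (set us)) (set vs) = hl_factor t x {a} (set vs) * hl_factor t x (set us) (set vs)"
    using Cons.prems by (simp add: hl_factor_def)
  ultimately show ?case using Cons by simp
qed simp

lemma hl_prod_nth:
  "distinct as \<Longrightarrow> hl_prod t x as = (\<Prod>j<length as. \<Prod>i<j. (x (as ! i) - t * x (as ! j)) / (x (as ! i) - x (as ! j)))"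
\<comment> \<open>The list grows at its end because the outer product runs over the larger
  index.\<close>
proof (induction as rule: rev_induct)
  case (snoc b as)
  have "hl_factor t x (set as) {b} = (\<Prod>i<length as. (x (as ! i) - t * x b) / (x (as ! i) - x b))"
  proof -
    have "bij_betw ((!) as) {..<length as} (set as)" using snoc.prems by (intro bij_betw_nth) auto
    from prod.reindex_bij_betw[OF this, of "\<lambda>a. (x a - t * x b) / (x a - x b)"]
    show ?thesis by (simp add: hl_factor_def)
  qed
  moreover have "(\<Prod>j<length as. \<Prod>i<j. (x ((as @ [b]) ! i) - t * x ((as @ [b]) ! j)) / (x ((as @ [b]) ! i) - x ((as @ [b]) ! j)))
    = (\<Prod>j<length as. \<Prod>i<j. (x (as ! i) - t * x (as ! j)) / (x (as ! i) - x (as ! j)))"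
    by (intro prod.cong refl) (auto simp: nth_append)
  ultimately show ?case using snoc by (simp add: hl_prod_append nth_append)
qed simp

text \<open>Unlike a permutation, a list of variables can be cut where the exponents become
  zero.\<close>

lemma sum_permutes_permutations_of_set:
  "(\<Sum>w | w permutes {..<n}. g (map w [0..<n])) = (\<Sum>as\<in>permutations_of_set {..<n}. g as)"
proof (rule sum.reindex_bij_betw)
  let ?f = "\<lambda>w. map w [0..<n]"
  have inj: "inj_on ?f {w. w permutes {..<n}}"
  proof (rule inj_onI, rule ext)
    fix w w' i assume w: "w \<in> {w. w permutes {..<n}}" "w' \<in> {w. w permutes {..<n}}" "?f w = ?f w'"
    show "w i = w' i"
    proof (cases "i < n")
      case True
      then show ?thesis using w(3) by (metis atLeastLessThan_iff map_eq_conv set_upt zero_le)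
    next
      case False
      then show ?thesis using w by (simp add: permutes_not_in)
    qed
  qed
  have sub: "?f ` {w. w permutes {..<n}} \<subseteq> permutations_of_set {..<n}"
  proof (intro image_subsetI permutations_of_setI)
    fix w assume "w \<in> {w. w permutes {..<n}}"
    then have w: "w permutes {..<n}" by simp
    show "set (?f w) = {..<n}" using permutes_image[OF w] by (simp add: atLeast0LessThan)
    show "distinct (?f w)" using permutes_inj_on[OF w] by (simp add: distinct_map)
  qed
  have "card (?f ` {w. w permutes {..<n}}) = card (permutations_of_set {..<n})"
    using inj by (simp add: card_image card_permutations)
  then have "?f ` {w. w permutes {..<n}} = permutations_of_set {..<n}"
    by (intro card_subset_eq sub) simp
  then show "bij_betw ?f {w. w permutes {..<n}} (permutations_of_set {..<n})"
    using inj by (simp add: bij_betw_def)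
qed

lemma sum_sum_factor:
  fixes c :: "'a::comm_semiring_0"
  shows "(\<Sum>a\<in>A. \<Sum>b\<in>B. c * f a * g b) = c * sum f A * sum g B"
  by (simp only: mult.assoc sum_product) (simp only: sum_distrib_left)

lemma sum_permutations_split:
  assumes "finite X" "l \<le> card X"
  shows "(\<Sum>as\<in>permutations_of_set X. F (take l as) (drop l as))
       = (\<Sum>S\<in>ksub X l. \<Sum>us\<in>permutations_of_set S. \<Sum>vs\<in>permutations_of_set (X - S). F us vs)"
proof -
  have "(\<Sum>S\<in>ksub X l. \<Sum>us\<in>permutations_of_set S. \<Sum>vs\<in>permutations_of_set (X - S). F us vs)
      = (\<Sum>(S, us, vs)\<in>Sigma (ksub X l) (\<lambda>S. permutations_of_set S \<times> permutations_of_set (X - S)). F us vs)"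
    using assms by (simp add: sum.cartesian_product sum.Sigma)
  also have "\<dots> = (\<Sum>as\<in>permutations_of_set X. F (take l as) (drop l as))"
  proof (rule sum.reindex_bij_witness[of _ "\<lambda>as. (set (take l as), take l as, drop l as)" "\<lambda>(S, us, vs). us @ vs"], goal_cases)
    case (1 a)
    then show ?case by (auto simp: ksub_def permutations_of_set_def distinct_card)
  next
    case (2 a)
    then show ?case by (auto simp: ksub_def permutations_of_set_def)
  next
    case (4 as)
    then have as: "set as = X" "distinct as" by (auto simp: permutations_of_set_def)
    have "set (take l as) \<union> set (drop l as) = X" "set (take l as) \<inter> set (drop l as) = {}"
      using as by (metis append_take_drop_id set_append) (metis as(2) append_take_drop_id distinct_append)
    moreover have "card (set (take l as)) = l"
      using as assms(2) by (simp add: distinct_card distinct_card[symmetric])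
    ultimately show ?case using as by (auto simp: ksub_def permutations_of_set_def)
  qed (auto simp: ksub_def permutations_of_set_def distinct_card)
  finally show ?thesis by simp
qed

lemma monomial_map_Suc_pad:
  assumes "length mu \<le> l" "length us = l"
  shows "monomial x (map Suc (pad l mu)) (us @ vs) = (\<Prod>a\<leftarrow>us. x a) * monomial x mu us"
proof -
  have part: "part (map Suc (pad l mu)) i = (if i < l then Suc (part mu i) else 0)" for i
    using assms(1) part_pad[of l mu i] by (auto simp: part_def length_pad)
  have "monomial x (map Suc (pad l mu)) (us @ vs) = (\<Prod>i<l. x (us ! i) ^ Suc (part mu i))"
    unfolding monomial_def part using assms(2)
    by (intro prod.mono_neutral_cong_right) (auto simp: nth_append)
  also have "\<dots> = (\<Prod>i<l. x (us ! i)) * monomial x mu us"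
    using assms(2) by (simp add: prod.distrib monomial_def)
  also have "(\<Prod>i<l. x (us ! i)) = (\<Prod>a\<leftarrow>us. x a)"
    using assms(2) by (simp add: prod.list_conv_set_nth atLeast0LessThan)
  finally show ?thesis .
qed

context hall_littlewood
begin

text \<open>The choice of the first entry contributes \<open>(1 - t^n) / (1 - t)\<close> by
  \<open>sum_D_singleton\<close>, and the remaining entries form an ordering of one variable
  less.\<close>

lemma sum_hl_prod:
  assumes "finite X"
  shows "(\<Sum>as\<in>permutations_of_set X. hl_prod t x as) = vfac t (card X)"
  using assms
proof (induction "card X" arbitrary: X)
  case 0
  then show ?case by (simp add: vfac_def)
next
  case (Suc n)
  have t1: "t \<noteq> 1" using t_neq[of 1] by simp
  have "(\<Sum>as\<in>permutations_of_set X. hl_prod t x as)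
      = (\<Sum>as\<in>permutations_of_set X. hl_prod t x (take 1 as @ drop 1 as))"
    by simp
  also have "\<dots> = (\<Sum>S\<in>ksub X 1. \<Sum>us\<in>permutations_of_set S. \<Sum>vs\<in>permutations_of_set (X - S). hl_prod t x (us @ vs))"
    using Suc by (subst sum_permutations_split[symmetric]) simp_all
  also have "\<dots> = (\<Sum>a\<in>X. \<Sum>vs\<in>permutations_of_set (X - {a}). D {a} (X - {a}) * hl_prod t x vs)"
    unfolding sum_ksub_1
    by (rule sum.cong[OF refl], simp, rule sum.cong[OF refl], simp add: permutations_of_setD)
  also have "\<dots> = (\<Sum>A\<in>ksub X 1. D A (X - A)) * vfac t n"
    unfolding sum_ksub_1 using Suc by (simp add: sum_distrib_right Suc(2)[symmetric] flip: sum_distrib_left)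
  also have "(\<Sum>A\<in>ksub X 1. D A (X - A)) = (1 - t ^ Suc n) / (1 - t)"
    using sum_D_singleton[OF Suc.prems] t1 Suc(2) by (simp add: field_simps)
  finally show ?case unfolding Suc(2)[symmetric] by (simp add: vfac_def)
qed

text \<open>The first \<open>l\<close> entries of an ordering form the set \<open>S\<close> of the
  first column. The monomial ignores the order of the others, which therefore sum to
  \<open>vfac t (card X - l)\<close>; once \<open>px S\<close> is taken out, the first entries pose
  the same problem for the later columns.\<close>

lemma sum_monomial_hl_prod:
  "decreasing cs \<Longrightarrow> finite X \<Longrightarrow> hd0 cs \<le> card X \<Longrightarrow>
    (\<Sum>as\<in>permutations_of_set X. monomial x (of_cols cs) as * hl_prod t x as) = vcols t cs (card X) * Q cs X"
proof (induction cs arbitrary: X)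
  case Nil
  then show ?case by (simp add: sum_hl_prod monomial_def part_def)
next
  case (Cons l cs)
  have dec: "decreasing cs" "hd0 cs \<le> l" using Cons.prems unfolding decreasing_Cons by auto
  let ?mu = "of_cols cs"
  have mu: "length ?mu \<le> l" using dec length_of_cols by simp
  let ?M = "\<lambda>as. monomial x (of_cols (l # cs)) as * hl_prod t x as"
  have "(\<Sum>as\<in>permutations_of_set X. ?M as) = (\<Sum>as\<in>permutations_of_set X. ?M (take l as @ drop l as))"
    by simp
  also have "\<dots> = (\<Sum>S\<in>ksub X l. \<Sum>us\<in>permutations_of_set S. \<Sum>vs\<in>permutations_of_set (X - S). ?M (us @ vs))"
    using Cons.prems by (subst sum_permutations_split[symmetric]) simp_all
  also have "\<dots> = (\<Sum>S\<in>ksub X l. px S * D S (X - S) *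
      (\<Sum>us\<in>permutations_of_set S. monomial x ?mu us * hl_prod t x us) *
      (\<Sum>vs\<in>permutations_of_set (X - S). hl_prod t x vs))"
  proof (intro sum.cong refl)
    fix S assume S: "S \<in> ksub X l"
    have "?M (us @ vs) = px S * D S (X - S) * (monomial x ?mu us * hl_prod t x us) * hl_prod t x vs"
      if "us \<in> permutations_of_set S" "vs \<in> permutations_of_set (X - S)" for us vs
    proof -
      have us: "set us = S" "distinct us" "length us = l" and vs: "set vs = X - S" "distinct vs"
        using that S by (auto simp: permutations_of_set_def ksub_def distinct_card)
      have "(\<Prod>a\<leftarrow>us. x a) = px S" using us by (metis prod.distinct_set_conv_list)
      moreover have "hl_prod t x (us @ vs) = hl_prod t x us * D S (X - S) * hl_prod t x vs"
        using us vs by (subst hl_prod_append) auto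
      ultimately show ?thesis using monomial_map_Suc_pad[OF mu us(3), of x vs] by simp
    qed
    then have "(\<Sum>us\<in>permutations_of_set S. \<Sum>vs\<in>permutations_of_set (X - S). ?M (us @ vs))
       = (\<Sum>us\<in>permutations_of_set S. \<Sum>vs\<in>permutations_of_set (X - S).
          px S * D S (X - S) * (monomial x ?mu us * hl_prod t x us) * hl_prod t x vs)"
      by (intro sum.cong refl)
    then show "(\<Sum>us\<in>permutations_of_set S. \<Sum>vs\<in>permutations_of_set (X - S). ?M (us @ vs))
       = px S * D S (X - S) * (\<Sum>us\<in>permutations_of_set S. monomial x ?mu us * hl_prod t x us) *
         (\<Sum>vs\<in>permutations_of_set (X - S). hl_prod t x vs)"
      by (simp only: sum_sum_factor)
  qed
  also have "\<dots> = (\<Sum>S\<in>ksub X l. px S * D S (X - S) * (vcols t cs l * Q cs S) * vfac t (card X - l))"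
  proof (intro sum.cong refl)
    fix S assume "S \<in> ksub X l"
    then have S: "finite S" "card S = l" "S \<subseteq> X" using Cons.prems by (auto simp: ksub_def dest: finite_subset)
    have "(\<Sum>us\<in>permutations_of_set S. monomial x ?mu us * hl_prod t x us) = vcols t cs l * Q cs S"
      using Cons.IH[of S] dec S by simp
    moreover have "(\<Sum>vs\<in>permutations_of_set (X - S). hl_prod t x vs) = vfac t (card X - l)"
      using sum_hl_prod[of "X - S"] S Cons.prems by (simp add: card_Diff_subset)
    ultimately show "px S * D S (X - S) *
      (\<Sum>us\<in>permutations_of_set S. monomial x ?mu us * hl_prod t x us) *
      (\<Sum>vs\<in>permutations_of_set (X - S). hl_prod t x vs) = px S * D S (X - S) * (vcols t cs l * Q cs S) * vfac t (card X - l)"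
      by simp
  qed
  also have "\<dots> = vcols t (l # cs) (card X) * Q (l # cs) X"
    by (simp add: sum_distrib_left mult_ac)
  finally show ?case .
qed

end

lemma hl_sum_of_cols:
  assumes "hall_littlewood t x" "decreasing cs" "hd0 cs \<le> n"
  shows "hl_sum t x n (of_cols cs) = vcols t cs n * hl_cols t x cs {..<n}"
proof -
  let ?g = "\<lambda>as. monomial x (of_cols cs) as * hl_prod t x as"
  have "hl_sum t x n (of_cols cs) = (\<Sum>w | w permutes {..<n}. ?g (map w [0..<n]))"
    unfolding hl_sum_def
  proof (intro sum.cong refl)
    fix w assume "w \<in> {w. w permutes {..<n}}"
    then have "distinct (map w [0..<n])" by (auto simp: distinct_map intro: permutes_inj_on)
    then show "(\<Prod>i<n. x (w i) ^ part (of_cols cs) i) * (\<Prod>j<n. \<Prod>i<j. (x (w i) - t * x (w j)) / (x (w i) - x (w j)))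
        = ?g (map w [0..<n])"
      by (simp add: monomial_def hl_prod_nth)
  qed
  then show ?thesis
    unfolding sum_permutes_permutations_of_set[of ?g n]
    using hall_littlewood.sum_monomial_hl_prod[OF assms(1,2), of "{..<n}"] assms(3) by simp
qed


section \<open>The bialternant formula\<close>

lemma to_fract_prod: "to_fract (prod f A) = (\<Prod>a\<in>A. to_fract (f a))"
  by (induction A rule: infinite_finite_induct) simp_all

lemma to_fract_power: "to_fract (p ^ n) = to_fract p ^ n"
  by (induction n) simp_all

lemma to_fract_of_nat: "to_fract (of_nat n) = of_nat n"
  by (induction n) simp_all

lemma to_fract_of_int: "to_fract (of_int n) = of_int n"
  by (cases n) (simp_all add: to_fract_of_nat)

lemma coef_0 [simp]: "coef 0 = 0" and coef_1 [simp]: "coef 1 = 1"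
  by (simp_all add: coef_def)

lemma coef_add: "coef (p + q) = coef p + coef q"
  by (simp add: coef_def single_add)

lemma coef_diff: "coef (p - q) = coef p - coef q"
  by (simp add: coef_def single_diff)

lemma coef_mult: "coef (p * q) = coef p * coef q"
proof -
  have "Poly_Mapping.single 0 (p * q) = Poly_Mapping.single (0 :: nat \<Rightarrow>\<^sub>0 nat) p * Poly_Mapping.single 0 q"
    by (simp add: mult_single)
  then show ?thesis unfolding coef_def by simp
qed

lemma coef_eq_iff: "coef p = coef q \<longleftrightarrow> p = q"
  by (simp add: coef_def inj_eq[OF inj_single])

lemma coef_sum: "coef (sum f A) = (\<Sum>a\<in>A. coef (f a))"
  by (induction A rule: infinite_finite_induct) (simp_all add: coef_add)

lemma coef_prod: "coef (prod f A) = (\<Prod>a\<in>A. coef (f a))"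
  by (induction A rule: infinite_finite_induct) (simp_all add: coef_mult)

lemma coef_power: "coef (p ^ n) = coef p ^ n"
  by (induction n) (simp_all add: coef_mult)

lemma coef_of_nat: "coef (of_nat n) = of_nat n"
  by (induction n) (simp_all add: coef_add)

lemma not_root_of_unity_tvar: "not_root_of_unity tvar"
proof -
  have "[:0, 1:] ^ j \<noteq> (1 :: int poly)" if "j > 0" for j
  proof
    assume "[:0, 1:] ^ j = (1 :: int poly)"
    then have "poly ([:0, 1:] ^ j) 0 = (1 :: int)" by simp
    then show False using that by (simp add: poly_power power_0_left)
  qed
  then show ?thesis
    by (simp add: not_root_of_unity_def tvar_def coef_eq_iff flip: coef_power coef_1)
qed

lemma inj_xvar: "inj xvar"
proof (rule injI)
  fix i j assume "xvar i = xvar j"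
  then have "Poly_Mapping.single (Poly_Mapping.single i (Suc 0)) (1 :: int poly)
      = Poly_Mapping.single (Poly_Mapping.single j (Suc 0)) 1"
    by (simp add: xvar_def)
  then have "Poly_Mapping.lookup (Poly_Mapping.single (Poly_Mapping.single i (Suc 0)) (1 :: int poly)) (Poly_Mapping.single i (Suc 0))
      = Poly_Mapping.lookup (Poly_Mapping.single (Poly_Mapping.single j (Suc 0)) 1) (Poly_Mapping.single i (Suc 0))"
    by simp
  then have "Poly_Mapping.single i (Suc 0) = Poly_Mapping.single j (Suc 0)"
    by (simp add: lookup_single when_def split: if_splits)
  then have "Poly_Mapping.lookup (Poly_Mapping.single i (Suc 0)) i = Poly_Mapping.lookup (Poly_Mapping.single j (Suc 0)) i" by simp
  then show "i = j" by (simp add: lookup_single when_def split: if_splits)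
qed

lemma xvar_nonzero: "xvar i \<noteq> 0"
proof
  assume "xvar i = 0"
  then have "Poly_Mapping.single (Poly_Mapping.single i (Suc 0)) (1 :: int poly) = 0"
    by (simp add: xvar_def)
  then have "Poly_Mapping.lookup (Poly_Mapping.single (Poly_Mapping.single i (Suc 0)) (1 :: int poly)) (Poly_Mapping.single i (Suc 0)) = 0"
    by simp
  then show False by simp
qed

lemma hall_littlewood_tvar: "hall_littlewood tvar xvar"
  by unfold_locales (simp_all add: inj_xvar xvar_nonzero not_root_of_unity_tvar)

lemma hall_littlewood_0: "hall_littlewood 0 xvar"
  by unfold_locales (simp_all add: inj_xvar xvar_nonzero not_root_of_unity_def power_0_left)

lemma vcols_nonzero: "not_root_of_unity t \<Longrightarrow> vcols t cs n \<noteq> 0"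
proof (induction cs arbitrary: n)
  case Nil
  then have "1 - t ^ j \<noteq> 0" if "j > 0" for j using that by (auto simp: not_root_of_unity_def)
  from this this[of 1] show ?case by (auto simp: vfac_def)
next
  case (Cons l cs)
  from Cons.prems have "1 - t ^ j \<noteq> 0" if "j > 0" for j using that by (auto simp: not_root_of_unity_def)
  from this this[of 1] have "vfac t m \<noteq> 0" for m by (auto simp: vfac_def)
  then show ?case using Cons by simp
qed

lemma hl_cols_few_variables: "n < hd0 cs \<Longrightarrow> hl_cols t x cs {..<n} = 0"
  by (subst hl_cols_hd0) (simp_all add: ksub_eq_empty)

lemma hall_littlewood_P_of_cols:
  assumes "decreasing cs"
  shows "hall_littlewood_P n (of_cols cs) = hl_cols tvar xvar cs {..<n}"
proof (cases "hd0 cs \<le> n")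
  case True
  then have "hall_littlewood_P n (of_cols cs) = hl_sum tvar xvar n (of_cols cs) / v_part n (of_cols cs)"
    by (simp add: hall_littlewood_P_def hl_sum_def length_of_cols[OF assms])
  then show ?thesis
    using hl_sum_of_cols[OF hall_littlewood_tvar assms True] vcols_nonzero[OF not_root_of_unity_tvar]
    by (simp add: v_part_of_cols[OF assms])
qed (simp add: hall_littlewood_P_def length_of_cols[OF assms] hl_cols_few_variables)

section \<open>The Vandermonde product, alternants and the case \<open>t = 0\<close>\<close>

definition vandermonde :: "nat \<Rightarrow> (nat \<Rightarrow> 'a::field) \<Rightarrow> 'a" where
  "vandermonde n y = (\<Prod>j<n. \<Prod>i<j. y i - y j)"

text \<open>The pairs whose order is reversed are \<open>(a, b)\<close> and, for each
  \<open>c\<close> strictly between, \<open>(a, c)\<close> and \<open>(c, b)\<close>: an odd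
  number.\<close>

lemma vandermonde_transpose:
  assumes "a < b" "b < n"
  shows "vandermonde n (y \<circ> Transposition.transpose a b) = - vandermonde n y"
proof -
  let ?\<tau> = "Transposition.transpose a b"
  let ?P = "{(i, j). i < j \<and> j < n}"
  let ?I = "{(i, j). i < j \<and> j < n \<and> ?\<tau> j < ?\<tau> i}"
  \<comment> \<open>Applies the transposition to a pair and sorts the result; this is an involution
    of \<open>?P\<close>.\<close>
  let ?\<phi> = "\<lambda>(i, j). if ?\<tau> i < ?\<tau> j then (?\<tau> i, ?\<tau> j) else (?\<tau> j, ?\<tau> i)"
  have \<tau>: "?\<tau> i < n \<longleftrightarrow> i < n" for i using assms by (auto simp: transpose_def)
  have inj: "?\<tau> i = ?\<tau> j \<longleftrightarrow> i = j" for i j by (metis transpose_involutory)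
  have P: "?P = (\<lambda>(j, i). (i, j)) ` Sigma {..<n} (\<lambda>j. {..<j})" by auto
  have finP: "finite ?P" unfolding P by (intro finite_imageI finite_SigmaI) auto
  have V: "vandermonde n z = (\<Prod>(i, j)\<in>?P. z i - z j)" for z :: "nat \<Rightarrow> 'a"
    unfolding vandermonde_def P
    by (subst prod.Sigma) (auto simp: prod.reindex inj_on_def intro!: prod.cong)
  have I: "?I = insert (a, b) ((\<lambda>c. (a, c)) ` {a<..<b} \<union> (\<lambda>c. (c, b)) ` {a<..<b})"
    using assms by (auto simp: transpose_def split: if_splits)
  have "card ?I = Suc (card ((\<lambda>c. (a, c)) ` {a<..<b} \<union> (\<lambda>c. (c, b)) ` {a<..<b}))"
    unfolding I by (subst card_insert_disjoint) auto
  also have "card ((\<lambda>c. (a, c)) ` {a<..<b} \<union> (\<lambda>c. (c, b)) ` {a<..<b}) = 2 * card {a<..<b}"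
    by (subst card_Un_disjoint) (auto simp: card_image inj_on_def)
  finally have cardI: "(-1 :: 'a) ^ card ?I = -1" by simp
  have "vandermonde n (y \<circ> ?\<tau>) = (\<Prod>p\<in>?P. (if p \<in> ?I then -1 else 1) * (case ?\<phi> p of (i, j) \<Rightarrow> y i - y j))"
    unfolding V
  proof (intro prod.cong refl)
    fix p assume "p \<in> ?P"
    then obtain i j where p: "p = (i, j)" "i < j" "j < n" by auto
    then have "?\<tau> i \<noteq> ?\<tau> j" using inj by simp
    then consider "?\<tau> i < ?\<tau> j" | "?\<tau> j < ?\<tau> i" by linarith
    then show "(case p of (i, j) \<Rightarrow> (y \<circ> ?\<tau>) i - (y \<circ> ?\<tau>) j)
        = (if p \<in> ?I then -1 else 1) * (case ?\<phi> p of (i, j) \<Rightarrow> y i - y j)"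
      by cases (use p in auto)
  qed
  also have "\<dots> = (\<Prod>p\<in>?P. if p \<in> ?I then -1 else 1) * (\<Prod>p\<in>?P. case ?\<phi> p of (i, j) \<Rightarrow> y i - y j)"
    by (rule prod.distrib)
  also have "(\<Prod>p\<in>?P. if p \<in> ?I then -1 else 1) = (\<Prod>p\<in>?I. -1 :: 'a)"
    using finP by (intro prod.mono_neutral_cong_right) auto
  also have "\<dots> = -1" using cardI by simp
  also have "(\<Prod>p\<in>?P. case ?\<phi> p of (i, j) \<Rightarrow> y i - y j) = (\<Prod>(i, j)\<in>?P. y i - y j)"
  proof (rule prod.reindex_bij_witness[of _ ?\<phi> ?\<phi>])
    have ne: "i < j \<Longrightarrow> ?\<tau> i \<noteq> ?\<tau> j" for i j using inj by simp
    fix p assume "p \<in> ?P"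
    then obtain i j where p: "p = (i, j)" "i < j" "j < n" by auto
    show "?\<phi> (?\<phi> p) = p" "?\<phi> p \<in> ?P"
      using p ne[of i j] \<tau> by (auto simp: transpose_involutory)
    then show "?\<phi> (?\<phi> p) = p" "?\<phi> p \<in> ?P" by blast+
  qed auto
  finally show ?thesis unfolding V by simp
qed

lemma vandermonde_permute:
  fixes y :: "nat \<Rightarrow> 'a::field"
  assumes "w permutes {..<n}"
  shows "vandermonde n (y \<circ> w) = of_int (sign w) * vandermonde n y"
  using finite_lessThan assms
proof (induction w rule: permutes_rev_induct)
  case (swap a b p)
  have t: "vandermonde n (z \<circ> Transposition.transpose a b) = - vandermonde n z" for z :: "nat \<Rightarrow> 'a"
  proof (cases "a < b")
    case True
    then show ?thesis using swap.hyps by (intro vandermonde_transpose) auto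
  next
    case False
    then show ?thesis using swap.hyps by (subst transpose_commute) (intro vandermonde_transpose, auto)
  qed
  have "permutation p" using swap.hyps by (intro permutes_imp_permutation[OF finite_lessThan])
  then have "sign (p \<circ> Transposition.transpose a b) = - sign p"
    using swap.hyps by (simp add: sign_compose permutation_swap_id sign_swap_id)
  moreover have "vandermonde n (y \<circ> (p \<circ> Transposition.transpose a b)) = - vandermonde n (y \<circ> p)"
    using t[of "y \<circ> p"] by (simp only: o_assoc)
  ultimately show ?case unfolding swap.IH by (simp only: of_int_minus) simp
qed (simp add: sign_id)

lemma vandermonde_nonzero: "inj y \<Longrightarrow> vandermonde n y \<noteq> 0"
  by (auto simp: vandermonde_def inj_eq)

lemma sign_square: "of_int (sign w) * of_int (sign w) = (1 :: 'a::ring_1)"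
  by (simp add: sign_def)

lemma prod_lessThan_powers: "(\<Prod>j<n. \<Prod>i<j. z i) = (\<Prod>i<n. (z i :: 'a::comm_monoid_mult) ^ (n - 1 - i))"
proof (induction n)
  case (Suc n)
  have "(\<Prod>i<n. z i ^ (n - 1 - i)) * (\<Prod>i<n. z i) = (\<Prod>i<n. z i ^ (n - i))"
    unfolding prod.distrib[symmetric] by (intro prod.cong refl) (auto simp: Suc_diff_Suc simp flip: power_Suc2)
  then show ?case using Suc by simp
qed simp

text \<open>The denominators belonging to \<open>w\<close> form the Vandermonde product of
  \<open>x \<circ> w\<close>, which is the original one up to the sign of \<open>w\<close>.\<close>

lemma vandermonde_times_hl_sum:
  assumes "inj x"
  shows "vandermonde n x * hl_sum t x n lam = (\<Sum>w | w permutes {..<n}. of_int (sign w) *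
    ((\<Prod>i<n. x (w i) ^ part lam i) * (\<Prod>j<n. \<Prod>i<j. x (w i) - t * x (w j))))"
  unfolding hl_sum_def sum_distrib_left
proof (intro sum.cong refl)
  fix w assume "w \<in> {w. w permutes {..<n}}"
  then have w: "vandermonde n (x \<circ> w) = of_int (sign w) * vandermonde n x"
    by (intro vandermonde_permute) simp
  have "vandermonde n x \<noteq> 0" by (rule vandermonde_nonzero[OF assms])
  have "vandermonde n x = of_int (sign w) * vandermonde n (x \<circ> w)"
    unfolding w mult.assoc[symmetric] sign_square by simp
  moreover have "vandermonde n (x \<circ> w) \<noteq> 0"
    using \<open>vandermonde n x \<noteq> 0\<close> calculation by auto
  ultimately show "vandermonde n x * ((\<Prod>i<n. x (w i) ^ part lam i) *
      (\<Prod>j<n. \<Prod>i<j. (x (w i) - t * x (w j)) / (x (w i) - x (w j))))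
    = of_int (sign w) * ((\<Prod>i<n. x (w i) ^ part lam i) * (\<Prod>j<n. \<Prod>i<j. x (w i) - t * x (w j)))"
    by (simp add: prod_dividef vandermonde_def)
qed

lemma vandermonde_times_hl_sum_0:
  "vandermonde n xvar * hl_sum 0 xvar n lam = alternant n (\<lambda>i. part lam i + (n - 1 - i))"
  unfolding vandermonde_times_hl_sum[OF inj_xvar] alternant_def
  unfolding power_add prod.distrib by (simp add: prod_lessThan_powers)

lemma vcols_0: "vcols 0 cs n = 1"
  by (induction cs arbitrary: n) (simp_all add: vfac_def power_0_left)

lemma schur_of_cols:
  assumes "decreasing cs"
  shows "schur n (of_cols cs) = hl_cols 0 xvar cs {..<n}"
proof (cases "hd0 cs \<le> n")
  case True
  \<comment> \<open>The empty partition identifies the denominator of the bialternant with the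
    Vandermonde product, without evaluating a determinant.\<close>
  have "hl_sum 0 xvar n [] = 1"
    using hl_sum_of_cols[OF hall_littlewood_0, of "[]" n] by (simp add: vcols_0 del: vcols.simps)
  then have "alternant n (\<lambda>i. n - 1 - i) = vandermonde n xvar"
    using vandermonde_times_hl_sum_0[of n "[]"] by (simp add: part_def)
  moreover have "alternant n (\<lambda>i. part (of_cols cs) i + (n - 1 - i)) = vandermonde n xvar * hl_cols 0 xvar cs {..<n}"
    unfolding vandermonde_times_hl_sum_0[symmetric]
    by (simp add: hl_sum_of_cols[OF hall_littlewood_0 assms True] vcols_0)
  moreover have "schur n (of_cols cs)
      = alternant n (\<lambda>i. part (of_cols cs) i + (n - 1 - i)) / alternant n (\<lambda>i. n - 1 - i)"
    using True unfolding schur_def length_of_cols[OF assms] by (simp only: if_True)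
  ultimately show ?thesis
    using vandermonde_nonzero[OF inj_xvar, of n] by simp
qed (simp add: schur_def length_of_cols[OF assms] hl_cols_few_variables)


section \<open>Linear independence of the Hall--Littlewood functions\<close>

definition xpoly_var :: "nat \<Rightarrow> xpoly" where
  "xpoly_var i = Poly_Mapping.single (Poly_Mapping.single i 1) 1"

definition xpoly_t :: xpoly where
  "xpoly_t = Poly_Mapping.single 0 [:0, 1:]"

text \<open>Kept in the polynomial ring because divisibility by \<open>t\<close> has no content in
  the fraction field.\<close>

definition hl_numerator :: "nat \<Rightarrow> nat list \<Rightarrow> xpoly" where
  "hl_numerator n lam = (\<Sum>w | w permutes {..<n}. of_int (sign w) *
    ((\<Prod>i<n. xpoly_var (w i) ^ part lam i) * (\<Prod>j<n. \<Prod>i<j. xpoly_var (w i) - xpoly_t * xpoly_var (w j))))"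

text \<open>\<open>hl_numerator\<close> with \<open>t\<close> set to \<open>0\<close>: the inner
  products give \<open>x^\<delta>\<close>, so this is the alternant of
  \<open>\<lambda> + \<delta>\<close>.\<close>

definition schur_numerator :: "nat \<Rightarrow> nat list \<Rightarrow> xpoly" where
  "schur_numerator n lam = (\<Sum>w | w permutes {..<n}. of_int (sign w) *
    ((\<Prod>i<n. xpoly_var (w i) ^ part lam i) * (\<Prod>j<n. \<Prod>i<j. xpoly_var (w i))))"

lemma to_fract_hl_numerator: "to_fract (hl_numerator n lam) = vandermonde n xvar * hl_sum tvar xvar n lam"
  unfolding vandermonde_times_hl_sum[OF inj_xvar] hl_numerator_def
  by (simp add: to_fract_prod to_fract_power to_fract_of_int xpoly_var_def xpoly_t_def tvar_def coef_def xvar_def)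

lemma dvd_prod_diff:
  fixes T :: "'a::comm_ring_1"
  assumes "\<And>a. a \<in> A \<Longrightarrow> T dvd f a - g a"
  shows "T dvd prod f A - prod g A"
  using assms
proof (induction A rule: infinite_finite_induct)
  case (insert a A)
  have "prod f (insert a A) - prod g (insert a A) = (f a - g a) * prod f A + g a * (prod f A - prod g A)"
    using insert by (simp add: algebra_simps)
  then show ?case using insert by (metis dvd_add dvd_mult dvd_mult2 insertCI)
qed simp_all

lemma xpoly_t_dvd_numerators: "xpoly_t dvd hl_numerator n lam - schur_numerator n lam"
  unfolding hl_numerator_def schur_numerator_def sum_subtractf[symmetric] right_diff_distrib[symmetric]
  by (intro dvd_sum dvd_mult dvd_prod_diff) simp

lemma lookup_const_times: "Poly_Mapping.lookup (Poly_Mapping.single 0 c * (p :: xpoly)) k = c * Poly_Mapping.lookup p k"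
  unfolding mult_map_scale_conv_mult[symmetric] by (simp add: Poly_Mapping.map.rep_eq when_def)

definition shifted :: "nat \<Rightarrow> nat list \<Rightarrow> nat \<Rightarrow> nat" where
  "shifted n lam i = part lam i + (n - 1 - i)"

definition shifted_exponent :: "nat \<Rightarrow> nat list \<Rightarrow> nat \<Rightarrow>\<^sub>0 nat" where
  "shifted_exponent n lam = (\<Sum>i<n. Poly_Mapping.single i (shifted n lam i))"

lemma part_antimono: "is_partition lam \<Longrightarrow> i \<le> j \<Longrightarrow> part lam j \<le> part lam i"
  by (cases "i = j") (auto simp: is_partition_def part_def sorted_wrt_iff_nth_less)

lemma shifted_strict: "is_partition lam \<Longrightarrow> i < j \<Longrightarrow> j < n \<Longrightarrow> shifted n lam j < shifted n lam i"
  unfolding shifted_def using part_antimono[of lam i j] by simp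

lemma partition_eqI:
  assumes "is_partition lam" "is_partition mu" "length lam \<le> n" "length mu \<le> n"
    and "\<And>i. i < n \<Longrightarrow> part lam i = part mu i"
  shows "lam = mu"
proof -
  have len: "length nu = card {i. i < n \<and> part nu i \<noteq> 0}" if "is_partition nu" "length nu \<le> n" for nu
  proof -
    have "part nu i \<noteq> 0" if "i < length nu" for i
      using \<open>is_partition nu\<close> nth_mem[OF that] that unfolding is_partition_def part_def by metis
    then have "{i. i < n \<and> part nu i \<noteq> 0} = {..<length nu}"
      using that(2) by (auto simp: part_def split: if_splits)
    then show ?thesis by simp
  qed
  have eq: "{i. i < n \<and> part lam i \<noteq> 0} = {i. i < n \<and> part mu i \<noteq> 0}" using assms(5) by auto
  have l: "length lam = length mu" unfolding len[OF assms(1,3)] len[OF assms(2,4)] eq ..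
  show ?thesis
  proof (rule nth_equalityI[OF l])
    fix i assume "i < length lam"
    then show "lam ! i = mu ! i" using assms(3) assms(5)[of i] l by (simp add: part_def)
  qed
qed

lemma permutes_increasing_id:
  assumes "w permutes {..<n}" "\<And>i j. i < j \<Longrightarrow> j < n \<Longrightarrow> w i < w j" "i < n"
  shows "w i = (i :: nat)"
proof -
  have "map w [0..<n] = [0..<n]"
  proof (rule sorted_distinct_set_unique)
    have "sorted_wrt (<) (map w [0..<n])"
      using assms(2) by (auto simp: sorted_wrt_iff_nth_less)
    then show "sorted (map w [0..<n])" "distinct (map w [0..<n])"
      by (auto simp: strict_sorted_iff)
    show "set (map w [0..<n]) = set [0..<n]"
      using permutes_image[OF assms(1)] by (simp add: atLeast0LessThan)
  qed auto
  then have "map w [0..<n] ! i = [0..<n] ! i" by simp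
  then show ?thesis using assms(3) by simp
qed

lemma xpoly_var_power: "xpoly_var i ^ m = Poly_Mapping.single (Poly_Mapping.single i m) 1"
  by (induction m) (simp_all add: xpoly_var_def mult_single single_add[symmetric])

lemma prod_single_one: "(\<Prod>a\<in>A. Poly_Mapping.single (e a) (1::int poly)) = (Poly_Mapping.single (sum e A) 1 :: xpoly)"
  by (induction A rule: infinite_finite_induct) (simp_all add: mult_single)

text \<open>The sequences \<open>\<lambda> + \<delta>\<close> and \<open>\<mu> + \<delta>\<close>
  are strictly decreasing, so a permutation matching them is increasing, hence the identity. A
  single monomial thus detects each alternant.\<close>

lemma lookup_schur_numerator:
  assumes "is_partition lam" "is_partition mu" "length lam \<le> n" "length mu \<le> n"
  shows "Poly_Mapping.lookup (schur_numerator n mu) (shifted_exponent n lam) = (if mu = lam then 1 else 0)"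
proof -
  let ?e = "\<lambda>w. \<Sum>i<n. Poly_Mapping.single (w i) (shifted n mu i)"
  have num: "schur_numerator n mu = (\<Sum>w | w permutes {..<n}. Poly_Mapping.single (?e w) (of_int (sign w)))"
    unfolding schur_numerator_def
  proof (intro sum.cong refl)
    fix w
    have "(\<Prod>i<n. xpoly_var (w i) ^ part mu i) * (\<Prod>j<n. \<Prod>i<j. xpoly_var (w i)) = Poly_Mapping.single (?e w) 1"
      unfolding prod_lessThan_powers xpoly_var_power prod_single_one mult_single
      unfolding shifted_def single_add sum.distrib by simp
    then show "of_int (sign w) * ((\<Prod>i<n. xpoly_var (w i) ^ part mu i) * (\<Prod>j<n. \<Prod>i<j. xpoly_var (w i)))
        = Poly_Mapping.single (?e w) (of_int (sign w))"
      by (simp add: single_of_int[symmetric] mult_single del: single_of_int)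
  qed
  have key: "?e w = shifted_exponent n lam \<longleftrightarrow> mu = lam \<and> w = id" if w: "w permutes {..<n}" for w
  proof
    assume e: "?e w = shifted_exponent n lam"
    have s: "shifted n mu i = shifted n lam (w i)" if i: "i < n" for i
    proof -
      have wi: "w i < n" using i w by (metis lessThan_iff permutes_in_image)
      have "Poly_Mapping.lookup (?e w) (w i) = (\<Sum>j<n. if j = i then shifted n mu j else 0)"
        unfolding lookup_sum lookup_single when_def
        using permutes_inj[OF w] by (intro sum.cong refl) (auto dest: injD)
      moreover have "Poly_Mapping.lookup (shifted_exponent n lam) (w i) = (\<Sum>j<n. if j = w i then shifted n lam j else 0)"
        unfolding shifted_exponent_def lookup_sum lookup_single when_def by (intro sum.cong refl)
      ultimately show ?thesis using e i wi by simp
    qed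
    have "w i < w j" if "i < j" "j < n" for i j
    proof (rule ccontr)
      assume "\<not> w i < w j"
      moreover have "w i \<noteq> w j" using that permutes_inj[OF w] by (auto dest: injD)
      ultimately have "w j < w i" by simp
      moreover have "w i < n" using that w by (metis lessThan_iff order.strict_trans permutes_in_image)
      ultimately have "shifted n lam (w i) < shifted n lam (w j)" by (rule shifted_strict[OF assms(1)])
      moreover have "shifted n mu j < shifted n mu i" using that by (rule shifted_strict[OF assms(2)])
      ultimately show False using s[of i] s[of j] that by simp
    qed
    then have wid: "w i = i" if "i < n" for i using permutes_increasing_id[OF w _ that] by blast
    have "w = id"
    proof
      fix i show "w i = id i" using wid permutes_not_in[OF w, of i] by (cases "i < n") auto
    qed
    moreover have "mu = lam"
    proof (rule partition_eqI[OF assms(2,1,4,3)])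
      fix i assume "i < n"
      then show "part mu i = part lam i"
        using s[of i] wid[of i] by (simp only: shifted_def add_right_cancel)
    qed
    ultimately show "mu = lam \<and> w = id" by simp
  qed (auto simp: shifted_exponent_def)
  have "Poly_Mapping.lookup (schur_numerator n mu) (shifted_exponent n lam)
      = (\<Sum>w | w permutes {..<n}. if w = id then (if mu = lam then 1 else 0) else 0)"
    unfolding num lookup_sum lookup_single when_def
    by (intro sum.cong refl) (auto simp: key sign_id)
  also have "\<dots> = (if mu = lam then 1 else 0)"
    by (simp add: finite_permutations permutes_id)
  finally show ?thesis .
qed

text \<open>Modulo \<open>t\<close> the relation is one between alternants, and the coefficient at
  \<open>shifted_exponent n lam\<close> isolates \<open>E lam\<close>.\<close>

lemma hl_numerator_independent_step:
  assumes "finite F" "\<And>lam. lam \<in> F \<Longrightarrow> is_partition lam \<and> length lam \<le> n"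
    and "(\<Sum>lam\<in>F. Poly_Mapping.single 0 (E lam) * hl_numerator n lam) = 0" "lam \<in> F"
  shows "[:0, 1:] dvd E lam"
proof -
  let ?s = "\<Sum>mu\<in>F. Poly_Mapping.single 0 (E mu) * schur_numerator n mu"
  have "xpoly_t dvd (\<Sum>mu\<in>F. Poly_Mapping.single 0 (E mu) * (hl_numerator n mu - schur_numerator n mu))"
    by (intro dvd_sum dvd_mult xpoly_t_dvd_numerators)
  also have "\<dots> = - ?s"
    using assms(3) by (simp add: right_diff_distrib sum_subtractf)
  finally have "xpoly_t dvd ?s" by simp
  then obtain q where q: "?s = xpoly_t * q" by (elim dvdE)
  have "E lam = (\<Sum>mu\<in>F. if mu = lam then E mu else 0)"
    using assms(1,4) by simp
  also have "\<dots> = (\<Sum>mu\<in>F. E mu * (if mu = lam then 1 else 0))"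
    by (intro sum.cong) auto
  also have "\<dots> = Poly_Mapping.lookup ?s (shifted_exponent n lam)"
    unfolding lookup_sum lookup_const_times
    by (intro sum.cong refl arg_cong2[where f = "(*)"] lookup_schur_numerator[symmetric])
       (use assms(2,4) in auto)
  also have "\<dots> = [:0, 1:] * Poly_Mapping.lookup q (shifted_exponent n lam)"
    unfolding q xpoly_t_def lookup_const_times ..
  finally show ?thesis by (rule dvdI)
qed

text \<open>Modulo \<open>t\<close> the numerators become alternants, whose leading monomials are distinct; hence all
  coefficients of a linear relation are divisible by \<open>t\<close>, and then by every power of \<open>t\<close>.\<close>

lemma hl_numerator_independent:
  assumes "finite F" "\<And>lam. lam \<in> F \<Longrightarrow> is_partition lam \<and> length lam \<le> n"
    and "(\<Sum>lam\<in>F. Poly_Mapping.single 0 (E lam) * hl_numerator n lam) = 0" "lam \<in> F"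
  shows "E lam = 0"
proof (rule ccontr)
  assume ne: "E lam \<noteq> 0"
  have "[:0, 1:] ^ m dvd G lam"
    if "(\<Sum>lam\<in>F. Poly_Mapping.single 0 (G lam) * hl_numerator n lam) = 0" for m and G :: "nat list \<Rightarrow> int poly"
    using that
  proof (induction m arbitrary: G)
    case (Suc m)
    have "\<forall>mu\<in>F. \<exists>H. G mu = [:0, 1:] * H"
      using hl_numerator_independent_step[OF assms(1,2) Suc.prems] by (auto simp: dvd_def)
    then obtain H where H: "\<And>mu. mu \<in> F \<Longrightarrow> G mu = [:0, 1:] * H mu" by metis
    have "xpoly_t * (\<Sum>mu\<in>F. Poly_Mapping.single 0 (H mu) * hl_numerator n mu)
        = (\<Sum>mu\<in>F. Poly_Mapping.single 0 (G mu) * hl_numerator n mu)"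
      unfolding sum_distrib_left
      by (intro sum.cong refl) (simp only: H xpoly_t_def mult.assoc[symmetric] mult_single add_0_left)
    moreover have "xpoly_t \<noteq> 0"
    proof
      assume "xpoly_t = 0"
      then have "Poly_Mapping.lookup xpoly_t 0 = 0" by simp
      then show False by (simp add: xpoly_t_def)
    qed
    ultimately have "(\<Sum>mu\<in>F. Poly_Mapping.single 0 (H mu) * hl_numerator n mu) = 0"
      using Suc.prems by simp
    then have "[:0, 1:] ^ m dvd H lam" by (rule Suc.IH)
    then show ?case unfolding H[OF assms(4)] power_Suc by (rule mult_dvd_mono[OF dvd_refl])
  qed simp
  from this[OF assms(3), of "Suc (degree (E lam))"]
  have "degree ([:0, 1 :: int:] ^ Suc (degree (E lam))) \<le> degree (E lam)"
    using ne by (rule dvd_imp_degree_le)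
  then show False by (simp add: degree_power_eq del: power_Suc)
qed

section \<open>From the numerators to the functions \<open>P_\<lambda>\<close>\<close>

lemma v_fac_coef: "\<exists>u. v_fac m = coef u"
proof -
  have "(1 - tvar ^ j) / (1 - tvar) = coef (\<Sum>i<j. [:0, 1:] ^ i)" for j
  proof -
    have "tvar \<noteq> 1" using not_root_of_unity_tvar by (auto simp: not_root_of_unity_def dest: spec[of _ 1])
    then show ?thesis
      by (simp add: coef_sum coef_power flip: tvar_def) (simp add: sum_gp_strict)
  qed
  then have "v_fac m = coef (\<Prod>j=1..m. \<Sum>i<j. [:0, 1:] ^ i)"
    by (simp add: v_fac_def coef_prod)
  then show ?thesis ..
qed

lemma v_part_coef: "\<exists>u. v_part n lam = coef u"
proof -
  obtain u where "\<And>m. v_fac m = coef (u m)" using v_fac_coef by metis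
  then show ?thesis by (simp add: v_part_def flip: coef_prod coef_mult) blast
qed

lemma v_part_nonzero:
  assumes "is_partition lam"
  shows "v_part n lam \<noteq> 0"
proof -
  have "of_cols (cols_of (sum_list lam) lam) = lam"
    using assms member_le_sum_list by (intro of_cols_cols_of) auto
  then show ?thesis
    using v_part_of_cols[OF decreasing_cols_of, of n "sum_list lam" lam] vcols_nonzero[OF not_root_of_unity_tvar]
    by simp
qed

text \<open>The numerators differ from the \<open>P_\<lambda>\<close> by factors
  \<open>v_\<lambda>(t)\<close> that depend on \<open>\<lambda>\<close>. Multiplying the relation by
  all of them keeps the coefficients in \<open>\<int>[t]\<close>; the result is
  \<open>?E\<close>.\<close>

theorem hall_littlewood_P_independent:
  assumes "finite F" "\<And>lam. lam \<in> F \<Longrightarrow> is_partition lam"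
    and "\<And>n. (\<Sum>lam\<in>F. coef (E lam) * hall_littlewood_P n lam) = 0" "lam \<in> F"
  shows "E lam = 0"
proof -
  \<comment> \<open>Enough variables for every partition in \<open>F\<close>: a function with more
    parts than variables is zero.\<close>
  define n where "n = (\<Sum>lam\<in>F. length lam)"
  have len: "length mu \<le> n" if "mu \<in> F" for mu
    unfolding n_def using assms(1) that by (intro member_le_sum) auto
  obtain u where u: "\<And>mu. v_part n mu = coef (u mu)" using v_part_coef by metis
  have u0: "u mu \<noteq> 0" if "mu \<in> F" for mu
    using v_part_nonzero[OF assms(2)[OF that], of n] u[of mu] coef_eq_iff[of "u mu" 0] by auto
  let ?E = "\<lambda>mu. E mu * (\<Prod>nu\<in>F - {mu}. u nu)"
  let ?U = "\<Prod>nu\<in>F. u nu"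
  have "to_fract (\<Sum>mu\<in>F. Poly_Mapping.single 0 (?E mu) * hl_numerator n mu)
      = (\<Sum>mu\<in>F. coef (?E mu) * (vandermonde n xvar * hl_sum tvar xvar n mu))"
    by (simp add: to_fract_hl_numerator coef_def)
  also have "\<dots> = (\<Sum>mu\<in>F. coef ?U * vandermonde n xvar * (coef (E mu) * hall_littlewood_P n mu))"
  proof (intro sum.cong refl)
    fix mu assume mu: "mu \<in> F"
    have "coef ?U = coef (u mu) * coef (\<Prod>nu\<in>F - {mu}. u nu)"
      using assms(1) mu by (simp add: prod.remove flip: coef_mult)
    moreover have "hall_littlewood_P n mu = hl_sum tvar xvar n mu / coef (u mu)"
      using len[OF mu] u[of mu] by (simp add: hall_littlewood_P_def hl_sum_def)
    moreover have "coef (u mu) \<noteq> 0" using u0[OF mu] coef_eq_iff[of "u mu" 0] by simp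
    ultimately show "coef (?E mu) * (vandermonde n xvar * hl_sum tvar xvar n mu)
        = coef ?U * vandermonde n xvar * (coef (E mu) * hall_littlewood_P n mu)"
      by (simp add: coef_mult)
  qed
  also have "\<dots> = 0" unfolding sum_distrib_left[symmetric] assms(3) by simp
  finally have "(\<Sum>mu\<in>F. Poly_Mapping.single 0 (?E mu) * hl_numerator n mu) = 0"
    by (simp only: to_fract_eq_0_iff)
  then have "?E lam = 0"
    using assms len by (intro hl_numerator_independent[of F n ?E]) auto
  then show ?thesis using u0 assms(1) by auto
qed


section \<open>Two-row shapes\<close>

text \<open>The two-row shapes for which a tableau of weight \<open>(p, |\<eta>| - p)\<close> exists.\<close>

definition interlaced :: "nat list \<Rightarrow> nat \<Rightarrow> bool" where
  "interlaced eta p \<longleftrightarrow> length eta \<le> 2 \<and> part eta 1 \<le> p \<and> p \<le> part eta 0"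

section \<open>Conjugate partitions and the Pieri rule for Schur functions\<close>

lemma downward_closed_iff:
  fixes A :: "nat set"
  assumes "finite A" "\<And>i j. j \<in> A \<Longrightarrow> i \<le> j \<Longrightarrow> i \<in> A"
  shows "r \<in> A \<longleftrightarrow> r < card A"
proof -
  define m where "m = (LEAST m. m \<notin> A)"
  have "\<exists>m. m \<notin> A" using assms(1) ex_new_if_finite infinite_UNIV_nat by blast
  then have m: "m \<notin> A" unfolding m_def by (rule LeastI_ex)
  have "i \<in> A" if "i < m" for i using that not_less_Least unfolding m_def by blast
  then have "A = {..<m}" using m assms(2) by (auto simp: not_le[symmetric])
  then show ?thesis by simp
qed

text \<open>The rows longer than \<open>i\<close> form an initial segment, so comparing
  \<open>r\<close> with their number decides whether row \<open>r\<close> is among them.\<close>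

lemma less_conj_part_iff:
  assumes "is_partition eta"
  shows "r < conj_part eta (Suc i) \<longleftrightarrow> i < part eta r"
proof -
  have e: "{r. r < length eta \<and> Suc i \<le> eta ! r} = {r. i < part eta r}"
    by (auto simp: part_def split: if_splits)
  have "finite {r. i < part eta r}" unfolding e[symmetric] by simp
  then have "r \<in> {r. i < part eta r} \<longleftrightarrow> r < card {r. i < part eta r}"
    by (rule downward_closed_iff) (use part_antimono[OF assms] in fastforce)
  then show ?thesis unfolding conj_part_def e by simp
qed

lemma part_le_sum_list: "part eta r \<le> sum_list eta"
  by (simp add: part_def member_le_sum_list)

lemma length_le_2_iff: "is_partition eta \<Longrightarrow> length eta \<le> 2 \<longleftrightarrow> part eta 2 = 0"
  by (auto simp: is_partition_def part_def not_le) (metis gr0I nth_mem)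

lemma sum_list_two_rows: "length eta \<le> 2 \<Longrightarrow> sum_list eta = part eta 0 + part eta 1"
  by (cases eta; cases "tl eta") (auto simp: part_def)

text \<open>A power of \<open>0\<close> survives only with exponent \<open>0\<close>, that is, when
  a column grows by at most one box. These are the horizontal strips.\<close>

lemma pieri_coeff_at_0:
  "length ls = length ms \<Longrightarrow> decreasing ms \<Longrightarrow>
   pieri_coeff 0 ls ms = (if list_all2 (\<lambda>l m. m \<le> l \<and> l \<le> Suc m) ls ms then 1 else (0 :: 'a::comm_ring_1))"
proof (induction ls ms rule: list_induct2)
  case (Cons l ls m ms)
  have dec: "decreasing ms" "hd0 ms \<le> m" using Cons.prems unfolding decreasing_Cons by auto
  have c: "(0 :: 'a) ^ ((l - m) choose 2) = (if l \<le> Suc m then 1 else 0)"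
    by (simp add: power_0_left binomial_eq_0_iff) arith
  show ?case
  proof (cases "m \<le> l")
    case True
    then have "gauss (0 :: 'a) (l - hd0 ms) (m - hd0 ms) = 1" by (intro gauss_at_0) simp
    then show ?thesis using Cons.IH[OF dec(1)] True by (simp add: c)
  qed simp
qed simp

lemma decreasing_zero_one:
  "decreasing ms \<Longrightarrow> \<forall>m\<in>set ms. m \<le> 1 \<Longrightarrow>
    ms = replicate (sum_list ms) 1 @ replicate (length ms - sum_list ms) 0"
proof (induction ms)
  case (Cons m ms)
  show ?case
  proof (cases "m = 0")
    case True
    then have "\<forall>m'\<in>set ms. m' = 0" using Cons.prems(1) by auto
    then have r: "replicate (length ms) 0 = ms" and s: "sum_list ms = 0"
      by (auto intro!: replicate_eqI[symmetric] simp: sum_list_eq_0_iff)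
    show ?thesis unfolding True by (simp add: s r)
  next
    case False
    then have "m = 1" using Cons.prems by auto
    then show ?thesis using Cons by simp
  qed
qed simp

text \<open>At \<open>t = 0\<close> the intermediate partition can only have columns of length at
  most \<open>1\<close>: it is the row of length \<open>p\<close>, in accordance with
  \<open>h_p = s_(p)\<close>.\<close>

lemma hh_coeff_at_0:
  "hh_coeff 0 p cs = (if p \<le> length cs \<and>
      list_all2 (\<lambda>l m. m \<le> l \<and> l \<le> Suc m) cs (replicate p 1 @ replicate (length cs - p) 0) then 1 else (0::'a::comm_ring_1))"
proof -
  let ?k = "length cs" and ?u = "replicate p 1 @ replicate (length cs - p) (0::nat)"
  have dec: "decreasing ?u"
    by (auto simp: sorted_wrt_append) (auto simp: sorted_wrt_iff_nth_less)
  have z: "(0::'a) ^ (\<Sum>m\<leftarrow>ms. m choose 2) = (if ms = ?u then 1 else 0)" if "ms \<in> cols ?k p" for ms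
  proof -
    have ms: "length ms = ?k" "sum_list ms = p" "decreasing ms" using that by (auto simp: cols_def lists_sum_def)
    have "(\<Sum>m\<leftarrow>ms. m choose 2) = 0 \<longleftrightarrow> (\<forall>m\<in>set ms. m \<le> 1)"
      by (auto simp: sum_list_eq_0_iff binomial_eq_0_iff)
    also have "\<dots> \<longleftrightarrow> ms = ?u"
    proof
      assume "ms = ?u"
      then have "set ms = set ?u" by (rule arg_cong)
      then show "\<forall>m\<in>set ms. m \<le> 1" by auto
    qed (use decreasing_zero_one[OF ms(3)] ms in simp)
    finally show ?thesis by (simp add: power_0_left)
  qed
  have "hh_coeff 0 p cs = (\<Sum>ms\<in>cols ?k p. if ms = ?u then pieri_coeff 0 cs ?u else (0::'a))"
    unfolding hh_coeff_def by (intro sum.cong refl) (auto simp: z)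
  also have "\<dots> = (if ?u \<in> cols ?k p then pieri_coeff 0 cs ?u else 0)"
    by simp
  also have "?u \<in> cols ?k p \<longleftrightarrow> p \<le> ?k"
    using dec by (auto simp: cols_def lists_sum_def sum_list_replicate)
  finally show ?thesis
    using pieri_coeff_at_0[OF _ dec, of cs] by auto
qed

lemma hh_coeff_at_0_cols_of:
  assumes "is_partition eta" "sum_list eta \<le> k"
  shows "hh_coeff 0 p (cols_of k eta) = (if interlaced eta p then 1 else (0::'a::comm_ring_1))"
proof -
  have nth: "(replicate p (Suc 0) @ replicate (k - p) 0) ! i = (if i < p then 1 else (0::nat))" if "i < k" "p \<le> k" for i
    using that by (simp add: nth_append)
  have b: "part eta r \<le> k" for r using part_le_sum_list[of eta r] assms(2) by simp
  have "(p \<le> k \<and> list_all2 (\<lambda>l m. m \<le> l \<and> l \<le> Suc m) (cols_of k eta) (replicate p 1 @ replicate (k - p) 0))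
      \<longleftrightarrow> p \<le> k \<and> (\<forall>i<k. (if i < p then 1 else 0) \<le> conj_part eta (Suc i)
          \<and> conj_part eta (Suc i) \<le> (if i < p then 2 else 1))"
    by (auto simp: list_all2_conv_all_nth cols_of_def nth numeral_2_eq_2)
  also have "\<dots> \<longleftrightarrow> p \<le> k \<and> (\<forall>i<k. (i < p \<longrightarrow> 0 < conj_part eta (Suc i) \<and> \<not> 2 < conj_part eta (Suc i))
          \<and> (\<not> i < p \<longrightarrow> \<not> 1 < conj_part eta (Suc i)))"
    by (auto simp: Suc_le_eq not_less)
  \<comment> \<open>The columns have length \<open>1\<close> or \<open>2\<close> before position
    \<open>p\<close> and at most \<open>1\<close> afterwards; \<open>less_conj_part_iff\<close>
    turns this into conditions on the first three rows.\<close>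
  also have "\<dots> \<longleftrightarrow> p \<le> k \<and> (\<forall>i<k. (i < p \<longrightarrow> i < part eta 0 \<and> part eta 2 \<le> i) \<and> (p \<le> i \<longrightarrow> part eta 1 \<le> i))"
    unfolding less_conj_part_iff[OF assms(1)] by (simp add: not_less)
  also have "\<dots> \<longleftrightarrow> part eta 2 = 0 \<and> part eta 1 \<le> p \<and> p \<le> part eta 0" (is "?L \<longleftrightarrow> ?R")
  proof
    assume L: ?L
    have 1: "part eta 1 \<le> p"
    proof (cases "p < k")
      case False
      then show ?thesis using b[of 1] by simp
    qed (use L in auto)
    have 2: "part eta 2 = 0"
    \<comment> \<open>For \<open>p = 0\<close> nothing is said about the third row, but then already
      the second row is empty.\<close>
    proof (cases "p = 0")
      case True
      then show ?thesis using 1 part_antimono[OF assms(1), of 1 2] by simp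
    qed (use L in auto)
    have "p \<le> part eta 0"
    proof (cases p)
      case (Suc q)
      then have "q < k" "q < p" using L by auto
      then have "q < part eta 0" using L by blast
      then show ?thesis using Suc by simp
    qed simp
    then show ?R using 1 2 by simp
  next
    assume ?R
    then show ?L using b[of 0] by auto
  qed
  finally show ?thesis
    by (simp add: hh_coeff_at_0 interlaced_def length_le_2_iff[OF assms(1)])
qed

section \<open>Tableaux with entries \<open>1\<close> and \<open>2\<close>\<close>

lemma diagram_iff: "(r, c) \<in> diagram eta \<longleftrightarrow> c < part eta r"
  by (auto simp: diagram_def part_def)

lemma finite_diagram: "finite (diagram eta)"
proof -
  have "diagram eta = Sigma {..<length eta} (\<lambda>r. {..<eta ! r})" by (auto simp: diagram_def)
  then show ?thesis by simp
qed

definition two_row_tableau :: "nat list \<Rightarrow> nat \<Rightarrow> nat \<times> nat \<Rightarrow> nat" where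
  "two_row_tableau eta p x = (if x \<notin> diagram eta then 0 else if fst x = 0 \<and> snd x < p then 1 else 2)"

text \<open>Strict columns leave room for two rows and force \<open>2\<close> throughout the second.
  The entries \<open>1\<close> are then an initial segment of the first row, of length
  \<open>m1\<close>.\<close>

lemma two_row_tableau_unique:
  assumes "is_partition eta" "T \<in> ssyt eta"
    and wt: "\<And>i. card {x \<in> diagram eta. T x = i + 1} = part [m1, m2] i"
  shows "interlaced eta m1 \<and> T = two_row_tableau eta m1"
proof -
  have out: "T x = 0" if "x \<notin> diagram eta" for x
    using assms(2) that unfolding ssyt_def by blast
  have row: "T (r, c) \<le> T (r, c')" if "c' < part eta r" "c \<le> c'" for r c c'
    using assms(2) that unfolding ssyt_def diagram_iff by auto
  have col: "T (r, c) < T (r', c)" if "c < part eta r'" "r < r'" for r r' c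
    using assms(2) that part_antimono[OF assms(1), of r r'] unfolding ssyt_def diagram_iff by auto
  have T12: "T x = 1 \<or> T x = 2" if "x \<in> diagram eta" for x
  proof (rule ccontr)
    assume n: "\<not> (T x = 1 \<or> T x = 2)"
    have "1 \<le> T x" using assms(2) that by (auto simp: ssyt_def)
    then have "T x - 1 \<ge> 2" using n by auto
    then have "card {y \<in> diagram eta. T y = T x - 1 + 1} = 0" unfolding wt by (simp add: part_def)
    then have "{y \<in> diagram eta. T y = T x - 1 + 1} = {}" using finite_diagram by simp
    moreover have "T x = T x - 1 + 1" using \<open>1 \<le> T x\<close> by simp
    ultimately show False using that by blast
  qed
  have len: "length eta \<le> 2"
  proof (rule ccontr)
    assume "\<not> length eta \<le> 2"
    then have p2: "0 < part eta 2" using length_le_2_iff[OF assms(1)] by simp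
    then have p0: "0 < part eta 0" using part_antimono[OF assms(1), of 0 2] by simp
    have p1: "0 < part eta 1" using p2 part_antimono[OF assms(1), of 1 2] by simp
    have "T (0, 0) < T (1, 0)" "T (1, 0) < T (2, 0)" using col p1 p2 by auto
    moreover have "T (0, 0) \<ge> 1" "T (2, 0) \<le> 2"
      using T12[of "(0, 0)"] T12[of "(2, 0)"] p0 p2 by (auto simp: diagram_iff)
    ultimately show False by simp
  qed
  have row1: "T (0, c) = 1 \<and> T (1, c) = 2" if "c < part eta 1" for c
    using col[of c 1 0] T12[of "(0, c)"] T12[of "(1, c)"] that part_antimono[OF assms(1), of 0 1]
    by (auto simp: diagram_iff)
  have no_row: "part eta r = 0" if "r \<ge> 2" for r
    using len that by (simp add: part_def)
  let ?C = "{c. c < part eta 0 \<and> T (0, c) = 1}"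
  have ones: "{x \<in> diagram eta. T x = 1} = Pair 0 ` ?C"
  proof (intro equalityI subsetI)
    fix x assume x: "x \<in> {x \<in> diagram eta. T x = 1}"
    obtain r c where rc: "x = (r, c)" by (cases x)
    have "r \<noteq> 1" using x row1[of c] unfolding rc by (auto simp: diagram_iff)
    moreover have "r < 2" using x no_row[of r] unfolding rc by (auto simp: diagram_iff not_le[symmetric])
    ultimately have "r = 0" by simp
    then show "x \<in> Pair 0 ` ?C" using x unfolding rc by (auto simp: diagram_iff)
  qed (auto simp: diagram_iff)
  have "card ?C = m1"
    using wt[of 0] unfolding One_nat_def[symmetric] add_0_left ones by (simp add: card_image inj_on_def part_def)
  moreover have "c \<in> ?C \<longleftrightarrow> c < card ?C" for c
  proof (rule downward_closed_iff)
    fix i j assume "j \<in> ?C" "i \<le> j"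
    then show "i \<in> ?C" using row[of j 0 i] T12[of "(0, i)"] by (auto simp: diagram_iff)
  qed simp
  ultimately have C: "c < part eta 0 \<and> T (0, c) = 1 \<longleftrightarrow> c < m1" for c by simp
  have "part eta 1 \<le> m1"
  proof (rule ccontr)
    assume "\<not> part eta 1 \<le> m1"
    then have "m1 < part eta 0 \<and> T (0, m1) = 1"
      using row1[of m1] part_antimono[OF assms(1), of 0 1] by auto
    then show False using C[of m1] by simp
  qed
  moreover have "m1 \<le> part eta 0" using C[of "part eta 0"] by auto
  moreover have "T = two_row_tableau eta m1"
  proof
    fix x :: "nat \<times> nat"
    obtain r c where rc: "x = (r, c)" by (cases x)
    show "T x = two_row_tableau eta m1 x"
    proof (cases "x \<in> diagram eta")
      case True
      then have c: "c < part eta r" unfolding rc diagram_iff .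
      have "r = 0 \<or> r = 1" using no_row[of r] c by (cases "r \<ge> 2") auto
      then show ?thesis
        using True c C[of c] row1[of c] T12[of x] unfolding rc by (auto simp: two_row_tableau_def)
    qed (simp add: out two_row_tableau_def)
  qed
  ultimately show ?thesis using len by (simp add: interlaced_def)
qed

lemma two_row_tableau_exists:
  assumes "is_partition eta" "sum_list eta = m1 + m2" "interlaced eta m1"
  shows "two_row_tableau eta m1 \<in> ssyt eta"
    and "card {x \<in> diagram eta. two_row_tableau eta m1 x = i + 1} = part [m1, m2] i"
proof -
  have il: "length eta \<le> 2" "part eta 1 \<le> m1" "m1 \<le> part eta 0"
    using assms(3) by (auto simp: interlaced_def)
  have sum: "part eta 0 + part eta 1 = m1 + m2" using sum_list_two_rows[OF il(1)] assms(2) by simp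
  have no_row: "part eta r = 0" if "r \<noteq> 0" "r \<noteq> Suc 0" for r
    using il(1) that by (auto simp: part_def)
  have r01: "r = 0 \<or> r = Suc 0" if "c < part eta r" for r c using no_row[of r] that by auto
  have "two_row_tableau eta m1 (r, c) < two_row_tableau eta m1 (r', c)"
    if "c < part eta r" "c < part eta r'" "r < r'" for r r' c
    using r01[OF that(1)] r01[OF that(2)] that il(2) by (auto simp: two_row_tableau_def diagram_iff)
  moreover have "two_row_tableau eta m1 (r, c) \<le> two_row_tableau eta m1 (r, c')"
    if "c < part eta r" "c' < part eta r" "c \<le> c'" for r c c'
    using that by (auto simp: two_row_tableau_def diagram_iff)
  moreover have "1 \<le> two_row_tableau eta m1 x" if "x \<in> diagram eta" for x
    using that by (simp add: two_row_tableau_def)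
  moreover have "two_row_tableau eta m1 x = 0" if "x \<notin> diagram eta" for x
    using that by (simp add: two_row_tableau_def)
  ultimately show "two_row_tableau eta m1 \<in> ssyt eta"
    unfolding ssyt_def diagram_iff mem_Collect_eq by blast
  show "card {x \<in> diagram eta. two_row_tableau eta m1 x = i + 1} = part [m1, m2] i"
  proof -
    consider "i = 0" | "i = 1" | "i \<ge> 2" by linarith
    then show ?thesis
    proof cases
      case 1
      have "{x \<in> diagram eta. two_row_tableau eta m1 x = i + 1} = Pair 0 ` {..<m1}"
        using 1 il(3) by (auto simp: two_row_tableau_def diagram_iff)
      then show ?thesis using 1 by (simp add: card_image inj_on_def part_def)
    next
      case 2
      have "{x \<in> diagram eta. two_row_tableau eta m1 x = i + 1}
          = Pair 0 ` {m1..<part eta 0} \<union> Pair 1 ` {..<part eta 1}"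
      proof (intro set_eqI)
        fix x :: "nat \<times> nat"
        obtain r c where x: "x = (r, c)" by (cases x)
        show "x \<in> {x \<in> diagram eta. two_row_tableau eta m1 x = i + 1}
            \<longleftrightarrow> x \<in> Pair 0 ` {m1..<part eta 0} \<union> Pair 1 ` {..<part eta 1}"
          using 2 r01[of c r] unfolding x by (auto simp: two_row_tableau_def diagram_iff)
      qed
      then have "card {x \<in> diagram eta. two_row_tableau eta m1 x = i + 1}
          = card (Pair (0::nat) ` {m1..<part eta 0}) + card (Pair (1::nat) ` {..<part eta 1})"
        by (simp only:) (rule card_Un_disjoint, auto)
      then show ?thesis using 2 sum il(3) by (simp add: card_image inj_on_def part_def)
    next
      case 3
      then have e: "{x \<in> diagram eta. two_row_tableau eta m1 x = i + 1} = {}"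
        by (auto simp: two_row_tableau_def)
      show ?thesis unfolding e using 3 by (simp add: part_def)
    qed
  qed
qed

lemma kostka_number_two_parts:
  assumes "is_partition eta" "sum_list eta = m1 + m2"
  shows "kostka_number eta [m1, m2] = (if interlaced eta m1 then 1 else 0)"
proof -
  have "{T \<in> ssyt eta. \<forall>i. card {x \<in> diagram eta. T x = i + 1} = part [m1, m2] i}
      = (if interlaced eta m1 then {two_row_tableau eta m1} else {})"
  proof (cases "interlaced eta m1")
    case True
    have "T = two_row_tableau eta m1"
      if "T \<in> ssyt eta" "\<forall>i. card {x \<in> diagram eta. T x = i + 1} = part [m1, m2] i" for T
      using two_row_tableau_unique[OF assms(1) that(1)] that(2) by blast
    then show ?thesis using two_row_tableau_exists[OF assms True] True by (simp only: if_True) blast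
  next
    case False
    have "interlaced eta m1"
      if "T \<in> ssyt eta" "\<forall>i. card {x \<in> diagram eta. T x = i + 1} = part [m1, m2] i" for T
      using two_row_tableau_unique[OF assms(1) that(1)] that(2) by blast
    then show ?thesis using False by (simp only: if_False) blast
  qed
  then show ?thesis by (simp add: kostka_number_def)
qed

section \<open>Transport of the coefficients and two-row Kostka-Foulkes polynomials\<close>

lemma gauss_hom:
  fixes \<phi> :: "'a::comm_ring_1 \<Rightarrow> 'b::comm_ring_1"
  assumes "\<phi> 0 = 0" "\<phi> 1 = 1" "\<And>a b. \<phi> (a + b) = \<phi> a + \<phi> b" "\<And>a b. \<phi> (a * b) = \<phi> a * \<phi> b"
  shows "\<phi> (gauss t n p) = gauss (\<phi> t) n p"
proof -
  have "\<phi> (a ^ m) = \<phi> a ^ m" for a m by (induction m) (simp_all add: assms)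
  then show ?thesis by (induction t n p rule: gauss.induct) (simp_all add: assms)
qed

text \<open>Applied to \<open>coef\<close>, which sends the indeterminate to \<open>tvar\<close>,
  and to the evaluation of integer polynomials in a field.\<close>

lemma hh_coeff_hom:
  fixes \<phi> :: "'a::comm_ring_1 \<Rightarrow> 'b::comm_ring_1"
  assumes "\<phi> 0 = 0" "\<phi> 1 = 1" "\<And>a b. \<phi> (a + b) = \<phi> a + \<phi> b" "\<And>a b. \<phi> (a * b) = \<phi> a * \<phi> b"
  shows "\<phi> (hh_coeff t p cs) = hh_coeff (\<phi> t) p cs"
proof -
  have pow: "\<phi> (a ^ m) = \<phi> a ^ m" for a m by (induction m) (simp_all add: assms)
  have "\<phi> (pieri_coeff t ls ms) = pieri_coeff (\<phi> t) ls ms" for ls ms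
    by (induction t ls ms rule: pieri_coeff.induct) (simp_all add: assms pow gauss_hom[of \<phi>, OF assms])
  moreover have "\<phi> (sum f A) = (\<Sum>a\<in>A. \<phi> (f a))" for f :: "nat list \<Rightarrow> 'a" and A
    by (induction A rule: infinite_finite_induct) (simp_all add: assms)
  ultimately show ?thesis by (simp add: hh_coeff_def assms pow)
qed

text \<open>With \<open>sum_list lam\<close> columns there is room for every partition of that
  size.\<close>

definition hh_poly :: "nat \<Rightarrow> nat list \<Rightarrow> int poly" where
  "hh_poly p lam = hh_coeff [:0, 1:] p (cols_of (sum_list lam) lam)"

text \<open>For \<open>p \<le> N\<close> both sides are \<open>h_p h_(N-p)\<close>: at
  \<open>t = 0\<close> its coefficients are \<open>0\<close> or \<open>1\<close> and select the
  interlaced shapes, at \<open>tvar\<close> they come from \<open>hh_poly\<close>. For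
  \<open>p > N\<close> both sides vanish.\<close>

lemma sum_interlaced_schur:
  "(\<Sum>eta\<in>partitions_of N. if interlaced eta p then schur n eta else 0)
    = (\<Sum>lam\<in>partitions_of N. coef (hh_poly p lam) * hall_littlewood_P n lam)"
proof -
  have c: "of_cols (cols_of N lam) = lam" if "lam \<in> partitions_of N" for lam
    using that member_le_sum_list by (intro of_cols_cols_of) (auto simp: partitions_of_def)
  have "(\<Sum>eta\<in>partitions_of N. if interlaced eta p then schur n eta else 0)
      = (\<Sum>eta\<in>partitions_of N. hh_coeff 0 p (cols_of N eta) * hl_cols 0 xvar (cols_of N eta) {..<n})"
  proof (intro sum.cong refl)
    fix eta assume eta: "eta \<in> partitions_of N"
    then have "schur n eta = hl_cols 0 xvar (cols_of N eta) {..<n}"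
      using schur_of_cols[OF decreasing_cols_of, of n N eta] c by simp
    moreover have "hh_coeff 0 p (cols_of N eta) = (if interlaced eta p then 1 else (0 :: xpoly fract))"
      using eta by (intro hh_coeff_at_0_cols_of) (auto simp: partitions_of_def)
    ultimately show "(if interlaced eta p then schur n eta else 0)
        = hh_coeff 0 p (cols_of N eta) * hl_cols 0 xvar (cols_of N eta) {..<n}" by simp
  qed
  also have "\<dots> = (\<Sum>cs\<in>cols N N. hh_coeff 0 p cs * hl_cols 0 xvar cs {..<n})"
    by (rule sum_partitions_of) simp
  also have "\<dots> = (\<Sum>cs\<in>cols N N. hh_coeff tvar p cs * hl_cols tvar xvar cs {..<n})"
    by (rule cauchy_transfer[OF hall_littlewood_0 hall_littlewood_tvar]) simp_all
  also have "\<dots> = (\<Sum>lam\<in>partitions_of N. hh_coeff tvar p (cols_of N lam) * hl_cols tvar xvar (cols_of N lam) {..<n})"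
    by (rule sum_partitions_of[symmetric]) simp
  also have "\<dots> = (\<Sum>lam\<in>partitions_of N. coef (hh_poly p lam) * hall_littlewood_P n lam)"
  proof (intro sum.cong refl)
    fix lam assume lam: "lam \<in> partitions_of N"
    then have "hall_littlewood_P n lam = hl_cols tvar xvar (cols_of N lam) {..<n}"
      using hall_littlewood_P_of_cols[OF decreasing_cols_of, of n N lam] c by simp
    moreover have "coef (hh_poly p lam) = hh_coeff tvar p (cols_of N lam)"
      using lam hh_coeff_hom[of coef "[:0, 1:]"]
      by (simp add: hh_poly_def partitions_of_def tvar_def coef_add coef_mult)
    ultimately show "hh_coeff tvar p (cols_of N lam) * hl_cols tvar xvar (cols_of N lam) {..<n}
        = coef (hh_poly p lam) * hall_littlewood_P n lam" by simp
  qed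
  finally show ?thesis .
qed

text \<open>The uniqueness demanded by the definite description is linear independence on the union
  of the two supports.\<close>

lemma kostka_foulkes_eqI:
  assumes "finite {lam. K lam \<noteq> 0}" "\<And>lam. K lam \<noteq> 0 \<Longrightarrow> is_partition lam"
    and "\<And>n. schur n eta = (\<Sum>lam | K lam \<noteq> 0. coef (K lam) * hall_littlewood_P n lam)"
  shows "kostka_foulkes eta = K"
  unfolding kostka_foulkes_def
proof (rule the_equality)
  show "finite {lam. K lam \<noteq> 0} \<and> (\<forall>lam. K lam \<noteq> 0 \<longrightarrow> is_partition lam) \<and>
    (\<forall>n. schur n eta = (\<Sum>lam | K lam \<noteq> 0. coef (K lam) * hall_littlewood_P n lam))"
    using assms by blast
next
  fix K' assume K': "finite {lam. K' lam \<noteq> 0} \<and> (\<forall>lam. K' lam \<noteq> 0 \<longrightarrow> is_partition lam) \<and>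
    (\<forall>n. schur n eta = (\<Sum>lam | K' lam \<noteq> 0. coef (K' lam) * hall_littlewood_P n lam))"
  let ?F = "{lam. K lam \<noteq> 0} \<union> {lam. K' lam \<noteq> 0}"
  have extend: "(\<Sum>lam | G lam \<noteq> 0. coef (G lam) * hall_littlewood_P n lam)
      = (\<Sum>lam\<in>?F. coef (G lam) * hall_littlewood_P n lam)"
    if "{lam. G lam \<noteq> 0} \<subseteq> ?F" for G n
    using that assms(1) K' by (intro sum.mono_neutral_left) auto
  have "K lam - K' lam = 0" if "lam \<in> ?F" for lam
  proof (rule hall_littlewood_P_independent[of ?F "\<lambda>lam. K lam - K' lam"])
    show "(\<Sum>lam\<in>?F. coef (K lam - K' lam) * hall_littlewood_P n lam) = 0" for n
      using K' assms(3)[of n] extend[of K n] extend[of K' n]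
      by (simp add: coef_diff left_diff_distrib sum_subtractf)
  qed (use that K' assms in auto)
  then show "K' = K" by (intro ext) (metis (mono_tags, lifting) Un_iff eq_iff_diff_eq_0 mem_Collect_eq)
qed

lemma kostka_foulkes_two_rows:
  assumes "eta \<in> partitions_of N" "length eta \<le> 2"
  shows "kostka_foulkes eta lam
    = (if lam \<in> partitions_of N then hh_poly (part eta 0) lam - hh_poly (Suc (part eta 0)) lam else 0)"
    (is "_ = ?K lam")
    and "schur n eta = (\<Sum>lam\<in>partitions_of N. coef (kostka_foulkes eta lam) * hall_littlewood_P n lam)"
proof -
  let ?q = "part eta 0"
  have part: "is_partition eta" "sum_list eta = N" using assms(1) by (auto simp: partitions_of_def)
  \<comment> \<open>Since \<open>N - ?q \<le> ?q\<close>, a shape of size \<open>N\<close> is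
    interlaced at \<open>?q\<close> but not at \<open>?q + 1\<close> exactly when it has at most two
    rows and its first row is \<open>?q\<close>. All other shapes cancel.\<close>
  have diff: "(if interlaced nu ?q then z else 0) - (if interlaced nu (Suc ?q) then z else 0)
      = (if nu = eta then z else (0 :: xpoly fract))" if "nu \<in> partitions_of N" for nu z
  proof -
    have nu: "is_partition nu" "sum_list nu = N" using that by (auto simp: partitions_of_def)
    have eta: "?q + part eta 1 = N" "part eta 1 \<le> ?q"
      using sum_list_two_rows[OF assms(2)] part part_antimono[of eta 0 1] by auto
    show ?thesis
    proof (cases "length nu \<le> 2")
      case True
      then have s: "part nu 0 + part nu 1 = N" using sum_list_two_rows nu by simp
      have "nu = eta" if "part nu 0 = ?q"
      proof (rule partition_eqI[OF nu(1) part(1) True assms(2)])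
        fix i :: nat assume "i < 2"
        then have "i = 0 \<or> i = 1" by auto
        then show "part nu i = part eta i" using that s eta by auto
      qed
      then have "nu = eta \<longleftrightarrow> part nu 0 = ?q" by auto
      then show ?thesis using True s eta by (auto simp: interlaced_def)
    next
      case False
      then show ?thesis using assms(2) by (auto simp: interlaced_def)
    qed
  qed
  have schur: "schur n eta = (\<Sum>lam\<in>partitions_of N. coef (?K lam) * hall_littlewood_P n lam)" for n
  proof -
    have "schur n eta = (\<Sum>nu\<in>partitions_of N. if nu = eta then schur n nu else 0)"
      using assms(1) by simp
    also have "\<dots> = (\<Sum>nu\<in>partitions_of N. (if interlaced nu ?q then schur n nu else 0)
        - (if interlaced nu (Suc ?q) then schur n nu else 0))"
      by (intro sum.cong refl) (simp only: diff)
    also have "\<dots> = (\<Sum>lam\<in>partitions_of N. coef (?K lam) * hall_littlewood_P n lam)"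
      by (simp add: sum_subtractf sum_interlaced_schur coef_diff left_diff_distrib)
    finally show ?thesis .
  qed
  have sub: "{lam. ?K lam \<noteq> 0} \<subseteq> partitions_of N" by auto
  have KF: "kostka_foulkes eta = ?K"
  proof (rule kostka_foulkes_eqI)
    show "finite {lam. ?K lam \<noteq> 0}" by (rule finite_subset[OF sub]) simp
    show "is_partition lam" if "?K lam \<noteq> 0" for lam
      using that by (auto simp: partitions_of_def split: if_splits)
    show "schur n eta = (\<Sum>lam | ?K lam \<noteq> 0. coef (?K lam) * hall_littlewood_P n lam)" for n
      unfolding schur by (rule sum.mono_neutral_right[OF _ sub]) auto
  qed
  show "kostka_foulkes eta lam = ?K lam" unfolding KF ..
  show "schur n eta = (\<Sum>lam\<in>partitions_of N. coef (kostka_foulkes eta lam) * hall_littlewood_P n lam)"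
    unfolding KF by (rule schur)
qed

text \<open>The sum of the Schur functions weighted by Kostka numbers is expanded shape by shape
  and, by \<open>sum_interlaced_schur\<close>, as a whole; independence compares the
  coefficients.\<close>

theorem cal_P_two_parts:
  assumes "is_partition lam" "sum_list lam = m1 + m2"
  shows "cal_P lam [m1, m2] = hh_poly m1 lam"
proof -
  let ?N = "m1 + m2"
  let ?c = "\<lambda>eta. of_nat (kostka_number eta [m1, m2])"
  let ?E = "\<lambda>mu. (\<Sum>eta\<in>partitions_of ?N. ?c eta * kostka_foulkes eta mu) - hh_poly m1 mu"
  have k: "kostka_number eta [m1, m2] = (if interlaced eta m1 then 1 else 0)" if "eta \<in> partitions_of ?N" for eta
    using that by (intro kostka_number_two_parts) (auto simp: partitions_of_def)
  have "?E lam = 0"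
  proof (rule hall_littlewood_P_independent[of "partitions_of ?N" ?E])
    fix n
    have "(\<Sum>mu\<in>partitions_of ?N. coef (\<Sum>eta\<in>partitions_of ?N. ?c eta * kostka_foulkes eta mu) * hall_littlewood_P n mu)
        = (\<Sum>eta\<in>partitions_of ?N. ?c eta * (\<Sum>mu\<in>partitions_of ?N. coef (kostka_foulkes eta mu) * hall_littlewood_P n mu))"
      unfolding coef_sum coef_mult coef_of_nat sum_distrib_left sum_distrib_right mult.assoc by (rule sum.swap)
    also have "\<dots> = (\<Sum>eta\<in>partitions_of ?N. if interlaced eta m1 then schur n eta else 0)"
    proof (intro sum.cong refl)
      fix eta assume eta: "eta \<in> partitions_of ?N"
      show "?c eta * (\<Sum>mu\<in>partitions_of ?N. coef (kostka_foulkes eta mu) * hall_littlewood_P n mu)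
          = (if interlaced eta m1 then schur n eta else 0)"
      \<comment> \<open>Shapes with more than two rows, whose Kostka-Foulkes polynomials are not
        computed, fall under the second case, where the Kostka number is \<open>0\<close>.\<close>
      proof (cases "interlaced eta m1")
        case True
        then show ?thesis
          using kostka_foulkes_two_rows(2)[OF eta, of n] k[OF eta] by (simp add: interlaced_def)
      qed (simp add: k[OF eta])
    qed
    finally show "(\<Sum>mu\<in>partitions_of ?N. coef (?E mu) * hall_littlewood_P n mu) = 0"
      by (simp add: sum_interlaced_schur coef_diff left_diff_distrib sum_subtractf)
  next
    show "finite (partitions_of ?N)" by simp
  qed (use assms in \<open>auto simp: partitions_of_def\<close>)
  then show ?thesis by (simp add: cal_P_def assms(2))
qed


section \<open>Supernomial coefficients\<close>

lemma pieri_coeff_snoc_0: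
  "length ls = length ms \<Longrightarrow> pieri_coeff t (ls @ [0]) (ms @ [m]) = (if m = 0 then pieri_coeff t ls ms else 0)"
proof (induction ls ms rule: list_induct2)
  case (Cons l ls m' ms)
  have "hd0 (ms @ [0]) = hd0 ms" by (cases ms) auto
  then show ?case using Cons by (simp split: if_splits)
qed (simp add: numeral_2_eq_2)

text \<open>A zero column of \<open>\<lambda>\<close> forces one in the intermediate partition. This
  reconciles the number of columns in \<open>hh_poly\<close> with the \<open>k\<close> of the
  supernomial.\<close>

lemma hh_coeff_snoc_0: "hh_coeff t p (cs @ [0]) = hh_coeff t p cs"
proof -
  let ?k = "length cs" and ?f = "\<lambda>ms. ms @ [0 :: nat]"
  let ?g = "\<lambda>ms. t ^ (\<Sum>m\<leftarrow>ms. m choose 2) * pieri_coeff t (cs @ [0]) ms"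
  have "hh_coeff t p (cs @ [0]) = (\<Sum>ms\<in>cols (Suc ?k) p. ?g ms)"
    by (simp add: hh_coeff_def)
  also have "\<dots> = (\<Sum>ms\<in>?f ` cols ?k p. ?g ms)"
  proof (rule sum.mono_neutral_right)
    show "?f ` cols ?k p \<subseteq> cols (Suc ?k) p"
      by (auto simp: cols_def lists_sum_def sorted_wrt_append)
    show "\<forall>ms\<in>cols (Suc ?k) p - ?f ` cols ?k p. ?g ms = 0"
    proof
      fix ms assume ms: "ms \<in> cols (Suc ?k) p - ?f ` cols ?k p"
      then have "length ms = Suc ?k" by (auto simp: cols_def lists_sum_def)
      then obtain ms' m where m: "ms = ms' @ [m]" "length ms' = ?k" by (metis length_Suc_conv_rev)
      then have "m \<noteq> 0" using ms by (auto simp: cols_def lists_sum_def sorted_wrt_append)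
      then show "?g ms = 0" using m by (simp add: pieri_coeff_snoc_0)
    qed
  qed simp
  also have "\<dots> = (\<Sum>ms\<in>cols ?k p. ?g (?f ms))"
    by (subst sum.reindex) (auto simp: inj_on_def)
  also have "\<dots> = hh_coeff t p cs"
    unfolding hh_coeff_def
    by (intro sum.cong refl) (auto simp: pieri_coeff_snoc_0 cols_def lists_sum_def numeral_2_eq_2)
  finally show ?thesis .
qed

lemma hh_coeff_cols_of:
  assumes "\<And>q. q \<in> set lam \<Longrightarrow> q \<le> k"
  shows "hh_coeff t p (cols_of (k + d) lam) = hh_coeff t p (cols_of k lam)"
proof (induction d)
  case (Suc d)
  have "{r. r < length lam \<and> Suc (k + d) \<le> lam ! r} = {}"
    using assms by (auto dest!: nth_mem) fastforce
  then have "cols_of (k + Suc d) lam = cols_of (k + d) lam @ [0]"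
    by (simp add: cols_of_def conj_part_def)
  then show ?case using Suc.IH by (simp add: hh_coeff_snoc_0)
qed simp

lemma hd0_part: "hd0 ms = part ms 0"
  by (cases ms) (simp_all add: part_def)

lemma part_Cons [simp]: "part (m # ms) 0 = m" "part (m # ms) (Suc i) = part ms i"
  by (simp_all add: part_def)

text \<open>\<open>part\<close> reads \<open>0\<close> past the end of a list, which gives the last
  factor the same form as the others.\<close>

lemma pieri_coeff_prod:
  "length ls = length ms \<Longrightarrow> (\<And>i. part ms i \<le> part ls i) \<Longrightarrow>
   pieri_coeff u ls ms = (\<Prod>i<length ms. u ^ ((part ls i - part ms i) choose 2)
      * gauss u (part ls i - part ms (Suc i)) (part ms i - part ms (Suc i)))"
proof (induction ls ms rule: list_induct2)
  case (Cons l ls m ms)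
  have "part ms i \<le> part ls i" for i using Cons.prems[of "Suc i"] by simp
  moreover have "m \<le> l" using Cons.prems[of 0] by simp
  ultimately show ?case using Cons.IH by (simp add: prod.lessThan_Suc_shift hd0_part del: prod.lessThan_Suc)
qed simp

lemma pieri_coeff_not_contained:
  "length ls = length ms \<Longrightarrow> \<not> part ms i \<le> part ls i \<Longrightarrow> pieri_coeff u ls ms = 0"
proof (induction ls ms arbitrary: i rule: list_induct2)
  case (Cons l ls m ms)
  then show ?case by (cases i) auto
qed (simp add: part_def)

lemma sum_list_map_part: "(\<Sum>c\<leftarrow>cs. f c) = (\<Sum>i<length cs. f (part cs i))"
  by (simp add: sum_list_sum_nth atLeast0LessThan part_def)

lemma decreasing_part: "decreasing cs \<Longrightarrow> part cs (Suc i) \<le> part cs i"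
  by (auto simp: part_def sorted_wrt_iff_nth_less)

section \<open>Matching the intermediate partitions with the summation variables
  \<open>j_l\<close>\<close>

lemma telescope_nat:
  fixes f :: "nat \<Rightarrow> nat"
  assumes "\<And>i. f (Suc i) \<le> f i" "m \<le> n"
  shows "(\<Sum>i=m..<n. f i - f (Suc i)) = f m - f n \<and> f n \<le> f m"
  using assms(2)
proof (induction n rule: dec_induct)
  case (step n)
  then show ?case using assms(1)[of n] by auto
qed simp

text \<open>Abel summation; for the column lengths it yields
  \<open>|\<lambda>| = \<Sum> i L_i\<close>.\<close>

lemma weighted_telescope_nat:
  fixes f :: "nat \<Rightarrow> nat"
  assumes "\<And>i. f (Suc i) \<le> f i"
  shows "(\<Sum>i<n. Suc i * (f i - f (Suc i))) + n * f n = (\<Sum>i<n. f i)"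
proof (induction n)
  case (Suc n)
  have "Suc n * (f n - f (Suc n)) + Suc n * f (Suc n) = Suc n * f n"
    using assms[of n] by (simp flip: distrib_left)
  then show ?case using Suc by simp
qed simp

lemma sum_1_to: "(\<Sum>l=1..k. g l) = (\<Sum>i<k. g (Suc i))"
  by (rule sum.reindex_bij_witness[of _ Suc "\<lambda>l. l - 1"]) auto

text \<open>Here \<open>c\<close>, \<open>m\<close>, \<open>m'\<close> are
  \<open>\<lambda>'_l\<close>, \<open>\<nu>'_l\<close>, \<open>\<nu>'_(l+1)\<close>. The inverse
  powers reduce \<open>c choose 2\<close> to \<open>m (c - m)\<close>, the inverted Gaussian
  binomial uses up \<open>(m - m') (c - m)\<close>, and \<open>m' (c - m)\<close> remains. With
  \<open>j_l = c - m\<close> and \<open>m' = L_(l+1) + ... + L_k - j_(l+1)\<close> this is a term of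
  the supernomial exponent.\<close>

lemma term_inversion:
  fixes t :: "'a::field"
  assumes "not_root_of_unity t" "t \<noteq> 0" "m' \<le> m" "m \<le> c"
  shows "t ^ (c choose 2) * inverse t ^ (m choose 2) * (inverse t ^ ((c - m) choose 2) * gauss (inverse t) (c - m') (m - m'))
       = t ^ (m' * (c - m)) * t_binomial t (c - m') (c - m)"
proof -
  let ?d = "c - m" and ?n = "c - m'" and ?p = "m - m'"
  have pd: "?n - ?p = ?d" "?p \<le> ?n" "?n - ?d = ?p" "?d \<le> ?n" using assms by auto
  have "c choose 2 = (m choose 2) + (?d choose 2) + m * ?d"
    using choose_two_add[of m ?d] assms(4) by simp
  then have "t ^ (c choose 2) * inverse t ^ (m choose 2) * inverse t ^ (?d choose 2) = t ^ (m * ?d)"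
    using assms(2) by (simp add: power_add power_inverse field_simps)
  moreover have "m * ?d = m' * ?d + ?p * ?d"
    using assms(3) by (simp flip: distrib_right)
  ultimately have "t ^ (c choose 2) * inverse t ^ (m choose 2) * (inverse t ^ (?d choose 2) * gauss (inverse t) ?n ?p)
      = t ^ (m' * ?d) * (t ^ (?p * (?n - ?p)) * gauss (inverse t) ?n ?p)"
    unfolding pd(1) by (simp add: power_add mult_ac)
  also have "\<dots> = t ^ (m' * ?d) * gauss t ?n ?p"
    by (simp only: gauss_inverse[OF assms(1,2) pd(2)])
  also have "gauss t ?n ?p = t_binomial t ?n ?d"
    using gauss_symmetric[OF assms(1) pd(4)] unfolding pd(3) by (simp add: gauss_eq_t_binomial[OF assms(1)])
  finally show ?thesis .
qed

text \<open>Under \<open>j_l = \<lambda>'_l - \<nu>'_l\<close> the condition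
  \<open>j_l \<le> L_l + j_(l+1)\<close> says \<open>\<nu>'_(l+1) \<le> \<nu>'_l\<close>. So the
  binomials are nonzero exactly when \<open>j\<close> comes from a partition \<open>\<nu>\<close>
  inside \<open>\<lambda>\<close>, of size \<open>p\<close> if the \<open>j_l\<close> sum to
  \<open>q\<close>.\<close>

theorem supernomial_eq_hh_coeff:
  fixes t :: "'a::field"
  assumes t: "not_root_of_unity t" "t \<noteq> 0"
    and cs: "decreasing cs" "length cs = k" "1 \<le> k" "sum_list cs = p + q"
    and L: "\<And>i. i < k \<Longrightarrow> L (Suc i) = part cs i - part cs (Suc i)"
    and a: "of_nat q = of_nat (sum_list cs) / 2 + a"
  shows "supernomial t k L a = t ^ (\<Sum>c\<leftarrow>cs. c choose 2) * hh_coeff (inverse t) p cs"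
proof -
  let ?c = "part cs"
  obtain k' where k': "k = Suc k'" using cs(3) by (cases k) auto
  have c_dec: "?c (Suc i) \<le> ?c i" for i by (rule decreasing_part[OF cs(1)])
  have c_out: "?c i = 0" if "i \<ge> k" for i using that cs(2) by (simp add: part_def)
  have sum_c: "(\<Sum>i<k. ?c i) = p + q"
    using sum_list_map_part[of "\<lambda>c. c" cs] cs by simp
  have "(\<Sum>i=1..k. i * L i) = (\<Sum>i<k. Suc i * (?c i - ?c (Suc i)))"
    unfolding sum_1_to using L by simp
  also have "\<dots> = p + q"
    using weighted_telescope_nat[of ?c k, OF c_dec] c_out[of k] sum_c by simp
  finally have size: "(\<Sum>i=1..k. i * L i) = p + q" .
  have L': "L i = ?c (i - 1) - ?c i" if "1 \<le> i" "i \<le> k" for i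
    using L[of "i - 1"] that by simp
  have L_tail: "(\<Sum>i=l..k. L i) = ?c (l - 1)" if "1 \<le> l" "l \<le> k" for l
  proof -
    have "(\<Sum>i=l..k. L i) = (\<Sum>i=l - 1..<k. ?c i - ?c (Suc i))"
      using that by (intro sum.reindex_bij_witness[of _ Suc "\<lambda>i. i - 1"]) (auto simp: L')
    then show ?thesis using telescope_nat[of ?c "l - 1" k, OF c_dec] c_out[of k] that by simp
  qed
  define F where "F j = t powi (\<Sum>l=2..k. int (j (l - 1)) * (int (\<Sum>i=l..k. L i) - int (j l))) *
        t_binomial t (L k) (j k) * (\<Prod>l=1..<k. t_binomial t (L l + j (l + 1)) (j l))" for j
  define J where "J = {j \<in> {1..k} \<rightarrow>\<^sub>E (UNIV :: nat set). (\<Sum>l=1..k. j l) = q}"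
  \<comment> \<open>\<open>J0\<close> keeps the indices for which no binomial is \<open>0\<close> by
    convention, \<open>M0\<close> the partitions contained in \<open>\<lambda>\<close>. Between
    these two sets the truncated subtractions are inverse to each other.\<close>
  define J0 where "J0 = {j \<in> J. j k \<le> L k \<and> (\<forall>l\<in>{1..<k}. j l \<le> L l + j (l + 1))}"
  define M0 where "M0 = {ms \<in> cols k p. \<forall>i. part ms i \<le> ?c i}"
  let ?u = "inverse t"
  let ?G = "\<lambda>ms. t ^ (\<Sum>c\<leftarrow>cs. c choose 2) * (?u ^ (\<Sum>m\<leftarrow>ms. m choose 2) * pieri_coeff ?u cs ms)"
  have cond: "of_nat s = a + of_nat (\<Sum>i=1..k. i * L i) / 2 \<longleftrightarrow> s = q" for s
  proof -
    have "a + of_nat (\<Sum>i=1..k. i * L i) / 2 = of_nat q" unfolding size a cs(4) by simp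
    then show ?thesis by simp
  qed
  have "supernomial t k L a = sum F J"
    unfolding supernomial_def F_def J_def cond by (rule sum.cong) auto
  also have "\<dots> = sum F J0"
  proof (rule sum.mono_neutral_right)
    \<comment> \<open>The index functions are unbounded a priori; the prescribed sum bounds each
      value and makes the index set finite.\<close>
    have "J \<subseteq> {1..k} \<rightarrow>\<^sub>E {..q}"
    proof
      fix j assume "j \<in> J"
      then have j: "j \<in> {1..k} \<rightarrow>\<^sub>E (UNIV :: nat set)" "(\<Sum>l=1..k. j l) = q" by (auto simp: J_def)
      have "j l \<le> q" if "l \<in> {1..k}" for l
        unfolding j(2)[symmetric] using that by (intro member_le_sum) auto
      then show "j \<in> {1..k} \<rightarrow>\<^sub>E {..q}" using j(1) by (auto simp: PiE_iff)
    qed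
    then show "finite J" by (rule finite_subset) (intro finite_PiE; simp)
    show "\<forall>j\<in>J - J0. F j = 0"
    proof
      fix j assume "j \<in> J - J0"
      then have "\<not> j k \<le> L k \<or> (\<exists>l\<in>{1..<k}. \<not> j l \<le> L l + j (l + 1))" by (auto simp: J0_def)
      then show "F j = 0"
      proof
        assume "\<exists>l\<in>{1..<k}. \<not> j l \<le> L l + j (l + 1)"
        then have "(\<Prod>l=1..<k. t_binomial t (L l + j (l + 1)) (j l)) = 0"
          by (intro prod_zero) (auto simp: t_binomial_def)
        then show ?thesis by (simp add: F_def)
      qed (simp add: F_def t_binomial_def)
    qed
  qed (auto simp: J0_def)
  also have "\<dots> = sum ?G M0"
  proof (rule sum.reindex_bij_witness[of _ "\<lambda>ms. \<lambda>l\<in>{1..k}. ?c (l - 1) - part ms (l - 1)"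
        "\<lambda>j. map (\<lambda>i. ?c i - j (Suc i)) [0..<k]"])
    fix j assume j: "j \<in> J0"
    let ?ms = "map (\<lambda>i. ?c i - j (Suc i)) [0..<k]"
    have jE: "j \<in> {1..k} \<rightarrow>\<^sub>E (UNIV :: nat set)" and jsum: "(\<Sum>i<k. j (Suc i)) = q"
      using j unfolding J0_def J_def sum_1_to by auto
    have jL: "j (Suc i) \<le> L (Suc i) + j (Suc (Suc i))" if "Suc i < k" for i
      using j that by (auto simp: J0_def)
    have jc: "j (Suc i) \<le> ?c i" if "i < k" for i
    proof -
      have "i \<le> k'" using that k' by simp
      then show ?thesis
      \<comment> \<open>The bound starts at the last column, from \<open>j k \<le> L k\<close>, and
        travels to the left through \<open>jL\<close>.\<close>
      proof (induction i rule: inc_induct)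
        case base
        then show ?case using j L[of k'] c_out[of k] by (simp add: J0_def k')
      next
        case (step i)
        then show ?case using jL[of i] L[of i] c_dec[of i] by (simp add: k')
      qed
    qed
    have part_ms: "part ?ms i = (if i < k then ?c i - j (Suc i) else 0)" for i
      by (simp add: part_def)
    show "(\<lambda>l\<in>{1..k}. ?c (l - 1) - part ?ms (l - 1)) = j"
    proof
      fix l show "(\<lambda>l\<in>{1..k}. ?c (l - 1) - part ?ms (l - 1)) l = j l"
      proof (cases "l \<in> {1..k}")
        case True
        then have "l - 1 < k" by auto
        then show ?thesis using True jc[of "l - 1"] by (simp add: part_ms)
      next
        case False
        then show ?thesis using PiE_arb[OF jE False] by (simp only: restrict_apply if_False)
      qed
    qed
    have "decreasing ?ms"
    proof -
      have "?c (Suc i) - j (Suc (Suc i)) \<le> ?c i - j (Suc i)" if "Suc i < k" for i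
        using jL[OF that] jc[of i] jc[of "Suc i"] L[of i] c_dec[of i] that by simp
      then show ?thesis by (subst sorted_wrt_iff_nth_Suc_transp) (auto simp: transp_def)
    qed
    moreover have "sum_list ?ms = p"
    proof -
      have "sum_list ?ms = (\<Sum>i<k. ?c i - j (Suc i))"
        by (simp add: interv_sum_list_conv_sum_set_nat atLeast0LessThan)
      also have "\<dots> = (\<Sum>i<k. ?c i) - (\<Sum>i<k. j (Suc i))"
        using jc by (intro sum_subtractf_nat) auto
      finally show ?thesis using sum_c jsum by simp
    qed
    ultimately show "?ms \<in> M0"
      by (auto simp: M0_def cols_def lists_sum_def part_ms)
    have "?G ms = F j"
      if len: "length ms = k" and dec: "decreasing ms" and m_le: "\<And>i. part ms i \<le> ?c i"
        and jm: "\<And>i. i < k \<Longrightarrow> j (Suc i) = ?c i - part ms i" for ms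
    proof -
      have m_dec: "part ms (Suc i) \<le> part ms i" for i by (rule decreasing_part[OF dec])
      have mk: "part ms k = 0" using len by (simp add: part_def)
      let ?e = "\<lambda>i. part ms (Suc i) * (?c i - part ms i)"
      let ?b = "\<lambda>i. t_binomial t (?c i - part ms (Suc i)) (?c i - part ms i)"
      have "?G ms = (\<Prod>i<k. t ^ (?c i choose 2) * ?u ^ (part ms i choose 2) *
          (?u ^ ((?c i - part ms i) choose 2) * gauss ?u (?c i - part ms (Suc i)) (part ms i - part ms (Suc i))))"
        using m_le cs(2)
        by (subst pieri_coeff_prod) (simp_all only: sum_list_map_part power_sum prod.distrib len mult_ac)
      also have "\<dots> = (\<Prod>i<k. t ^ ?e i * ?b i)"
        by (intro prod.cong refl term_inversion[OF t m_dec m_le])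
      also have "\<dots> = t ^ (\<Sum>i<k. ?e i) * (\<Prod>i<k. ?b i)"
        by (simp only: prod.distrib power_sum)
      \<comment> \<open>The last column has no successor, so its exponent is \<open>0\<close>; the
        other \<open>k - 1\<close> exponents match \<open>l = 2, ..., k\<close> in the
        supernomial.\<close>
      also have "(\<Sum>i<k. ?e i) = (\<Sum>i<k'. ?e i)"
        using mk unfolding k' sum.lessThan_Suc by (simp only: mult_zero_left add_0_right)
      also have "t ^ (\<Sum>i<k'. ?e i) = t powi (\<Sum>l=2..k. int (j (l - 1)) * (int (\<Sum>i=l..k. L i) - int (j l)))"
      proof -
        have "(\<Sum>l=2..k. int (j (l - 1)) * (int (\<Sum>i=l..k. L i) - int (j l))) = (\<Sum>i<k'. int (?e i))"
        proof (rule sum.reindex_bij_witness[of _ "\<lambda>i. i + 2" "\<lambda>l. l - 2"])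
          fix l assume l: "l \<in> {2..k}"
          then obtain i where i: "l = Suc (Suc i)" "Suc i < k" by (metis Suc_le_eq add_2_eq_Suc atLeastAtMost_iff le_Suc_ex)
          have "int (\<Sum>i=l..k. L i) - int (j l) = int (part ms (Suc i))"
            using L_tail[of l] l jm[of "Suc i"] m_le[of "Suc i"] i by simp
          then show "int (?e (l - 2)) = int (j (l - 1)) * (int (\<Sum>i=l..k. L i) - int (j l))"
            using jm[of i] i by (simp only:) simp
        qed (auto simp: k')
        then show ?thesis by (simp only: of_nat_sum[symmetric] power_int_of_nat)
      qed
      also have "(\<Prod>i<k. ?b i) = t_binomial t (L k) (j k) * (\<Prod>l=1..<k. t_binomial t (L l + j (l + 1)) (j l))"
      proof -
        have "?b k' = t_binomial t (L k) (j k)"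
          using mk L[of k'] c_out[of k] jm[of k'] unfolding k' by simp
        moreover have "(\<Prod>i<k'. ?b i) = (\<Prod>l=1..<k. t_binomial t (L l + j (l + 1)) (j l))"
        proof (rule prod.reindex_bij_witness[of _ "\<lambda>l. l - 1" Suc])
          fix i assume "i \<in> {..<k'}"
          then have "Suc i < k" by (simp add: k')
          then have "L (Suc i) + j (Suc i + 1) = ?c i - part ms (Suc i)" "j (Suc i) = ?c i - part ms i"
            using jm[of i] jm[of "Suc i"] L[of i] m_le[of "Suc i"] c_dec[of i] by simp_all
          then show "t_binomial t (L (Suc i) + j (Suc i + 1)) (j (Suc i)) = ?b i" by simp
        qed (auto simp: k')
        ultimately show ?thesis unfolding k' by (simp only: prod.lessThan_Suc mult.commute)
      qed
      finally show "?G ms = F j" by (simp only: F_def mult.assoc)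
    qed
    from this[of ?ms] show "?G ?ms = F j"
      using \<open>decreasing ?ms\<close> jc part_ms by simp
  next
    fix ms assume ms: "ms \<in> M0"
    let ?j = "\<lambda>l\<in>{1..k}. ?c (l - 1) - part ms (l - 1)"
    have len: "length ms = k" and dec: "decreasing ms" and sum: "sum_list ms = p" and le: "\<And>i. part ms i \<le> ?c i"
      using ms by (auto simp: M0_def cols_def lists_sum_def)
    have m_dec: "part ms (Suc i) \<le> part ms i" for i by (rule decreasing_part[OF dec])
    have j: "?j (Suc i) = ?c i - part ms i" if "i < k" for i using that by simp
    show "map (\<lambda>i. ?c i - ?j (Suc i)) [0..<k] = ms"
    proof (rule nth_equalityI)
      fix i assume "i < length (map (\<lambda>i. ?c i - ?j (Suc i)) [0..<k])"
      then show "map (\<lambda>i. ?c i - ?j (Suc i)) [0..<k] ! i = ms ! i"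
        using le[of i] len cs(2) by (simp add: part_def)
    qed (simp add: len)
    have "(\<Sum>l=1..k. ?j l) = q"
    proof -
      have "(\<Sum>l=1..k. ?j l) = (\<Sum>i<k. ?c i - part ms i)"
        unfolding sum_1_to by (intro sum.cong refl) simp
      also have "\<dots> = (\<Sum>i<k. ?c i) - (\<Sum>i<k. part ms i)"
        using le by (intro sum_subtractf_nat) auto
      also have "(\<Sum>i<k. part ms i) = p" using sum_list_map_part[of "\<lambda>c. c" ms] len sum by simp
      finally show ?thesis using sum_c by simp
    qed
    then have "?j \<in> J" by (auto simp: J_def)
    moreover have "?j k \<le> L k"
      using j[of k'] L[of k'] c_out[of k] by (simp add: k')
    moreover have "?j l \<le> L l + ?j (l + 1)" if l: "l \<in> {1..<k}" for l
    proof -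
      obtain i where i: "l = Suc i" "Suc i < k" using l by (cases l) auto
      then show ?thesis
        using j[of i] j[of "Suc i"] L[of i] le[of i] le[of "Suc i"] m_dec[of i] c_dec[of i] by simp
    qed
    ultimately show "?j \<in> J0" unfolding J0_def by blast
  qed
  also have "\<dots> = sum ?G (cols k p)"
  proof (rule sum.mono_neutral_left)
    show "\<forall>ms\<in>cols k p - M0. ?G ms = 0"
    proof
      fix ms assume ms: "ms \<in> cols k p - M0"
      then obtain i where "\<not> part ms i \<le> ?c i" by (auto simp: M0_def)
      moreover have "length cs = length ms" using ms cs(2) by (auto simp: cols_def lists_sum_def)
      ultimately have "pieri_coeff ?u cs ms = 0" by (intro pieri_coeff_not_contained)
      then show "?G ms = 0" by simp
    qed
  qed (auto simp: M0_def)
  also have "\<dots> = t ^ (\<Sum>c\<leftarrow>cs. c choose 2) * hh_coeff ?u p cs"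
    by (simp add: hh_coeff_def cs(2) sum_distrib_left)
  finally show ?thesis .
qed

section \<open>Evaluation of integer polynomials and assembly of the result\<close>

lemma eval_int_poly_0 [simp]: "eval_int_poly 0 x = 0" and eval_int_poly_1 [simp]: "eval_int_poly 1 x = 1"
  by (simp_all add: eval_int_poly_def)

lemma eval_int_poly_pCons: "eval_int_poly (pCons a p) x = of_int a + x * eval_int_poly p x"
  by (cases "a = 0 \<and> p = 0") (auto simp: eval_int_poly_def map_poly_pCons)

lemma eval_int_poly_add: "eval_int_poly (p + q) x = eval_int_poly p x + eval_int_poly q x"
proof (induction p arbitrary: q)
  case (pCons a p)
  show ?case by (cases q) (simp add: eval_int_poly_pCons pCons.IH distrib_left)
qed simp

lemma eval_int_poly_smult: "eval_int_poly (smult c p) x = of_int c * eval_int_poly p x"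
  by (induction p) (simp_all add: eval_int_poly_pCons algebra_simps)

lemma eval_int_poly_mult: "eval_int_poly (p * q) x = eval_int_poly p x * eval_int_poly q x"
  by (induction p)
     (simp_all add: eval_int_poly_pCons eval_int_poly_add eval_int_poly_smult mult_pCons_left algebra_simps)

lemma eval_int_poly_sum: "eval_int_poly (sum f A) x = (\<Sum>a\<in>A. eval_int_poly (f a) x)"
  by (induction A rule: infinite_finite_induct) (simp_all add: eval_int_poly_add)

lemma eval_int_poly_of_nat: "eval_int_poly (of_nat n) x = of_nat n"
  by (induction n) (simp_all add: eval_int_poly_add)

lemma not_root_of_unity_t_indet: "not_root_of_unity t_indet"
  unfolding not_root_of_unity_def
proof (intro allI impI notI)
  fix j :: nat assume "j > 0" "t_indet ^ j = 1"
  then have "[:0, 1:] ^ j = (1 :: int poly)"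
    unfolding t_indet_def to_fract_power[symmetric] to_fract_1[symmetric] to_fract_eq_iff by simp
  then have "poly ([:0, 1:] ^ j) 0 = (1 :: int)" by simp
  then show False using \<open>j > 0\<close> by (simp add: poly_power power_0_left)
qed

lemma t_indet_nonzero: "t_indet \<noteq> 0"
  by (simp add: t_indet_def)

text \<open>Either of \<open>sum_list lam\<close> and \<open>k\<close> may be larger, so both column
  lists are extended to length \<open>sum_list lam + k\<close>.\<close>

lemma eval_hh_poly:
  assumes "\<And>q. q \<in> set lam \<Longrightarrow> q \<le> k"
  shows "eval_int_poly (hh_poly p lam) x = hh_coeff x p (cols_of k lam)"
proof -
  let ?N = "sum_list lam"
  have "eval_int_poly (hh_poly p lam) x = hh_coeff x p (cols_of (?N + k) lam)"
    unfolding hh_poly_def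
    by (subst hh_coeff_hom[of "\<lambda>p. eval_int_poly p x"])
       (simp_all add: eval_int_poly_add eval_int_poly_mult eval_int_poly_pCons hh_coeff_cols_of member_le_sum_list)
  also have "\<dots> = hh_coeff x p (cols_of k lam)"
    using hh_coeff_cols_of[OF assms, where d = ?N and t = x and p = p] by (simp add: add.commute)
  finally show ?thesis .
qed

theorem mainTheorem5:
  fixes k :: nat and lam :: "nat list" and L :: "nat \<Rightarrow> nat" and a :: rat and m1 m2 :: nat
  assumes "1 \<le> k"
    and "is_partition lam"
    and "part lam 0 \<le> k"
    and "\<And>i. 1 \<le> i \<Longrightarrow> i \<le> k \<Longrightarrow> L i = conj_part lam i - conj_part lam (i + 1)"
    and "of_nat m1 = of_nat (sum_list lam) / 2 - a"
    and "of_nat m2 = of_nat (sum_list lam) / 2 + a"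
  shows "supernomial t_indet k L a =
           (\<Sum>eta \<in> partitions_of (sum_list lam).
              of_nat (kostka_number eta [m1, m2]) * kostka_foulkes_tilde eta lam t_indet) \<and>
         (\<Sum>eta \<in> partitions_of (sum_list lam).
              of_nat (kostka_number eta [m1, m2]) * kostka_foulkes_tilde eta lam t_indet) =
           t_indet ^ n_stat lam * eval_int_poly (cal_P lam [m1, m2]) (inverse t_indet)"
proof -
  let ?N = "sum_list lam" and ?t = t_indet
  let ?cs = "cols_of k lam"
  have N: "?N = m1 + m2"
  proof -
    have "(of_nat (m1 + m2) :: rat) = of_nat ?N" using assms(5,6) by simp
    then show ?thesis by (simp only: of_nat_eq_iff)
  qed
  have parts: "q \<le> k" if q: "q \<in> set lam" for q
  proof -
    obtain i where "i < length lam" "q = lam ! i" using q by (auto simp: in_set_conv_nth)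
    then show ?thesis using part_antimono[OF assms(2), of 0 i] assms(3) by (simp add: part_def split: if_splits)
  qed
  have lam: "of_cols ?cs = lam" by (rule of_cols_cols_of[OF assms(2) parts])
  have cs: "decreasing ?cs" "sum_list ?cs = ?N" "n_stat lam = (\<Sum>c\<leftarrow>?cs. c choose 2)"
    using of_cols_partition[OF decreasing_cols_of, of k lam] n_stat_of_cols[OF decreasing_cols_of, of k lam] lam
    by (simp_all add: decreasing_cols_of)
  have "L (Suc i) = part ?cs i - part ?cs (Suc i)" if "i < k" for i
  proof -
    have "conj_part lam (Suc i) = part ?cs i" for i
      using conj_part_of_cols[OF decreasing_cols_of, of k lam i] unfolding lam by (simp add: part_def)
    then show ?thesis using assms(4)[of "Suc i"] that by simp
  qed
  \<comment> \<open>The \<open>j_l\<close> sum to \<open>a + |\<lambda>|/2 = m2\<close>, so the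
    intermediate partition has size \<open>m1\<close>.\<close>
  then have "supernomial ?t k L a = ?t ^ n_stat lam * hh_coeff (inverse ?t) m1 ?cs"
    unfolding cs(3) using assms(1,6) cs N
    by (intro supernomial_eq_hh_coeff[OF not_root_of_unity_t_indet t_indet_nonzero, where q = m2]) simp_all
  also have "\<dots> = ?t ^ n_stat lam * eval_int_poly (cal_P lam [m1, m2]) (inverse ?t)"
    using cal_P_two_parts[OF assms(2) N] eval_hh_poly[OF parts, of lam m1 "inverse ?t"] by simp
  finally have 1: "supernomial ?t k L a = \<dots>" .
  have 2: "(\<Sum>eta\<in>partitions_of ?N. of_nat (kostka_number eta [m1, m2]) * kostka_foulkes_tilde eta lam ?t)
      = ?t ^ n_stat lam * eval_int_poly (cal_P lam [m1, m2]) (inverse ?t)"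
    by (simp add: cal_P_def kostka_foulkes_tilde_def eval_int_poly_sum eval_int_poly_mult eval_int_poly_of_nat
        sum_distrib_left mult_ac)
  show ?thesis using 1 2 by simp
qed

end
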